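(* Let $\mathscr{T}$ be a $\mathscr{J}$-theory and $\mathscr{C}$ a $\mathscr{V}$-category with $\mathscr{J}$-powers. There is a fully faithful $\mathscr{V}'$-functor $$\mathsf{Y}:\mathscr{T}\text{-}\mathrm{Alg}(\mathscr{C})\longrightarrow[\mathscr{C}^{\mathrm{op}},\mathscr{T}\text{-}\mathrm{Alg}]$$ given by $\mathsf{Y}E=\llbracket -,E\rrbracket$.
   Context: Setting. $\mathscr{V}=(\mathscr{V},\otimes,I)$ is a symmetric monoidal closed category whose underlying ordinary category has finite limits. $\mathscr{V}$-categories may be large; $\mathscr{V}'$ is a symmetric monoidal closed category that has all limits and colimits that are small relative to a larger universe (for which all $\mathscr{V}$-categories considered are small), equipped with a fully faithful symmetric strong monoidal embedding $\mathscr{V}\hookrightarrow\mathscr{V}'$ that preserves all limits that exist in $\mathscr{V}$. $[\mathscr{C},\mathscr{D}]$ denotes the $\mathscr{V}'$-category of $\mathscr{V}$-functors $\mathscr{C}\to\mathscr{D}$. Systems of arities and theories. $\mathscr{J}\hookrightarrow\mathscr{V}$ is a system of arities, i.e. a full sub-$\mathscr{V}$-category closed under $\otimes$ and containing $I$. A power $C^X$ in a $\mathscr{V}$-category $\mathscr{C}$ is an object with $\mathscr{V}$-natural isomorphisms $\mathscr{C}(B,C^X)\cong\mathscr{V}(X,\mathscr{C}(B,C))$; $\mathscr{C}$ has $\mathscr{J}$-powers if it is equipped with a designated power $C^J$ for all $J\in\mathscr{J}$, $C\in\mathscr{C}$ (with $C^I=C$, and with counit $I\to\mathscr{C}(C,C)$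 the identity). A $\mathscr{J}$-theory is a $\mathscr{V}$-category $\mathscr{T}$ with $\mathrm{ob}\,\mathscr{T}=\mathrm{ob}\,\mathscr{J}$, equipped with an identity-on-objects $\mathscr{V}$-functor $\mathscr{J}^{\mathrm{op}}\to\mathscr{T}$ that preserves $\mathscr{J}$-powers. Algebras. A $\mathscr{T}$-algebra in a $\mathscr{V}$-category $\mathscr{C}$ with $\mathscr{J}$-powers is a $\mathscr{V}$-functor $\mathscr{T}\to\mathscr{C}$ that preserves $\mathscr{J}$-powers; $\mathscr{T}\text{-}\mathrm{Alg}(\mathscr{C})$ is the full sub-$\mathscr{V}'$-category of $[\mathscr{T},\mathscr{C}]$ on these, and $\mathscr{T}\text{-}\mathrm{Alg}=\mathscr{T}\text{-}\mathrm{Alg}(\mathscr{V})$, with $G^{\mathscr{T}}:\mathscr{T}\text{-}\mathrm{Alg}\to\mathscr{V}$ evaluation at $I$. Throughout, $\mathscr{J}$ is amenable: for every $\mathscr{J}$-theory $\mathscr{T}$, $\mathscr{T}\text{-}\mathrm{Alg}$ exists as a $\mathscr{V}$-category and $G^{\mathscr{T}}$ has a left adjoint. Notation for this statement. $\llbracket -,?\rrbracket:\mathscr{C}^{\mathrm{op}}\otimes\mathscr{T}\text{-}\mathrm{Alg}(\mathscr{C})\to\mathscr{T}\text{-}\mathrm{Alg}$ is the $\mathscr{V}'$-functor $\llbracket C,E\rrbracket=\mathscr{C}(C,E-):\mathscr{T}\to\mathscr{V}$; in particular each $\mathscr{T}$-algebra $E:\mathscr{T}\to\mathscr{C}$ determines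 a $\mathscr{V}$-functor $\llbracket -,E\rrbracket:\mathscr{C}^{\mathrm{op}}\to\mathscr{T}\text{-}\mathrm{Alg}$.
   Formalization: The embedding of V in V′ is additionally assumed to preserve internal homs (powers counted among the limits that exist in V, as in Kelly's universe enlargement); if only ordinary limits are preserved, Y can fail to be fully faithful. *)

theory Defs
  imports "HOL-Library.FuncSet"
begin

section \<open>Ordinary categories, limits and colimits\<close>

record ('o, 'a) category =
  Obj :: "'o set"
  Arr :: "'a set"
  Dom :: "'a \<Rightarrow> 'o"
  Cod :: "'a \<Rightarrow> 'o"
  Idn :: "'o \<Rightarrow> 'a"
  Comp :: "'a \<Rightarrow> 'a \<Rightarrow> 'a" (infixr "\<cdot>\<index>" 55)

definition Hom :: "('o, 'a, 'm) category_scheme \<Rightarrow> 'o \<Rightarrow> 'o \<Rightarrow> 'a set" where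
  "Hom K x y = {f \<in> Arr K. Dom K f = x \<and> Cod K f = y}"

definition is_category :: "('o, 'a, 'm) category_scheme \<Rightarrow> bool" where
  "is_category K \<longleftrightarrow>
     (\<forall>f\<in>Arr K. Dom K f \<in> Obj K \<and> Cod K f \<in> Obj K) \<and>
     (\<forall>x\<in>Obj K. Idn K x \<in> Hom K x x) \<and>
     (\<forall>f\<in>Arr K. \<forall>g\<in>Arr K. Cod K f = Dom K g \<longrightarrow> g \<cdot>\<^bsub>K\<^esub> f \<in> Hom K (Dom K f) (Cod K g)) \<and>
     (\<forall>f\<in>Arr K. f \<cdot>\<^bsub>K\<^esub> Idn K (Dom K f) = f \<and> Idn K (Cod K f) \<cdot>\<^bsub>K\<^esub> f = f) \<and>
     (\<forall>f\<in>Arr K. \<forall>g\<in>Arr K. \<forall>h\<in>Arr K. Cod K f = Dom K g \<and> Cod K g = Dom K h \<longrightarrow>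
        (h \<cdot>\<^bsub>K\<^esub> g) \<cdot>\<^bsub>K\<^esub> f = h \<cdot>\<^bsub>K\<^esub> (g \<cdot>\<^bsub>K\<^esub> f))"

definition is_inverse :: "('o, 'a, 'm) category_scheme \<Rightarrow> 'a \<Rightarrow> 'a \<Rightarrow> bool" where
  "is_inverse K f g \<longleftrightarrow>
     g \<in> Hom K (Cod K f) (Dom K f) \<and>
     g \<cdot>\<^bsub>K\<^esub> f = Idn K (Dom K f) \<and> f \<cdot>\<^bsub>K\<^esub> g = Idn K (Cod K f)"

definition is_iso :: "('o, 'a, 'm) category_scheme \<Rightarrow> 'a \<Rightarrow> bool" where
  "is_iso K f \<longleftrightarrow> f \<in> Arr K \<and> (\<exists>g. is_inverse K f g)"

definition inverse_arr :: "('o, 'a, 'm) category_scheme \<Rightarrow> 'a \<Rightarrow> 'a" where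
  "inverse_arr K f = (THE g. is_inverse K f g)"

definition is_functor ::
  "('i, 'j, 'm) category_scheme \<Rightarrow> ('o, 'a, 'n) category_scheme \<Rightarrow> ('i \<Rightarrow> 'o) \<Rightarrow> ('j \<Rightarrow> 'a) \<Rightarrow> bool" where
  "is_functor D K Fo Fa \<longleftrightarrow>
     (\<forall>d\<in>Obj D. Fo d \<in> Obj K) \<and>
     (\<forall>u\<in>Arr D. Fa u \<in> Hom K (Fo (Dom D u)) (Fo (Cod D u))) \<and>
     (\<forall>d\<in>Obj D. Fa (Idn D d) = Idn K (Fo d)) \<and>
     (\<forall>u\<in>Arr D. \<forall>v\<in>Arr D. Cod D u = Dom D v \<longrightarrow> Fa (v \<cdot>\<^bsub>D\<^esub> u) = Fa v \<cdot>\<^bsub>K\<^esub> Fa u)"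

definition is_cone ::
  "('i, 'j, 'm) category_scheme \<Rightarrow> ('o, 'a, 'n) category_scheme \<Rightarrow> ('i \<Rightarrow> 'o) \<Rightarrow> ('j \<Rightarrow> 'a) \<Rightarrow>
   'o \<Rightarrow> ('i \<Rightarrow> 'a) \<Rightarrow> bool" where
  "is_cone D K Fo Fa L p \<longleftrightarrow>
     L \<in> Obj K \<and> (\<forall>d\<in>Obj D. p d \<in> Hom K L (Fo d)) \<and>
     (\<forall>u\<in>Arr D. Fa u \<cdot>\<^bsub>K\<^esub> p (Dom D u) = p (Cod D u))"

definition is_limit ::
  "('i, 'j, 'm) category_scheme \<Rightarrow> ('o, 'a, 'n) category_scheme \<Rightarrow> ('i \<Rightarrow> 'o) \<Rightarrow> ('j \<Rightarrow> 'a) \<Rightarrow>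
   'o \<Rightarrow> ('i \<Rightarrow> 'a) \<Rightarrow> bool" where
  "is_limit D K Fo Fa L p \<longleftrightarrow>
     is_cone D K Fo Fa L p \<and>
     (\<forall>L' p'. is_cone D K Fo Fa L' p' \<longrightarrow>
        (\<exists>!h. h \<in> Hom K L' L \<and> (\<forall>d\<in>Obj D. p d \<cdot>\<^bsub>K\<^esub> h = p' d)))"

definition opposite :: "('o, 'a, 'm) category_scheme \<Rightarrow> ('o, 'a) category" where
  "opposite K = \<lparr>Obj = Obj K, Arr = Arr K, Dom = Cod K, Cod = Dom K, Idn = Idn K,
                 Comp = (\<lambda>g f. f \<cdot>\<^bsub>K\<^esub> g)\<rparr>"

text \<open>A finite category is isomorphic to one whose objects and arrows are natural numbers.\<close>
definition has_finite_limits :: "('o, 'a, 'm) category_scheme \<Rightarrow> bool" where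
  "has_finite_limits K \<longleftrightarrow>
     (\<forall>(D :: (nat, nat) category) Fo Fa.
        is_category D \<and> finite (Obj D) \<and> finite (Arr D) \<and> is_functor D K Fo Fa \<longrightarrow>
        (\<exists>L p. is_limit D K Fo Fa L p))"

text \<open>
  Size. A type \<open>'u\<close> stands for the bound on sizes that the larger universe provides: a set is small
  if it injects into \<open>'u\<close>, and a small diagram is, up to isomorphism of its shape, one whose shape
  has its objects and arrows in \<open>'u\<close>. The only closure property asked of \<open>'u\<close> is infinitude (which
  gives closure under binary products). A Grothendieck universe in which given categories are
  small provides limits and colimits of these sizes for any \<open>'u\<close> whose cardinality belongs to it.
\<close>
definition is_small :: "'u itself \<Rightarrow> 'c set \<Rightarrow> bool" where
  "is_small U S \<longleftrightarrow> (\<exists>f :: 'c \<Rightarrow> 'u. inj_on f S)"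

definition has_limits :: "'u itself \<Rightarrow> ('o, 'a, 'm) category_scheme \<Rightarrow> bool" where
  "has_limits U K \<longleftrightarrow>
     (\<forall>(D :: ('u, 'u) category) Fo Fa.
        is_category D \<and> is_functor D K Fo Fa \<longrightarrow> (\<exists>L p. is_limit D K Fo Fa L p))"

definition has_colimits :: "'u itself \<Rightarrow> ('o, 'a, 'm) category_scheme \<Rightarrow> bool" where
  "has_colimits U K \<longleftrightarrow> has_limits U (opposite K)"


section \<open>Symmetric monoidal closed categories\<close>

text \<open>The internal hom \<open>IHom x y\<close> represents the maps out of \<open>- \<otimes> x\<close>.\<close>
record ('o, 'a) smcc = "('o, 'a) category" +
  Tens :: "'o \<Rightarrow> 'o \<Rightarrow> 'o" (infixr "\<otimes>\<index>" 70)
  TensA :: "'a \<Rightarrow> 'a \<Rightarrow> 'a" (infixr "\<boxtimes>\<index>" 70)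
  TUnit :: "'o"
  Assoc :: "'o \<Rightarrow> 'o \<Rightarrow> 'o \<Rightarrow> 'a"
  LUnit :: "'o \<Rightarrow> 'a"
  RUnit :: "'o \<Rightarrow> 'a"
  Symm :: "'o \<Rightarrow> 'o \<Rightarrow> 'a"
  IHom :: "'o \<Rightarrow> 'o \<Rightarrow> 'o"
  Eval :: "'o \<Rightarrow> 'o \<Rightarrow> 'a"

definition is_smcc :: "('o, 'a) smcc \<Rightarrow> bool" where
  "is_smcc V \<longleftrightarrow>
     is_category V \<and>
     \<comment> \<open>the tensor product is a functor\<close>
     (\<forall>x\<in>Obj V. \<forall>y\<in>Obj V. x \<otimes>\<^bsub>V\<^esub> y \<in> Obj V \<and> Idn V x \<boxtimes>\<^bsub>V\<^esub> Idn V y = Idn V (x \<otimes>\<^bsub>V\<^esub> y)) \<and>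
     (\<forall>f\<in>Arr V. \<forall>g\<in>Arr V.
        f \<boxtimes>\<^bsub>V\<^esub> g \<in> Hom V (Dom V f \<otimes>\<^bsub>V\<^esub> Dom V g) (Cod V f \<otimes>\<^bsub>V\<^esub> Cod V g)) \<and>
     (\<forall>f\<in>Arr V. \<forall>g\<in>Arr V. \<forall>f'\<in>Arr V. \<forall>g'\<in>Arr V. Cod V f = Dom V f' \<and> Cod V g = Dom V g' \<longrightarrow>
        (f' \<cdot>\<^bsub>V\<^esub> f) \<boxtimes>\<^bsub>V\<^esub> (g' \<cdot>\<^bsub>V\<^esub> g) = (f' \<boxtimes>\<^bsub>V\<^esub> g') \<cdot>\<^bsub>V\<^esub> (f \<boxtimes>\<^bsub>V\<^esub> g)) \<and>
     TUnit V \<in> Obj V \<and>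
     \<comment> \<open>structural isomorphisms and their naturality\<close>
     (\<forall>x\<in>Obj V. \<forall>y\<in>Obj V. \<forall>z\<in>Obj V. is_iso V (Assoc V x y z) \<and>
        Assoc V x y z \<in> Hom V ((x \<otimes>\<^bsub>V\<^esub> y) \<otimes>\<^bsub>V\<^esub> z) (x \<otimes>\<^bsub>V\<^esub> (y \<otimes>\<^bsub>V\<^esub> z))) \<and>
     (\<forall>x\<in>Obj V. is_iso V (LUnit V x) \<and> LUnit V x \<in> Hom V (TUnit V \<otimes>\<^bsub>V\<^esub> x) x) \<and>
     (\<forall>x\<in>Obj V. is_iso V (RUnit V x) \<and> RUnit V x \<in> Hom V (x \<otimes>\<^bsub>V\<^esub> TUnit V) x) \<and>
     (\<forall>x\<in>Obj V. \<forall>y\<in>Obj V. Symm V x y \<in> Hom V (x \<otimes>\<^bsub>V\<^esub> y) (y \<otimes>\<^bsub>V\<^esub> x)) \<and>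
     (\<forall>f\<in>Arr V. \<forall>g\<in>Arr V. \<forall>h\<in>Arr V.
        Assoc V (Cod V f) (Cod V g) (Cod V h) \<cdot>\<^bsub>V\<^esub> ((f \<boxtimes>\<^bsub>V\<^esub> g) \<boxtimes>\<^bsub>V\<^esub> h) =
        (f \<boxtimes>\<^bsub>V\<^esub> (g \<boxtimes>\<^bsub>V\<^esub> h)) \<cdot>\<^bsub>V\<^esub> Assoc V (Dom V f) (Dom V g) (Dom V h)) \<and>
     (\<forall>f\<in>Arr V. LUnit V (Cod V f) \<cdot>\<^bsub>V\<^esub> (Idn V (TUnit V) \<boxtimes>\<^bsub>V\<^esub> f) = f \<cdot>\<^bsub>V\<^esub> LUnit V (Dom V f)) \<and>
     (\<forall>f\<in>Arr V. RUnit V (Cod V f) \<cdot>\<^bsub>V\<^esub> (f \<boxtimes>\<^bsub>V\<^esub> Idn V (TUnit V)) = f \<cdot>\<^bsub>V\<^esub> RUnit V (Dom V f)) \<and>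
     (\<forall>f\<in>Arr V. \<forall>g\<in>Arr V.
        Symm V (Cod V f) (Cod V g) \<cdot>\<^bsub>V\<^esub> (f \<boxtimes>\<^bsub>V\<^esub> g) = (g \<boxtimes>\<^bsub>V\<^esub> f) \<cdot>\<^bsub>V\<^esub> Symm V (Dom V f) (Dom V g)) \<and>
     \<comment> \<open>coherence: pentagon, triangle, symmetry, hexagon\<close>
     (\<forall>w\<in>Obj V. \<forall>x\<in>Obj V. \<forall>y\<in>Obj V. \<forall>z\<in>Obj V.
        (Idn V w \<boxtimes>\<^bsub>V\<^esub> Assoc V x y z) \<cdot>\<^bsub>V\<^esub> Assoc V w (x \<otimes>\<^bsub>V\<^esub> y) z \<cdot>\<^bsub>V\<^esub> (Assoc V w x y \<boxtimes>\<^bsub>V\<^esub> Idn V z) =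
        Assoc V w x (y \<otimes>\<^bsub>V\<^esub> z) \<cdot>\<^bsub>V\<^esub> Assoc V (w \<otimes>\<^bsub>V\<^esub> x) y z) \<and>
     (\<forall>x\<in>Obj V. \<forall>y\<in>Obj V.
        (Idn V x \<boxtimes>\<^bsub>V\<^esub> LUnit V y) \<cdot>\<^bsub>V\<^esub> Assoc V x (TUnit V) y = RUnit V x \<boxtimes>\<^bsub>V\<^esub> Idn V y) \<and>
     (\<forall>x\<in>Obj V. \<forall>y\<in>Obj V. Symm V y x \<cdot>\<^bsub>V\<^esub> Symm V x y = Idn V (x \<otimes>\<^bsub>V\<^esub> y)) \<and>
     (\<forall>x\<in>Obj V. \<forall>y\<in>Obj V. \<forall>z\<in>Obj V.
        Assoc V y z x \<cdot>\<^bsub>V\<^esub> Symm V x (y \<otimes>\<^bsub>V\<^esub> z) \<cdot>\<^bsub>V\<^esub> Assoc V x y z =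
        (Idn V y \<boxtimes>\<^bsub>V\<^esub> Symm V x z) \<cdot>\<^bsub>V\<^esub> Assoc V y x z \<cdot>\<^bsub>V\<^esub> (Symm V x y \<boxtimes>\<^bsub>V\<^esub> Idn V z)) \<and>
     \<comment> \<open>closedness\<close>
     (\<forall>x\<in>Obj V. \<forall>y\<in>Obj V. IHom V x y \<in> Obj V \<and> Eval V x y \<in> Hom V (IHom V x y \<otimes>\<^bsub>V\<^esub> x) y) \<and>
     (\<forall>x\<in>Obj V. \<forall>y\<in>Obj V. \<forall>z\<in>Obj V. \<forall>f\<in>Hom V (z \<otimes>\<^bsub>V\<^esub> x) y.
        \<exists>!g. g \<in> Hom V z (IHom V x y) \<and> Eval V x y \<cdot>\<^bsub>V\<^esub> (g \<boxtimes>\<^bsub>V\<^esub> Idn V x) = f)"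

definition transpose_arr :: "('o, 'a) smcc \<Rightarrow> 'o \<Rightarrow> 'o \<Rightarrow> 'o \<Rightarrow> 'a \<Rightarrow> 'a" where
  "transpose_arr V z x y f =
     (THE g. g \<in> Hom V z (IHom V x y) \<and> Eval V x y \<cdot>\<^bsub>V\<^esub> (g \<boxtimes>\<^bsub>V\<^esub> Idn V x) = f)"

text \<open>The element \<open>I \<rightarrow> IHom x y\<close> corresponding to an arrow \<open>f : x \<rightarrow> y\<close>.\<close>
definition name_of :: "('o, 'a) smcc \<Rightarrow> 'a \<Rightarrow> 'a" where
  "name_of V f = transpose_arr V (TUnit V) (Dom V f) (Cod V f) (f \<cdot>\<^bsub>V\<^esub> LUnit V (Dom V f))"

record ('o, 'a, 'p, 'b) mon_functor =
  MOb :: "'o \<Rightarrow> 'p"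
  MArr :: "'a \<Rightarrow> 'b"
  Mu :: "'o \<Rightarrow> 'o \<Rightarrow> 'b"
  Eps :: "'b"

definition is_symmetric_strong_monoidal ::
  "('o, 'a) smcc \<Rightarrow> ('p, 'b) smcc \<Rightarrow> ('o, 'a, 'p, 'b) mon_functor \<Rightarrow> bool" where
  "is_symmetric_strong_monoidal V W M \<longleftrightarrow>
     is_functor V W (MOb M) (MArr M) \<and>
     is_iso W (Eps M) \<and> Eps M \<in> Hom W (TUnit W) (MOb M (TUnit V)) \<and>
     (\<forall>x\<in>Obj V. \<forall>y\<in>Obj V. is_iso W (Mu M x y) \<and>
        Mu M x y \<in> Hom W (MOb M x \<otimes>\<^bsub>W\<^esub> MOb M y) (MOb M (x \<otimes>\<^bsub>V\<^esub> y))) \<and>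
     (\<forall>f\<in>Arr V. \<forall>g\<in>Arr V.
        Mu M (Cod V f) (Cod V g) \<cdot>\<^bsub>W\<^esub> (MArr M f \<boxtimes>\<^bsub>W\<^esub> MArr M g) =
        MArr M (f \<boxtimes>\<^bsub>V\<^esub> g) \<cdot>\<^bsub>W\<^esub> Mu M (Dom V f) (Dom V g)) \<and>
     (\<forall>x\<in>Obj V. \<forall>y\<in>Obj V. \<forall>z\<in>Obj V.
        MArr M (Assoc V x y z) \<cdot>\<^bsub>W\<^esub> Mu M (x \<otimes>\<^bsub>V\<^esub> y) z \<cdot>\<^bsub>W\<^esub> (Mu M x y \<boxtimes>\<^bsub>W\<^esub> Idn W (MOb M z)) =
        Mu M x (y \<otimes>\<^bsub>V\<^esub> z) \<cdot>\<^bsub>W\<^esub> (Idn W (MOb M x) \<boxtimes>\<^bsub>W\<^esub> Mu M y z) \<cdot>\<^bsub>W\<^esub>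
          Assoc W (MOb M x) (MOb M y) (MOb M z)) \<and>
     (\<forall>x\<in>Obj V. MArr M (LUnit V x) \<cdot>\<^bsub>W\<^esub> Mu M (TUnit V) x \<cdot>\<^bsub>W\<^esub> (Eps M \<boxtimes>\<^bsub>W\<^esub> Idn W (MOb M x)) =
        LUnit W (MOb M x)) \<and>
     (\<forall>x\<in>Obj V. MArr M (RUnit V x) \<cdot>\<^bsub>W\<^esub> Mu M x (TUnit V) \<cdot>\<^bsub>W\<^esub> (Idn W (MOb M x) \<boxtimes>\<^bsub>W\<^esub> Eps M) =
        RUnit W (MOb M x)) \<and>
     (\<forall>x\<in>Obj V. \<forall>y\<in>Obj V.
        MArr M (Symm V x y) \<cdot>\<^bsub>W\<^esub> Mu M x y = Mu M y x \<cdot>\<^bsub>W\<^esub> Symm W (MOb M x) (MOb M y))"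

definition is_fully_faithful ::
  "('o, 'a, 'm) category_scheme \<Rightarrow> ('p, 'b, 'n) category_scheme \<Rightarrow> ('o \<Rightarrow> 'p) \<Rightarrow> ('a \<Rightarrow> 'b) \<Rightarrow> bool" where
  "is_fully_faithful V W Fo Fa \<longleftrightarrow>
     (\<forall>x\<in>Obj V. \<forall>y\<in>Obj V. bij_betw Fa (Hom V x y) (Hom W (Fo x) (Fo y)))"

text \<open>
  Preservation of all limits that exist in \<open>V\<close> is meant in the enriched sense, for which it amounts
  to preservation of conical limits and of powers. The conical limits are the ordinary limits
  that exist in \<open>V\<close>; their shapes have objects and arrows in an arbitrary type \<open>'i\<close>. The power
  of \<open>y\<close> by \<open>x\<close> in \<open>V\<close> is the internal hom \<open>IHom V x y\<close>, and its preservation says that the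
  canonical comparison of internal homs is invertible, i.e. that \<open>M\<close> exhibits \<open>V\<close> as a full
  subcategory of \<open>W\<close> in the sense enriched in \<open>W\<close> (as in Kelly's enlargement of the universe).
\<close>
definition preserves_limits ::
  "'i itself \<Rightarrow> ('o, 'a) smcc \<Rightarrow> ('p, 'b) smcc \<Rightarrow> ('o, 'a, 'p, 'b) mon_functor \<Rightarrow> bool" where
  "preserves_limits X V W M \<longleftrightarrow>
     (\<forall>(D :: ('i, 'i) category) Fo Fa L p.
        is_category D \<and> is_functor D V Fo Fa \<and> is_limit D V Fo Fa L p \<longrightarrow>
        is_limit D W (\<lambda>d. MOb M (Fo d)) (\<lambda>u. MArr M (Fa u)) (MOb M L) (\<lambda>d. MArr M (p d))) \<and>
     (\<forall>x\<in>Obj V. \<forall>y\<in>Obj V.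
        is_iso W (transpose_arr W (MOb M (IHom V x y)) (MOb M x) (MOb M y)
          (MArr M (Eval V x y) \<cdot>\<^bsub>W\<^esub> Mu M (IHom V x y) x)))"


section \<open>Enriched categories and functors\<close>

text \<open>\<open>VComp A x y z : A(y,z) \<otimes> A(x,y) \<rightarrow> A(x,z)\<close> and \<open>VId A x : I \<rightarrow> A(x,x)\<close>.\<close>
record ('o, 'a, 'c) vcat =
  VOb :: "'c set"
  VHom :: "'c \<Rightarrow> 'c \<Rightarrow> 'o"
  VComp :: "'c \<Rightarrow> 'c \<Rightarrow> 'c \<Rightarrow> 'a"
  VId :: "'c \<Rightarrow> 'a"

definition is_vcat :: "('o, 'a) smcc \<Rightarrow> ('o, 'a, 'c) vcat \<Rightarrow> bool" where
  "is_vcat V A \<longleftrightarrow>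
     (\<forall>x\<in>VOb A. \<forall>y\<in>VOb A. VHom A x y \<in> Obj V) \<and>
     (\<forall>x\<in>VOb A. \<forall>y\<in>VOb A. \<forall>z\<in>VOb A.
        VComp A x y z \<in> Hom V (VHom A y z \<otimes>\<^bsub>V\<^esub> VHom A x y) (VHom A x z)) \<and>
     (\<forall>x\<in>VOb A. VId A x \<in> Hom V (TUnit V) (VHom A x x)) \<and>
     (\<forall>w\<in>VOb A. \<forall>x\<in>VOb A. \<forall>y\<in>VOb A. \<forall>z\<in>VOb A.
        VComp A w x z \<cdot>\<^bsub>V\<^esub> (VComp A x y z \<boxtimes>\<^bsub>V\<^esub> Idn V (VHom A w x)) =
        VComp A w y z \<cdot>\<^bsub>V\<^esub> (Idn V (VHom A y z) \<boxtimes>\<^bsub>V\<^esub> VComp A w x y) \<cdot>\<^bsub>V\<^esub>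
          Assoc V (VHom A y z) (VHom A x y) (VHom A w x)) \<and>
     (\<forall>x\<in>VOb A. \<forall>y\<in>VOb A.
        VComp A x y y \<cdot>\<^bsub>V\<^esub> (VId A y \<boxtimes>\<^bsub>V\<^esub> Idn V (VHom A x y)) = LUnit V (VHom A x y) \<and>
        VComp A x x y \<cdot>\<^bsub>V\<^esub> (Idn V (VHom A x y) \<boxtimes>\<^bsub>V\<^esub> VId A x) = RUnit V (VHom A x y))"

record ('a, 'c, 'd) vfun =
  FOb :: "'c \<Rightarrow> 'd"
  FHom :: "'c \<Rightarrow> 'c \<Rightarrow> 'a"

text \<open>
  Both components of a functor are required to be undefined off the objects of its domain, so that
  equality of functors is equality of records.
\<close>
definition restrict_vfun :: "('o, 'a, 'c) vcat \<Rightarrow> ('c \<Rightarrow> 'd) \<Rightarrow> ('c \<Rightarrow> 'c \<Rightarrow> 'a) \<Rightarrow> ('a, 'c, 'd) vfun" where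
  "restrict_vfun A Fo Fh = \<lparr>FOb = restrict Fo (VOb A),
     FHom = restrict (\<lambda>x. restrict (Fh x) (VOb A)) (VOb A)\<rparr>"

definition is_vfunctor ::
  "('o, 'a) smcc \<Rightarrow> ('o, 'a, 'c) vcat \<Rightarrow> ('o, 'a, 'd) vcat \<Rightarrow> ('a, 'c, 'd) vfun \<Rightarrow> bool" where
  "is_vfunctor V A B F \<longleftrightarrow>
     is_vcat V A \<and> is_vcat V B \<and> F = restrict_vfun A (FOb F) (FHom F) \<and>
     (\<forall>x\<in>VOb A. FOb F x \<in> VOb B) \<and>
     (\<forall>x\<in>VOb A. \<forall>y\<in>VOb A. FHom F x y \<in> Hom V (VHom A x y) (VHom B (FOb F x) (FOb F y))) \<and>
     (\<forall>x\<in>VOb A. FHom F x x \<cdot>\<^bsub>V\<^esub> VId A x = VId B (FOb F x)) \<and>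
     (\<forall>x\<in>VOb A. \<forall>y\<in>VOb A. \<forall>z\<in>VOb A.
        FHom F x z \<cdot>\<^bsub>V\<^esub> VComp A x y z =
        VComp B (FOb F x) (FOb F y) (FOb F z) \<cdot>\<^bsub>V\<^esub> (FHom F y z \<boxtimes>\<^bsub>V\<^esub> FHom F x y))"

definition vfully_faithful ::
  "('o, 'a) smcc \<Rightarrow> ('o, 'a, 'c) vcat \<Rightarrow> ('a, 'c, 'd) vfun \<Rightarrow> bool" where
  "vfully_faithful V A F \<longleftrightarrow> (\<forall>x\<in>VOb A. \<forall>y\<in>VOb A. is_iso V (FHom F x y))"

definition vid_fun :: "('o, 'a) smcc \<Rightarrow> ('o, 'a, 'c) vcat \<Rightarrow> ('a, 'c, 'c) vfun" where
  "vid_fun V A = restrict_vfun A (\<lambda>x. x) (\<lambda>x y. Idn V (VHom A x y))"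

text \<open>The composite of \<open>F : A \<rightarrow> B\<close> followed by \<open>G\<close>.\<close>
definition vfun_comp ::
  "('o, 'a) smcc \<Rightarrow> ('o, 'a, 'c) vcat \<Rightarrow> ('a, 'd, 'e) vfun \<Rightarrow> ('a, 'c, 'd) vfun \<Rightarrow> ('a, 'c, 'e) vfun" where
  "vfun_comp V A G F = restrict_vfun A (\<lambda>x. FOb G (FOb F x))
     (\<lambda>x y. FHom G (FOb F x) (FOb F y) \<cdot>\<^bsub>V\<^esub> FHom F x y)"

definition full_sub :: "('o, 'a, 'c) vcat \<Rightarrow> 'c set \<Rightarrow> ('o, 'a, 'c) vcat" where
  "full_sub A S = A\<lparr>VOb := S\<rparr>"

definition vop :: "('o, 'a) smcc \<Rightarrow> ('o, 'a, 'c) vcat \<Rightarrow> ('o, 'a, 'c) vcat" where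
  "vop V A = \<lparr>VOb = VOb A, VHom = (\<lambda>x y. VHom A y x),
     VComp = (\<lambda>x y z. VComp A z y x \<cdot>\<^bsub>V\<^esub> Symm V (VHom A z y) (VHom A y x)),
     VId = VId A\<rparr>"

text \<open>\<open>V\<close> as a category enriched in itself.\<close>
definition vself :: "('o, 'a) smcc \<Rightarrow> ('o, 'a, 'o) vcat" where
  "vself V = \<lparr>VOb = Obj V, VHom = IHom V,
     VComp = (\<lambda>x y z. transpose_arr V (IHom V y z \<otimes>\<^bsub>V\<^esub> IHom V x y) x z
       (Eval V y z \<cdot>\<^bsub>V\<^esub> (Idn V (IHom V y z) \<boxtimes>\<^bsub>V\<^esub> Eval V x y) \<cdot>\<^bsub>V\<^esub> Assoc V (IHom V y z) (IHom V x y) x)),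
     VId = (\<lambda>x. transpose_arr V (TUnit V) x x (LUnit V x))\<rparr>"

text \<open>\<open>A(b,-) : A \<rightarrow> V\<close> and \<open>A(-,b) : A\<^sup>o\<^sup>p \<rightarrow> V\<close>.\<close>
definition hom_from :: "('o, 'a) smcc \<Rightarrow> ('o, 'a, 'c) vcat \<Rightarrow> 'c \<Rightarrow> ('a, 'c, 'o) vfun" where
  "hom_from V A b = restrict_vfun A (\<lambda>x. VHom A b x)
     (\<lambda>x y. transpose_arr V (VHom A x y) (VHom A b x) (VHom A b y) (VComp A b x y))"

definition hom_to :: "('o, 'a) smcc \<Rightarrow> ('o, 'a, 'c) vcat \<Rightarrow> 'c \<Rightarrow> ('a, 'c, 'o) vfun" where
  "hom_to V A b = restrict_vfun A (\<lambda>x. VHom A x b)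
     (\<lambda>x y. transpose_arr V (VHom A y x) (VHom A x b) (VHom A y b)
        (VComp A y x b \<cdot>\<^bsub>V\<^esub> Symm V (VHom A y x) (VHom A x b)))"

text \<open>
  A natural family \<open>p x : W \<rightarrow> B(F x, G x)\<close> with vertex an object \<open>W\<close> of \<open>V\<close>, and the universal one,
  i.e. the end of \<open>B(F -, G -)\<close>. The naturality square is the transpose of the one whose corner is
  the internal hom from \<open>A(x,y)\<close> to \<open>B(F x, G y)\<close>.
\<close>
definition nat_family ::
  "('o, 'a) smcc \<Rightarrow> ('o, 'a, 'c) vcat \<Rightarrow> ('o, 'a, 'd) vcat \<Rightarrow> ('a, 'c, 'd) vfun \<Rightarrow> ('a, 'c, 'd) vfun \<Rightarrow>
   'o \<Rightarrow> ('c \<Rightarrow> 'a) \<Rightarrow> bool" where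
  "nat_family V A B F G W p \<longleftrightarrow>
     W \<in> Obj V \<and>
     (\<forall>x\<in>VOb A. p x \<in> Hom V W (VHom B (FOb F x) (FOb G x))) \<and>
     (\<forall>x\<in>VOb A. \<forall>y\<in>VOb A.
        VComp B (FOb F x) (FOb F y) (FOb G y) \<cdot>\<^bsub>V\<^esub> (p y \<boxtimes>\<^bsub>V\<^esub> FHom F x y) =
        VComp B (FOb F x) (FOb G x) (FOb G y) \<cdot>\<^bsub>V\<^esub> (FHom G x y \<boxtimes>\<^bsub>V\<^esub> p x) \<cdot>\<^bsub>V\<^esub> Symm V W (VHom A x y))"

definition is_nat_object ::
  "('o, 'a) smcc \<Rightarrow> ('o, 'a, 'c) vcat \<Rightarrow> ('o, 'a, 'd) vcat \<Rightarrow> ('a, 'c, 'd) vfun \<Rightarrow> ('a, 'c, 'd) vfun \<Rightarrow>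
   'o \<Rightarrow> ('c \<Rightarrow> 'a) \<Rightarrow> bool" where
  "is_nat_object V A B F G W p \<longleftrightarrow>
     nat_family V A B F G W p \<and>
     (\<forall>W' p'. nat_family V A B F G W' p' \<longrightarrow>
        (\<exists>!h. h \<in> Hom V W' W \<and> (\<forall>x\<in>VOb A. p x \<cdot>\<^bsub>V\<^esub> h = p' x)))"

text \<open>A choice of the object of natural transformations, with its projections.\<close>
definition nat_object ::
  "('o, 'a) smcc \<Rightarrow> ('o, 'a, 'c) vcat \<Rightarrow> ('o, 'a, 'd) vcat \<Rightarrow> ('a, 'c, 'd) vfun \<Rightarrow> ('a, 'c, 'd) vfun \<Rightarrow>
   'o \<times> ('c \<Rightarrow> 'a)" where
  "nat_object V A B F G = (SOME (W, p). is_nat_object V A B F G W p)"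

text \<open>Natural transformations are the natural families with vertex the unit object.\<close>
definition is_vnat ::
  "('o, 'a) smcc \<Rightarrow> ('o, 'a, 'c) vcat \<Rightarrow> ('o, 'a, 'd) vcat \<Rightarrow> ('a, 'c, 'd) vfun \<Rightarrow> ('a, 'c, 'd) vfun \<Rightarrow>
   ('c \<Rightarrow> 'a) \<Rightarrow> bool" where
  "is_vnat V A B F G \<alpha> \<longleftrightarrow> nat_family V A B F G (TUnit V) \<alpha>"

text \<open>The composite of elements \<open>f : I \<rightarrow> A(x,y)\<close> and \<open>g : I \<rightarrow> A(y,z)\<close>.\<close>
definition elem_comp :: "('o, 'a) smcc \<Rightarrow> ('o, 'a, 'c) vcat \<Rightarrow> 'c \<Rightarrow> 'c \<Rightarrow> 'c \<Rightarrow> 'a \<Rightarrow> 'a \<Rightarrow> 'a" where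
  "elem_comp V A x y z g f = VComp A x y z \<cdot>\<^bsub>V\<^esub> (g \<boxtimes>\<^bsub>V\<^esub> f) \<cdot>\<^bsub>V\<^esub> inverse_arr V (LUnit V (TUnit V))"

definition has_left_adjoint ::
  "('o, 'a) smcc \<Rightarrow> ('o, 'a, 'c) vcat \<Rightarrow> ('o, 'a, 'd) vcat \<Rightarrow> ('a, 'c, 'd) vfun \<Rightarrow> bool" where
  "has_left_adjoint V A B G \<longleftrightarrow>
     is_vfunctor V A B G \<and>
     (\<exists>F \<eta> \<epsilon>. is_vfunctor V B A F \<and>
        is_vnat V B B (vid_fun V B) (vfun_comp V B G F) \<eta> \<and>
        is_vnat V A A (vfun_comp V A F G) (vid_fun V A) \<epsilon> \<and>
        (\<forall>a\<in>VOb A. elem_comp V B (FOb G a) (FOb G (FOb F (FOb G a))) (FOb G a)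
           (FHom G (FOb F (FOb G a)) a \<cdot>\<^bsub>V\<^esub> \<epsilon> a) (\<eta> (FOb G a)) = VId B (FOb G a)) \<and>
        (\<forall>b\<in>VOb B. elem_comp V A (FOb F b) (FOb F (FOb G (FOb F b))) (FOb F b)
           (\<epsilon> (FOb F b)) (FHom F b (FOb G (FOb F b)) \<cdot>\<^bsub>V\<^esub> \<eta> b) = VId A (FOb F b)))"


section \<open>Powers\<close>

text \<open>
  \<open>P\<close> is a power of \<open>c\<close> by \<open>X\<close>, via isomorphisms \<open>\<psi> b : A(b,P) \<cong> V(X, A(b,c))\<close> natural in \<open>b\<close>.
\<close>
definition is_power ::
  "('o, 'a) smcc \<Rightarrow> ('o, 'a, 'c) vcat \<Rightarrow> 'o \<Rightarrow> 'c \<Rightarrow> 'c \<Rightarrow> ('c \<Rightarrow> 'a) \<Rightarrow> bool" where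
  "is_power V A X c P \<psi> \<longleftrightarrow>
     P \<in> VOb A \<and>
     (\<forall>b\<in>VOb A. is_iso V (\<psi> b) \<and> \<psi> b \<in> Hom V (VHom A b P) (IHom V X (VHom A b c))) \<and>
     is_vnat V (vop V A) (vself V) (hom_to V A P)
       (vfun_comp V (vop V A) (hom_from V (vself V) X) (hom_to V A c)) (\<lambda>b. name_of V (\<psi> b))"

text \<open>The counit \<open>X \<rightarrow> A(P,c)\<close>: the image of the identity under \<open>\<psi> P\<close>.\<close>
definition power_counit ::
  "('o, 'a) smcc \<Rightarrow> ('o, 'a, 'c) vcat \<Rightarrow> 'o \<Rightarrow> 'c \<Rightarrow> 'c \<Rightarrow> ('c \<Rightarrow> 'a) \<Rightarrow> 'a" where
  "power_counit V A X c P \<psi> =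
     Eval V X (VHom A P c) \<cdot>\<^bsub>V\<^esub> ((\<psi> P \<cdot>\<^bsub>V\<^esub> VId A P) \<boxtimes>\<^bsub>V\<^esub> Idn V X) \<cdot>\<^bsub>V\<^esub> inverse_arr V (LUnit V X)"

definition is_power_with_counit ::
  "('o, 'a) smcc \<Rightarrow> ('o, 'a, 'c) vcat \<Rightarrow> 'o \<Rightarrow> 'c \<Rightarrow> 'c \<Rightarrow> 'a \<Rightarrow> bool" where
  "is_power_with_counit V A X c P \<kappa> \<longleftrightarrow> (\<exists>\<psi>. is_power V A X c P \<psi> \<and> \<kappa> = power_counit V A X c P \<psi>)"

definition has_designated_powers ::
  "('o, 'a) smcc \<Rightarrow> 'o set \<Rightarrow> ('o, 'a, 'c) vcat \<Rightarrow> ('o \<Rightarrow> 'c \<Rightarrow> 'c) \<Rightarrow> ('o \<Rightarrow> 'c \<Rightarrow> 'a) \<Rightarrow> bool" where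
  "has_designated_powers V J A pw \<kappa> \<longleftrightarrow>
     (\<forall>X\<in>J. \<forall>c\<in>VOb A. is_power_with_counit V A X c (pw X c) (\<kappa> X c)) \<and>
     (\<forall>c\<in>VOb A. pw (TUnit V) c = c \<and> \<kappa> (TUnit V) c = VId A c)"

text \<open>
  Powers are sent to powers, with the image of the counit as counit. Powers being unique up to
  isomorphism, this does not depend on any designation of powers.
\<close>
definition preserves_powers ::
  "('o, 'a) smcc \<Rightarrow> 'o set \<Rightarrow> ('o, 'a, 'c) vcat \<Rightarrow> ('o, 'a, 'd) vcat \<Rightarrow> ('a, 'c, 'd) vfun \<Rightarrow> bool" where
  "preserves_powers V J A B F \<longleftrightarrow>
     (\<forall>X\<in>J. \<forall>c\<in>VOb A. \<forall>P \<kappa>. is_power_with_counit V A X c P \<kappa> \<longrightarrow>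
        is_power_with_counit V B X (FOb F c) (FOb F P) (FHom F P c \<cdot>\<^bsub>V\<^esub> \<kappa>))"


section \<open>Base change and functor categories\<close>

definition base_cat ::
  "('p, 'b) smcc \<Rightarrow> ('o, 'a, 'p, 'b) mon_functor \<Rightarrow> ('o, 'a, 'c) vcat \<Rightarrow> ('p, 'b, 'c) vcat" where
  "base_cat W M A = \<lparr>VOb = VOb A, VHom = (\<lambda>x y. MOb M (VHom A x y)),
     VComp = (\<lambda>x y z. MArr M (VComp A x y z) \<cdot>\<^bsub>W\<^esub> Mu M (VHom A y z) (VHom A x y)),
     VId = (\<lambda>x. MArr M (VId A x) \<cdot>\<^bsub>W\<^esub> Eps M)\<rparr>"

definition base_fun ::
  "('o, 'a, 'p, 'b) mon_functor \<Rightarrow> ('o, 'a, 'c) vcat \<Rightarrow> ('a, 'c, 'd) vfun \<Rightarrow> ('b, 'c, 'd) vfun" where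
  "base_fun M A F = \<lparr>FOb = FOb F,
     FHom = restrict (\<lambda>x. restrict (\<lambda>y. MArr M (FHom F x y)) (VOb A)) (VOb A)\<rparr>"

text \<open>
  The \<open>W\<close>-category \<open>[A,B]\<close> of \<open>V\<close>-functors: its hom-objects are ends formed in \<open>W\<close>.
  \<open>fun_hom\<close> is the hom-object, \<open>fun_proj\<close> its projection at an object \<open>x\<close> of \<open>A\<close>.
\<close>
definition fun_hom ::
  "('p, 'b) smcc \<Rightarrow> ('o, 'a, 'p, 'b) mon_functor \<Rightarrow> ('o, 'a, 'c) vcat \<Rightarrow> ('o, 'a, 'd) vcat \<Rightarrow>
   ('a, 'c, 'd) vfun \<Rightarrow> ('a, 'c, 'd) vfun \<Rightarrow> 'p" where
  "fun_hom W M A B F G =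
     fst (nat_object W (base_cat W M A) (base_cat W M B) (base_fun M A F) (base_fun M A G))"

definition fun_proj ::
  "('p, 'b) smcc \<Rightarrow> ('o, 'a, 'p, 'b) mon_functor \<Rightarrow> ('o, 'a, 'c) vcat \<Rightarrow> ('o, 'a, 'd) vcat \<Rightarrow>
   ('a, 'c, 'd) vfun \<Rightarrow> ('a, 'c, 'd) vfun \<Rightarrow> 'c \<Rightarrow> 'b" where
  "fun_proj W M A B F G =
     snd (nat_object W (base_cat W M A) (base_cat W M B) (base_fun M A F) (base_fun M A G))"

definition fun_cat ::
  "('o, 'a) smcc \<Rightarrow> ('p, 'b) smcc \<Rightarrow> ('o, 'a, 'p, 'b) mon_functor \<Rightarrow>
   ('o, 'a, 'c) vcat \<Rightarrow> ('o, 'a, 'd) vcat \<Rightarrow> ('p, 'b, ('a, 'c, 'd) vfun) vcat" where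
  "fun_cat V W M A B = \<lparr>VOb = {F. is_vfunctor V A B F}, VHom = fun_hom W M A B,
     VComp = (\<lambda>F G H. THE h.
       h \<in> Hom W (fun_hom W M A B G H \<otimes>\<^bsub>W\<^esub> fun_hom W M A B F G) (fun_hom W M A B F H) \<and>
       (\<forall>x\<in>VOb A. fun_proj W M A B F H x \<cdot>\<^bsub>W\<^esub> h =
          VComp (base_cat W M B) (FOb F x) (FOb G x) (FOb H x) \<cdot>\<^bsub>W\<^esub>
            (fun_proj W M A B G H x \<boxtimes>\<^bsub>W\<^esub> fun_proj W M A B F G x))),
     VId = (\<lambda>F. THE h. h \<in> Hom W (TUnit W) (fun_hom W M A B F F) \<and>
       (\<forall>x\<in>VOb A. fun_proj W M A B F F x \<cdot>\<^bsub>W\<^esub> h = VId (base_cat W M B) (FOb F x)))\<rparr>"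


section \<open>Theories and algebras\<close>

text \<open>A full sub-\<open>V\<close>-category of \<open>V\<close> is given by its set \<open>J\<close> of objects.\<close>
definition is_system_of_arities :: "('o, 'a) smcc \<Rightarrow> 'o set \<Rightarrow> bool" where
  "is_system_of_arities V J \<longleftrightarrow>
     J \<subseteq> Obj V \<and> TUnit V \<in> J \<and> (\<forall>x\<in>J. \<forall>y\<in>J. x \<otimes>\<^bsub>V\<^esub> y \<in> J)"

definition is_theory ::
  "('o, 'a) smcc \<Rightarrow> 'o set \<Rightarrow> ('o, 'a, 'o) vcat \<Rightarrow> ('a, 'o, 'o) vfun \<Rightarrow> bool" where
  "is_theory V J T \<tau> \<longleftrightarrow>
     VOb T = J \<and> is_vfunctor V (vop V (full_sub (vself V) J)) T \<tau> \<and> (\<forall>j\<in>J. FOb \<tau> j = j) \<and>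
     preserves_powers V J (vop V (full_sub (vself V) J)) T \<tau>"

definition algebras ::
  "('o, 'a) smcc \<Rightarrow> 'o set \<Rightarrow> ('o, 'a, 'o) vcat \<Rightarrow> ('o, 'a, 'c) vcat \<Rightarrow> ('a, 'o, 'c) vfun set" where
  "algebras V J T C = {E. is_vfunctor V T C E \<and> preserves_powers V J T C E}"

definition Alg ::
  "('o, 'a) smcc \<Rightarrow> ('p, 'b) smcc \<Rightarrow> ('o, 'a, 'p, 'b) mon_functor \<Rightarrow> 'o set \<Rightarrow>
   ('o, 'a, 'o) vcat \<Rightarrow> ('o, 'a, 'c) vcat \<Rightarrow> ('p, 'b, ('a, 'o, 'c) vfun) vcat" where
  "Alg V W M J T C = full_sub (fun_cat V W M T C) (algebras V J T C)"

text \<open>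
  The \<open>W\<close>-category \<open>Alg V W M J T (vself V)\<close> exists as a \<open>V\<close>-category: there is a \<open>V\<close>-category \<open>TA\<close>
  with the same objects together with an identity-on-objects isomorphism \<open>\<phi>\<close> from its base change.
\<close>
definition alg_exists_as ::
  "('o, 'a) smcc \<Rightarrow> ('p, 'b) smcc \<Rightarrow> ('o, 'a, 'p, 'b) mon_functor \<Rightarrow> 'o set \<Rightarrow> ('o, 'a, 'o) vcat \<Rightarrow>
   ('o, 'a, ('a, 'o, 'o) vfun) vcat \<Rightarrow> ('b, ('a, 'o, 'o) vfun, ('a, 'o, 'o) vfun) vfun \<Rightarrow> bool" where
  "alg_exists_as V W M J T TA \<phi> \<longleftrightarrow>
     is_vcat V TA \<and> VOb TA = algebras V J T (vself V) \<and>
     is_vfunctor W (base_cat W M TA) (Alg V W M J T (vself V)) \<phi> \<and>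
     (\<forall>E\<in>VOb TA. FOb \<phi> E = E) \<and>
     vfully_faithful W (base_cat W M TA) \<phi>"

text \<open>Evaluation at \<open>t\<close>, as an arrow \<open>TA(E,F) \<rightarrow> V(E t, F t)\<close> carried to \<open>W\<close>.\<close>
definition alg_proj ::
  "('o, 'a) smcc \<Rightarrow> ('p, 'b) smcc \<Rightarrow> ('o, 'a, 'p, 'b) mon_functor \<Rightarrow> ('o, 'a, 'o) vcat \<Rightarrow>
   ('b, ('a, 'o, 'o) vfun, ('a, 'o, 'o) vfun) vfun \<Rightarrow>
   ('a, 'o, 'o) vfun \<Rightarrow> ('a, 'o, 'o) vfun \<Rightarrow> 'o \<Rightarrow> 'b" where
  "alg_proj V W M T \<phi> E F t = fun_proj W M T (vself V) E F t \<cdot>\<^bsub>W\<^esub> FHom \<phi> E F"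

text \<open>The functor \<open>G : TA \<rightarrow> V\<close> given by evaluation at the unit object.\<close>
definition alg_forget ::
  "('o, 'a) smcc \<Rightarrow> ('p, 'b) smcc \<Rightarrow> ('o, 'a, 'p, 'b) mon_functor \<Rightarrow> ('o, 'a, 'o) vcat \<Rightarrow>
   ('o, 'a, ('a, 'o, 'o) vfun) vcat \<Rightarrow> ('b, ('a, 'o, 'o) vfun, ('a, 'o, 'o) vfun) vfun \<Rightarrow>
   ('a, ('a, 'o, 'o) vfun, 'o) vfun" where
  "alg_forget V W M T TA \<phi> = restrict_vfun TA (\<lambda>E. FOb E (TUnit V))
     (\<lambda>E F. THE u. u \<in> Hom V (VHom TA E F) (IHom V (FOb E (TUnit V)) (FOb F (TUnit V))) \<and>
        MArr M u = alg_proj V W M T \<phi> E F (TUnit V))"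

definition is_amenable ::
  "('o, 'a) smcc \<Rightarrow> ('p, 'b) smcc \<Rightarrow> ('o, 'a, 'p, 'b) mon_functor \<Rightarrow> 'o set \<Rightarrow> bool" where
  "is_amenable V W M J \<longleftrightarrow>
     (\<forall>T \<tau>. is_theory V J T \<tau> \<longrightarrow>
        (\<exists>TA \<phi>. alg_exists_as V W M J T TA \<phi> \<and>
           has_left_adjoint V TA (vself V) (alg_forget V W M T TA \<phi>)))"

text \<open>
  \<open>bracket_ob V T C c E\<close> is the \<open>T\<close>-algebra \<open>C(c, E -)\<close>. The functor of two variables that it
  underlies is given by its partial functors \<open>bracket_left\<close> (fixed \<open>E\<close>, a \<open>V\<close>-functor on \<open>C\<^sup>o\<^sup>p\<close>) and
  \<open>bracket_right\<close> (fixed \<open>c\<close>, a \<open>W\<close>-functor on \<open>Alg V W M J T C\<close>); they act on hom-objects by the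
  unique arrows whose projection at each \<open>t\<close> is the action of \<open>C(-, E t)\<close>, respectively of \<open>C(c,-)\<close>
  after projection at \<open>t\<close>.
\<close>
definition bracket_ob ::
  "('o, 'a) smcc \<Rightarrow> ('o, 'a, 'o) vcat \<Rightarrow> ('o, 'a, 'c) vcat \<Rightarrow> 'c \<Rightarrow> ('a, 'o, 'c) vfun \<Rightarrow> ('a, 'o, 'o) vfun" where
  "bracket_ob V T C c E = vfun_comp V T (hom_from V C c) E"

definition bracket_left ::
  "('o, 'a) smcc \<Rightarrow> ('p, 'b) smcc \<Rightarrow> ('o, 'a, 'p, 'b) mon_functor \<Rightarrow> ('o, 'a, 'o) vcat \<Rightarrow>
   ('o, 'a, 'c) vcat \<Rightarrow> ('o, 'a, ('a, 'o, 'o) vfun) vcat \<Rightarrow>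
   ('b, ('a, 'o, 'o) vfun, ('a, 'o, 'o) vfun) vfun \<Rightarrow>
   ('a, 'o, 'c) vfun \<Rightarrow> ('a, 'c, ('a, 'o, 'o) vfun) vfun" where
  "bracket_left V W M T C TA \<phi> E = restrict_vfun (vop V C) (\<lambda>c. bracket_ob V T C c E)
     (\<lambda>c d. THE u. u \<in> Hom V (VHom C d c) (VHom TA (bracket_ob V T C c E) (bracket_ob V T C d E)) \<and>
        (\<forall>t\<in>VOb T. alg_proj V W M T \<phi> (bracket_ob V T C c E) (bracket_ob V T C d E) t \<cdot>\<^bsub>W\<^esub> MArr M u =
           MArr M (FHom (hom_to V C (FOb E t)) c d)))"

definition bracket_right ::
  "('o, 'a) smcc \<Rightarrow> ('p, 'b) smcc \<Rightarrow> ('o, 'a, 'p, 'b) mon_functor \<Rightarrow> 'o set \<Rightarrow> ('o, 'a, 'o) vcat \<Rightarrow>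
   ('o, 'a, 'c) vcat \<Rightarrow> ('o, 'a, ('a, 'o, 'o) vfun) vcat \<Rightarrow>
   ('b, ('a, 'o, 'o) vfun, ('a, 'o, 'o) vfun) vfun \<Rightarrow>
   'c \<Rightarrow> ('b, ('a, 'o, 'c) vfun, ('a, 'o, 'o) vfun) vfun" where
  "bracket_right V W M J T C TA \<phi> c = restrict_vfun (Alg V W M J T C) (\<lambda>E. bracket_ob V T C c E)
     (\<lambda>E F. THE v.
        v \<in> Hom W (fun_hom W M T C E F) (MOb M (VHom TA (bracket_ob V T C c E) (bracket_ob V T C c F))) \<and>
        (\<forall>t\<in>VOb T. alg_proj V W M T \<phi> (bracket_ob V T C c E) (bracket_ob V T C c F) t \<cdot>\<^bsub>W\<^esub> v =
           MArr M (FHom (hom_from V C c) (FOb E t) (FOb F t)) \<cdot>\<^bsub>W\<^esub> fun_proj W M T C E F t))"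

end

theory Submission
  imports Defs
begin

text \<open>
  Everything is checked on generalised elements \<open>Z \<rightarrow> A(x,y)\<close> in \<open>W = V'\<close>. The functor
  \<open>V \<rightarrow> W\<close> preserves internal homs, so an element \<open>Z \<rightarrow> V(x,y)\<close> of the base change of \<open>V\<close> is the
  same as an arrow \<open>Z \<otimes> x \<rightarrow> y\<close> of \<open>W\<close>. A map \<open>Z \<rightarrow> [C\<^sup>o\<^sup>p, T-Alg](Y E, Y F)\<close> is then a family
  \<open>q c t : Z \<rightarrow> V(C(c, E t), C(c, F t))\<close> natural in \<open>c\<close> and in \<open>t\<close>. By the Yoneda lemma, naturality in
  \<open>c\<close> makes \<open>q c t\<close> composition with a unique \<open>a t : Z \<rightarrow> C(E t, F t)\<close>, and naturality in \<open>t\<close> makes \<open>a\<close>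
  a map \<open>Z \<rightarrow> [T, C](E, F)\<close>. That \<open>C(c, E -)\<close> is an algebra holds because representables preserve
  powers, which are characterised by the universal property of their counits.
\<close>

section \<open>Coherence in symmetric monoidal closed categories\<close>

text \<open>The ends that form functor categories are taken in \<open>W\<close>, so their elements
  range over all objects \<open>Z\<close> of \<open>W\<close>, whereas evaluation in
  \<open>V\<close> is a priori universal only among objects of \<open>V\<close>. The invertible
  comparison from \<open>MOb M (IHom V x y)\<close> to the internal hom of \<open>W\<close> bridges
  this gap; it is what preservation of powers says. A second obstacle is that each
  \<open>bracket_left\<close> must be a functor over \<open>V\<close> although its target is known
  only through projections in \<open>W\<close>. Its equations are checked in \<open>W\<close> and
  descend, because \<open>M\<close> is fully faithful and its structure maps are invertible. Arrows
  into an internal hom, an end or a power are compared through the universal property. What remains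
  are equations between composites of elements in which the order and bracketing of the stages
  matter, hence the preparatory coherence lemmas on units and symmetry. No inverse of the action of
  \<open>Y\<close> is written down: an arrow is invertible as soon as every element of its codomain
  lifts uniquely along it.\<close>

lemma Hom_iff: "f \<in> Hom K x y \<longleftrightarrow> f \<in> Arr K \<and> Dom K f = x \<and> Cod K f = y"
  by (auto simp: Hom_def)

locale smcc =
  fixes V :: "('o, 'a) smcc" (structure)
  assumes smcc: "is_smcc V"
begin

lemma category: "is_category V"
  using smcc unfolding is_smcc_def by blast

lemma obj_dom [simp]: "f \<in> Arr V \<Longrightarrow> Dom V f \<in> Obj V"
  and obj_cod [simp]: "f \<in> Arr V \<Longrightarrow> Cod V f \<in> Obj V"
  using category unfolding is_category_def by blast+

lemma idn [simp]: "x \<in> Obj V \<Longrightarrow> Idn V x \<in> Arr V" "x \<in> Obj V \<Longrightarrow> Dom V (Idn V x) = x"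
    "x \<in> Obj V \<Longrightarrow> Cod V (Idn V x) = x"
  using category unfolding is_category_def Hom_iff by blast+

lemma comp_arr [simp]:
  assumes "f \<in> Arr V" "g \<in> Arr V" "Cod V f = Dom V g"
  shows "g \<cdot> f \<in> Arr V" "Dom V (g \<cdot> f) = Dom V f" "Cod V (g \<cdot> f) = Cod V g"
  using category assms unfolding is_category_def Hom_iff by blast+

lemma comp_idn [simp]: "f \<in> Arr V \<Longrightarrow> Dom V f = x \<Longrightarrow> f \<cdot> Idn V x = f"
  and idn_comp [simp]: "f \<in> Arr V \<Longrightarrow> Cod V f = x \<Longrightarrow> Idn V x \<cdot> f = f"
  using category unfolding is_category_def by blast+

lemma comp_assoc:
  "\<lbrakk>f \<in> Arr V; g \<in> Arr V; h \<in> Arr V; Cod V f = Dom V g; Cod V g = Dom V h\<rbrakk> \<Longrightarrow>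
    (h \<cdot> g) \<cdot> f = h \<cdot> (g \<cdot> f)"
  using category unfolding is_category_def by blast

lemma idn_in: "x \<in> Obj V \<Longrightarrow> Idn V x \<in> Hom V x x"
  by (simp add: Hom_iff)

lemma comp_in: "f \<in> Hom V x y \<Longrightarrow> g \<in> Hom V y z \<Longrightarrow> g \<cdot> f \<in> Hom V x z"
  by (simp add: Hom_iff)

lemma hom_obj: "f \<in> Hom V x y \<Longrightarrow> x \<in> Obj V" "f \<in> Hom V x y \<Longrightarrow> y \<in> Obj V"
  by (auto simp: Hom_iff)

lemma is_inverseD:
  assumes "is_inverse V f g" "f \<in> Arr V"
  shows "g \<in> Arr V" "Dom V g = Cod V f" "Cod V g = Dom V f"
    "g \<cdot> f = Idn V (Dom V f)" "f \<cdot> g = Idn V (Cod V f)"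
  using assms by (auto simp: is_inverse_def Hom_iff)

text \<open>Two-sided inverses are unique, so the definite description in \<open>inverse_arr\<close>
  denotes.\<close>

lemma inverse_arr:
  assumes "is_iso V f" shows "is_inverse V f (inverse_arr V f)"
proof -
  obtain g where f: "f \<in> Arr V" and g: "is_inverse V f g"
    using assms unfolding is_iso_def by blast
  have "h = g" if h: "is_inverse V f h" for h
  proof -
    have "h = h \<cdot> (f \<cdot> g)" using f is_inverseD[OF g f] is_inverseD[OF h f] by simp
    also have "\<dots> = (h \<cdot> f) \<cdot> g"
      using f is_inverseD(1-3)[OF g f] is_inverseD(1-3)[OF h f] by (simp add: comp_assoc)
    also have "\<dots> = g" using f is_inverseD[OF g f] is_inverseD[OF h f] by simp
    finally show ?thesis .
  qed
  then show ?thesis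
    unfolding inverse_arr_def using g by (rule theI[of "is_inverse V f" g, rotated])
qed

lemma iso_arr: "is_iso V f \<Longrightarrow> f \<in> Arr V"
  by (simp add: is_iso_def)

lemma inverse_arrD:
  assumes "is_iso V f"
  shows "inverse_arr V f \<in> Arr V" "Dom V (inverse_arr V f) = Cod V f"
    "Cod V (inverse_arr V f) = Dom V f"
    "inverse_arr V f \<cdot> f = Idn V (Dom V f)" "f \<cdot> inverse_arr V f = Idn V (Cod V f)"
  by (fact is_inverseD[OF inverse_arr[OF assms] iso_arr[OF assms]])+

lemma isoI:
  assumes "f \<in> Hom V x y" "g \<in> Hom V y x" "g \<cdot> f = Idn V x" "f \<cdot> g = Idn V y"
  shows "is_iso V f"
  using assms unfolding is_iso_def is_inverse_def Hom_iff by auto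

lemma iso_comp:
  assumes "is_iso V f" "is_iso V g" "Cod V f = Dom V g"
  shows "is_iso V (g \<cdot> f)"
proof (rule isoI[of _ "Dom V f" "Cod V g" "inverse_arr V f \<cdot> inverse_arr V g"])
  note [simp] = iso_arr[OF assms(1)] iso_arr[OF assms(2)]
    inverse_arrD(1-3)[OF assms(1)] inverse_arrD(1-3)[OF assms(2)]
  note i = inverse_arrD(4,5)[OF assms(1)] inverse_arrD(4,5)[OF assms(2)]
  show "g \<cdot> f \<in> Hom V (Dom V f) (Cod V g)"
    "inverse_arr V f \<cdot> inverse_arr V g \<in> Hom V (Cod V g) (Dom V f)"
    using assms(3) by (simp_all add: Hom_iff)
  have "(inverse_arr V f \<cdot> inverse_arr V g) \<cdot> (g \<cdot> f) =
      inverse_arr V f \<cdot> ((inverse_arr V g \<cdot> g) \<cdot> f)"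
    using assms(3) by (simp add: comp_assoc)
  then show "(inverse_arr V f \<cdot> inverse_arr V g) \<cdot> (g \<cdot> f) = Idn V (Dom V f)"
    using assms(3) by (simp add: i)
  have "(g \<cdot> f) \<cdot> (inverse_arr V f \<cdot> inverse_arr V g) =
      g \<cdot> ((f \<cdot> inverse_arr V f) \<cdot> inverse_arr V g)"
    using assms(3) by (simp add: comp_assoc)
  then show "(g \<cdot> f) \<cdot> (inverse_arr V f \<cdot> inverse_arr V g) = Idn V (Cod V g)"
    using assms(3) by (simp add: i)
qed

lemma iso_idn: "x \<in> Obj V \<Longrightarrow> is_iso V (Idn V x)"
  by (rule isoI[of _ x x "Idn V x"]) (simp_all add: Hom_iff)

lemma iso_epi:
  assumes "is_iso V e" "f \<in> Arr V" "g \<in> Arr V" "Dom V f = Cod V e" "Dom V g = Cod V e"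
    and eq: "f \<cdot> e = g \<cdot> e"
  shows "f = g"
proof -
  note [simp] = iso_arr[OF assms(1)] inverse_arrD[OF assms(1)]
  have "f = (f \<cdot> e) \<cdot> inverse_arr V e" using assms(1-5) by (simp add: comp_assoc)
  also have "\<dots> = g" unfolding eq using assms(1-5) by (simp add: comp_assoc)
  finally show ?thesis .
qed

lemma iso_mono:
  assumes "is_iso V m" "f \<in> Arr V" "g \<in> Arr V" "Cod V f = Dom V m" "Cod V g = Dom V m"
    and eq: "m \<cdot> f = m \<cdot> g"
  shows "f = g"
proof -
  note [simp] = iso_arr[OF assms(1)] inverse_arrD[OF assms(1)]
  have "f = inverse_arr V m \<cdot> (m \<cdot> f)" using assms(1-5) by (simp flip: comp_assoc)
  also have "\<dots> = g" unfolding eq using assms(1-5) by (simp flip: comp_assoc)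
  finally show ?thesis .
qed

section \<open>The axioms of a symmetric monoidal closed category, one at a time\<close>

lemma tens_ob:
  "\<forall>x\<in>Obj V. \<forall>y\<in>Obj V. x \<otimes> y \<in> Obj V \<and> Idn V x \<boxtimes> Idn V y = Idn V (x \<otimes> y)"
  using smcc unfolding is_smcc_def by (elim conjE)

lemma tens_hom:
  "\<forall>f\<in>Arr V. \<forall>g\<in>Arr V.
    f \<boxtimes> g \<in> Hom V (Dom V f \<otimes> Dom V g) (Cod V f \<otimes> Cod V g)"
  using smcc unfolding is_smcc_def by (elim conjE)

lemma tunit [simp]: "TUnit V \<in> Obj V"
  using smcc unfolding is_smcc_def by (elim conjE)

lemma tens_obj [simp]: "x \<in> Obj V \<Longrightarrow> y \<in> Obj V \<Longrightarrow> x \<otimes> y \<in> Obj V"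
  and tens_idn [simp]: "x \<in> Obj V \<Longrightarrow> y \<in> Obj V \<Longrightarrow> Idn V x \<boxtimes> Idn V y = Idn V (x \<otimes> y)"
  using tens_ob by blast+

lemma tens_arr [simp]:
  assumes "f \<in> Arr V" "g \<in> Arr V"
  shows "f \<boxtimes> g \<in> Arr V" "Dom V (f \<boxtimes> g) = Dom V f \<otimes> Dom V g"
    "Cod V (f \<boxtimes> g) = Cod V f \<otimes> Cod V g"
  using tens_hom assms unfolding Hom_iff by blast+

lemma tens_in: "f \<in> Hom V x y \<Longrightarrow> g \<in> Hom V x' y' \<Longrightarrow> f \<boxtimes> g \<in> Hom V (x \<otimes> x') (y \<otimes> y')"
  by (simp add: Hom_iff)

lemma tens_comp [simp]:
  assumes "f \<in> Arr V" "g \<in> Arr V" "f' \<in> Arr V" "g' \<in> Arr V" "Cod V f = Dom V f'" "Cod V g = Dom V g'"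
  shows "(f' \<boxtimes> g') \<cdot> (f \<boxtimes> g) = (f' \<cdot> f) \<boxtimes> (g' \<cdot> g)"
proof -
  have "\<forall>f\<in>Arr V. \<forall>g\<in>Arr V. \<forall>f'\<in>Arr V. \<forall>g'\<in>Arr V. Cod V f = Dom V f' \<and> Cod V g = Dom V g' \<longrightarrow>
        (f' \<cdot> f) \<boxtimes> (g' \<cdot> g) = (f' \<boxtimes> g') \<cdot> (f \<boxtimes> g)"
    using smcc unfolding is_smcc_def by (elim conjE)
  then show ?thesis using assms by (simp add: Hom_iff)
qed

lemma tens_comp' [simp]:
  assumes "f \<in> Arr V" "g \<in> Arr V" "f' \<in> Arr V" "g' \<in> Arr V" "h \<in> Arr V"
    "Cod V f = Dom V f'" "Cod V g = Dom V g'" "Cod V h = Dom V f \<otimes> Dom V g"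
  shows "(f' \<boxtimes> g') \<cdot> (f \<boxtimes> g) \<cdot> h = ((f' \<cdot> f) \<boxtimes> (g' \<cdot> g)) \<cdot> h"
  using assms by (simp flip: comp_assoc)

lemma assoc_arr [simp]:
  assumes "x \<in> Obj V" "y \<in> Obj V" "z \<in> Obj V"
  shows "Assoc V x y z \<in> Arr V" "Dom V (Assoc V x y z) = (x \<otimes> y) \<otimes> z"
    "Cod V (Assoc V x y z) = x \<otimes> (y \<otimes> z)" "is_iso V (Assoc V x y z)"
proof -
  have "\<forall>x\<in>Obj V. \<forall>y\<in>Obj V. \<forall>z\<in>Obj V. is_iso V (Assoc V x y z) \<and>
        Assoc V x y z \<in> Hom V ((x \<otimes> y) \<otimes> z) (x \<otimes> (y \<otimes> z))"
    using smcc unfolding is_smcc_def by (elim conjE)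
  then show "Assoc V x y z \<in> Arr V" "Dom V (Assoc V x y z) = (x \<otimes> y) \<otimes> z"
    "Cod V (Assoc V x y z) = x \<otimes> (y \<otimes> z)" "is_iso V (Assoc V x y z)"
    using assms unfolding Hom_iff by blast+
qed

lemma lunit_arr [simp]:
  assumes "x \<in> Obj V"
  shows "LUnit V x \<in> Arr V" "Dom V (LUnit V x) = TUnit V \<otimes> x" "Cod V (LUnit V x) = x"
    "is_iso V (LUnit V x)"
proof -
  have "\<forall>x\<in>Obj V. is_iso V (LUnit V x) \<and> LUnit V x \<in> Hom V (TUnit V \<otimes> x) x"
    using smcc unfolding is_smcc_def by (elim conjE)
  then show "LUnit V x \<in> Arr V" "Dom V (LUnit V x) = TUnit V \<otimes> x" "Cod V (LUnit V x) = x"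
    "is_iso V (LUnit V x)"
    using assms unfolding Hom_iff by blast+
qed

lemma runit_arr [simp]:
  assumes "x \<in> Obj V"
  shows "RUnit V x \<in> Arr V" "Dom V (RUnit V x) = x \<otimes> TUnit V" "Cod V (RUnit V x) = x"
    "is_iso V (RUnit V x)"
proof -
  have "\<forall>x\<in>Obj V. is_iso V (RUnit V x) \<and> RUnit V x \<in> Hom V (x \<otimes> TUnit V) x"
    using smcc unfolding is_smcc_def by (elim conjE)
  then show "RUnit V x \<in> Arr V" "Dom V (RUnit V x) = x \<otimes> TUnit V" "Cod V (RUnit V x) = x"
    "is_iso V (RUnit V x)"
    using assms unfolding Hom_iff by blast+
qed

lemma symm_arr [simp]:
  assumes "x \<in> Obj V" "y \<in> Obj V"
  shows "Symm V x y \<in> Arr V" "Dom V (Symm V x y) = x \<otimes> y" "Cod V (Symm V x y) = y \<otimes> x"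
proof -
  have "\<forall>x\<in>Obj V. \<forall>y\<in>Obj V. Symm V x y \<in> Hom V (x \<otimes> y) (y \<otimes> x)"
    using smcc unfolding is_smcc_def by (elim conjE)
  then show "Symm V x y \<in> Arr V" "Dom V (Symm V x y) = x \<otimes> y" "Cod V (Symm V x y) = y \<otimes> x"
    using assms unfolding Hom_iff by blast+
qed

lemma assoc_nat:
  assumes "f \<in> Hom V x x'" "g \<in> Hom V y y'" "h \<in> Hom V z z'"
  shows "Assoc V x' y' z' \<cdot> ((f \<boxtimes> g) \<boxtimes> h) = (f \<boxtimes> (g \<boxtimes> h)) \<cdot> Assoc V x y z"
proof -
  have "\<forall>f\<in>Arr V. \<forall>g\<in>Arr V. \<forall>h\<in>Arr V.
        Assoc V (Cod V f) (Cod V g) (Cod V h) \<cdot> ((f \<boxtimes> g) \<boxtimes> h) =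
        (f \<boxtimes> (g \<boxtimes> h)) \<cdot> Assoc V (Dom V f) (Dom V g) (Dom V h)"
    using smcc unfolding is_smcc_def by (elim conjE)
  then show ?thesis using assms by (auto simp: Hom_iff)
qed

lemma lunit_nat:
  assumes "f \<in> Hom V x y"
  shows "LUnit V y \<cdot> (Idn V (TUnit V) \<boxtimes> f) = f \<cdot> LUnit V x"
proof -
  have "\<forall>f\<in>Arr V. LUnit V (Cod V f) \<cdot> (Idn V (TUnit V) \<boxtimes> f) = f \<cdot> LUnit V (Dom V f)"
    using smcc unfolding is_smcc_def by (elim conjE)
  then show ?thesis using assms by (auto simp: Hom_iff)
qed

lemma runit_nat:
  assumes "f \<in> Hom V x y"
  shows "RUnit V y \<cdot> (f \<boxtimes> Idn V (TUnit V)) = f \<cdot> RUnit V x"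
proof -
  have "\<forall>f\<in>Arr V. RUnit V (Cod V f) \<cdot> (f \<boxtimes> Idn V (TUnit V)) = f \<cdot> RUnit V (Dom V f)"
    using smcc unfolding is_smcc_def by (elim conjE)
  then show ?thesis using assms by (auto simp: Hom_iff)
qed

lemma symm_nat:
  assumes "f \<in> Hom V x x'" "g \<in> Hom V y y'"
  shows "Symm V x' y' \<cdot> (f \<boxtimes> g) = (g \<boxtimes> f) \<cdot> Symm V x y"
proof -
  have "\<forall>f\<in>Arr V. \<forall>g\<in>Arr V.
        Symm V (Cod V f) (Cod V g) \<cdot> (f \<boxtimes> g) = (g \<boxtimes> f) \<cdot> Symm V (Dom V f) (Dom V g)"
    using smcc unfolding is_smcc_def by (elim conjE)
  then show ?thesis using assms by (auto simp: Hom_iff)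
qed

lemma pentagon:
  assumes "w \<in> Obj V" "x \<in> Obj V" "y \<in> Obj V" "z \<in> Obj V"
  shows "(Idn V w \<boxtimes> Assoc V x y z) \<cdot> Assoc V w (x \<otimes> y) z \<cdot> (Assoc V w x y \<boxtimes> Idn V z) =
    Assoc V w x (y \<otimes> z) \<cdot> Assoc V (w \<otimes> x) y z"
proof -
  have "\<forall>w\<in>Obj V. \<forall>x\<in>Obj V. \<forall>y\<in>Obj V. \<forall>z\<in>Obj V.
        (Idn V w \<boxtimes> Assoc V x y z) \<cdot> Assoc V w (x \<otimes> y) z \<cdot> (Assoc V w x y \<boxtimes> Idn V z) =
        Assoc V w x (y \<otimes> z) \<cdot> Assoc V (w \<otimes> x) y z"
    using smcc unfolding is_smcc_def by (elim conjE)
  then show ?thesis using assms by (simp add: Hom_iff)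
qed

lemma triangle:
  assumes "x \<in> Obj V" "y \<in> Obj V"
  shows "(Idn V x \<boxtimes> LUnit V y) \<cdot> Assoc V x (TUnit V) y = RUnit V x \<boxtimes> Idn V y"
proof -
  have "\<forall>x\<in>Obj V. \<forall>y\<in>Obj V.
        (Idn V x \<boxtimes> LUnit V y) \<cdot> Assoc V x (TUnit V) y = RUnit V x \<boxtimes> Idn V y"
    using smcc unfolding is_smcc_def by (elim conjE)
  then show ?thesis using assms by (simp add: Hom_iff)
qed

lemma symm_symm:
  assumes "x \<in> Obj V" "y \<in> Obj V"
  shows "Symm V y x \<cdot> Symm V x y = Idn V (x \<otimes> y)"
proof -
  have "\<forall>x\<in>Obj V. \<forall>y\<in>Obj V. Symm V y x \<cdot> Symm V x y = Idn V (x \<otimes> y)"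
    using smcc unfolding is_smcc_def by (elim conjE)
  then show ?thesis using assms by (simp add: Hom_iff)
qed

lemma hexagon:
  assumes "x \<in> Obj V" "y \<in> Obj V" "z \<in> Obj V"
  shows "Assoc V y z x \<cdot> Symm V x (y \<otimes> z) \<cdot> Assoc V x y z =
    (Idn V y \<boxtimes> Symm V x z) \<cdot> Assoc V y x z \<cdot> (Symm V x y \<boxtimes> Idn V z)"
proof -
  have "\<forall>x\<in>Obj V. \<forall>y\<in>Obj V. \<forall>z\<in>Obj V.
        Assoc V y z x \<cdot> Symm V x (y \<otimes> z) \<cdot> Assoc V x y z =
        (Idn V y \<boxtimes> Symm V x z) \<cdot> Assoc V y x z \<cdot> (Symm V x y \<boxtimes> Idn V z)"
    using smcc unfolding is_smcc_def by (elim conjE)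
  then show ?thesis using assms by (simp add: Hom_iff)
qed

lemma ihom_obj [simp]: "x \<in> Obj V \<Longrightarrow> y \<in> Obj V \<Longrightarrow> IHom V x y \<in> Obj V"
  and eval_arr [simp]: "x \<in> Obj V \<Longrightarrow> y \<in> Obj V \<Longrightarrow> Eval V x y \<in> Arr V"
    "x \<in> Obj V \<Longrightarrow> y \<in> Obj V \<Longrightarrow> Dom V (Eval V x y) = IHom V x y \<otimes> x"
    "x \<in> Obj V \<Longrightarrow> y \<in> Obj V \<Longrightarrow> Cod V (Eval V x y) = y"
proof -
  have "\<forall>x\<in>Obj V. \<forall>y\<in>Obj V. IHom V x y \<in> Obj V \<and> Eval V x y \<in> Hom V (IHom V x y \<otimes> x) y"
    using smcc unfolding is_smcc_def by (elim conjE)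
  then show "x \<in> Obj V \<Longrightarrow> y \<in> Obj V \<Longrightarrow> IHom V x y \<in> Obj V"
    "x \<in> Obj V \<Longrightarrow> y \<in> Obj V \<Longrightarrow> Eval V x y \<in> Arr V"
    "x \<in> Obj V \<Longrightarrow> y \<in> Obj V \<Longrightarrow> Dom V (Eval V x y) = IHom V x y \<otimes> x"
    "x \<in> Obj V \<Longrightarrow> y \<in> Obj V \<Longrightarrow> Cod V (Eval V x y) = y"
    unfolding Hom_iff by blast+
qed

lemma eval_universal:
  assumes "x \<in> Obj V" "y \<in> Obj V" "z \<in> Obj V" "f \<in> Hom V (z \<otimes> x) y"
  shows "\<exists>!g. g \<in> Hom V z (IHom V x y) \<and> Eval V x y \<cdot> (g \<boxtimes> Idn V x) = f"
proof -
  have "\<forall>x\<in>Obj V. \<forall>y\<in>Obj V. \<forall>z\<in>Obj V. \<forall>f\<in>Hom V (z \<otimes> x) y.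
        \<exists>!g. g \<in> Hom V z (IHom V x y) \<and> Eval V x y \<cdot> (g \<boxtimes> Idn V x) = f"
    using smcc unfolding is_smcc_def by (elim conjE)
  then show ?thesis using assms by blast
qed

lemma transpose_arr:
  assumes "x \<in> Obj V" "y \<in> Obj V" "z \<in> Obj V" "f \<in> Hom V (z \<otimes> x) y"
  shows "transpose_arr V z x y f \<in> Hom V z (IHom V x y)"
    "Eval V x y \<cdot> (transpose_arr V z x y f \<boxtimes> Idn V x) = f"
  using theI'[OF eval_universal[OF assms]] unfolding transpose_arr_def by blast+

section \<open>Derived isomorphisms and derived coherence laws\<close>

lemma symm_iso [simp]: "x \<in> Obj V \<Longrightarrow> y \<in> Obj V \<Longrightarrow> is_iso V (Symm V x y)"
  by (rule isoI[of _ "x \<otimes> y" "y \<otimes> x" "Symm V y x"]) (simp_all add: Hom_iff symm_symm)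

lemma tens_iso:
  assumes "is_iso V f" "is_iso V g" shows "is_iso V (f \<boxtimes> g)"
  by (rule isoI[of _ "Dom V f \<otimes> Dom V g" "Cod V f \<otimes> Cod V g" "inverse_arr V f \<boxtimes> inverse_arr V g"])
    (simp_all add: Hom_iff iso_arr[OF assms(1)] iso_arr[OF assms(2)]
      inverse_arrD[OF assms(1)] inverse_arrD[OF assms(2)])

text \<open>Tensoring with the unit object is naturally isomorphic to the identity functor, hence
  faithful. This allows a unit law to be proved after adding a further unit factor, where pentagon
  and triangle apply.\<close>

lemma lunit_faithful:
  assumes "f \<in> Hom V x y" "g \<in> Hom V x y" "Idn V (TUnit V) \<boxtimes> f = Idn V (TUnit V) \<boxtimes> g"
  shows "f = g"
proof (rule iso_epi[of "LUnit V x"])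
  have [simp]: "x \<in> Obj V" using hom_obj[OF assms(1)] by simp
  show "is_iso V (LUnit V x)" "f \<in> Arr V" "g \<in> Arr V" "Dom V f = Cod V (LUnit V x)"
    "Dom V g = Cod V (LUnit V x)"
    using assms(1,2) by (simp_all add: Hom_iff)
  show "f \<cdot> LUnit V x = g \<cdot> LUnit V x"
    using lunit_nat[OF assms(1)] lunit_nat[OF assms(2)] assms(3) by metis
qed

lemma runit_faithful:
  assumes "f \<in> Hom V x y" "g \<in> Hom V x y" "f \<boxtimes> Idn V (TUnit V) = g \<boxtimes> Idn V (TUnit V)"
  shows "f = g"
proof (rule iso_epi[of "RUnit V x"])
  have [simp]: "x \<in> Obj V" using hom_obj[OF assms(1)] by simp
  show "is_iso V (RUnit V x)" "f \<in> Arr V" "g \<in> Arr V" "Dom V f = Cod V (RUnit V x)"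
    "Dom V g = Cod V (RUnit V x)"
    using assms(1,2) by (simp_all add: Hom_iff)
  show "f \<cdot> RUnit V x = g \<cdot> RUnit V x"
    using runit_nat[OF assms(1)] runit_nat[OF assms(2)] assms(3) by metis
qed

text \<open>Kelly's argument: after tensoring with \<open>I\<close> on the left, the pentagon at
  \<open>I, I, x, y\<close> together with two triangles and naturality of the associator gives the
  identity; the invertible \<open>?e\<close> and the extra unit are then removed.\<close>

lemma lunit_tens:
  assumes x: "x \<in> Obj V" and y: "y \<in> Obj V"
  shows "LUnit V (x \<otimes> y) \<cdot> Assoc V (TUnit V) x y = LUnit V x \<boxtimes> Idn V y" (is "?l = ?r")
proof (rule lunit_faithful)
  note [simp] = x y
  let ?I = "TUnit V"
  let ?i = "Idn V (TUnit V)"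
  show "?l \<in> Hom V ((?I \<otimes> x) \<otimes> y) (x \<otimes> y)" "?r \<in> Hom V ((?I \<otimes> x) \<otimes> y) (x \<otimes> y)"
    by (simp_all add: Hom_iff)
  let ?e = "Assoc V ?I (?I \<otimes> x) y \<cdot> (Assoc V ?I ?I x \<boxtimes> Idn V y)"
  have "(?i \<boxtimes> ?l) \<cdot> ?e = (?i \<boxtimes> LUnit V (x \<otimes> y)) \<cdot> (?i \<boxtimes> Assoc V ?I x y) \<cdot> ?e"
    by simp
  also have "\<dots> = (?i \<boxtimes> LUnit V (x \<otimes> y)) \<cdot> Assoc V ?I ?I (x \<otimes> y) \<cdot> Assoc V (?I \<otimes> ?I) x y"
    by (simp only: pentagon[OF tunit tunit x y])
  also have "\<dots> = (RUnit V ?I \<boxtimes> Idn V (x \<otimes> y)) \<cdot> Assoc V (?I \<otimes> ?I) x y"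
    using triangle[of ?I "x \<otimes> y"] by (simp flip: comp_assoc)
  also have "\<dots> = Assoc V ?I x y \<cdot> ((RUnit V ?I \<boxtimes> Idn V x) \<boxtimes> Idn V y)"
    using assoc_nat[of "RUnit V ?I" "?I \<otimes> ?I" ?I "Idn V x" x x "Idn V y" y y]
    by (simp add: Hom_iff)
  also have "\<dots> = Assoc V ?I x y \<cdot> (((?i \<boxtimes> LUnit V x) \<boxtimes> Idn V y) \<cdot> (Assoc V ?I ?I x \<boxtimes> Idn V y))"
    using triangle[of ?I x] by simp
  also have "\<dots> = (?i \<boxtimes> ?r) \<cdot> ?e"
    using assoc_nat[of ?i ?I ?I "LUnit V x" "?I \<otimes> x" x "Idn V y" y y]
    by (simp add: Hom_iff flip: comp_assoc del: tens_comp tens_comp')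
  finally have eq: "(?i \<boxtimes> ?l) \<cdot> ?e = (?i \<boxtimes> ?r) \<cdot> ?e" .
  have "is_iso V ?e" by (simp add: iso_comp tens_iso iso_idn)
  from iso_epi[OF this _ _ _ _ eq] show "?i \<boxtimes> ?l = ?i \<boxtimes> ?r" by simp
qed

text \<open>Mirror image of \<open>lunit_tens\<close>: tensor with \<open>I\<close> on the right and
  use the pentagon at \<open>x, y, I, I\<close>.\<close>

lemma runit_tens:
  assumes x: "x \<in> Obj V" and y: "y \<in> Obj V"
  shows "(Idn V x \<boxtimes> RUnit V y) \<cdot> Assoc V x y (TUnit V) = RUnit V (x \<otimes> y)" (is "?l = ?r")
proof (rule runit_faithful)
  note [simp] = x y
  let ?I = "TUnit V"
  let ?i = "Idn V (TUnit V)"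
  show "?l \<in> Hom V ((x \<otimes> y) \<otimes> ?I) (x \<otimes> y)" "?r \<in> Hom V ((x \<otimes> y) \<otimes> ?I) (x \<otimes> y)"
    by (simp_all add: Hom_iff)
  have "Assoc V x y ?I \<cdot> (?l \<boxtimes> ?i) =
      Assoc V x y ?I \<cdot> ((Idn V x \<boxtimes> RUnit V y) \<boxtimes> ?i) \<cdot> (Assoc V x y ?I \<boxtimes> ?i)"
    by simp
  also have "\<dots> = (Idn V x \<boxtimes> (RUnit V y \<boxtimes> ?i)) \<cdot> Assoc V x (y \<otimes> ?I) ?I \<cdot> (Assoc V x y ?I \<boxtimes> ?i)"
    using assoc_nat[of "Idn V x" x x "RUnit V y" "y \<otimes> ?I" y ?i ?I ?I]
    by (simp add: Hom_iff flip: comp_assoc del: tens_comp tens_comp')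
  also have "\<dots> = (Idn V x \<boxtimes> (Idn V y \<boxtimes> LUnit V ?I)) \<cdot>
      (Idn V x \<boxtimes> Assoc V y ?I ?I) \<cdot> Assoc V x (y \<otimes> ?I) ?I \<cdot> (Assoc V x y ?I \<boxtimes> ?i)"
    using triangle[of y ?I] by simp
  also have "\<dots> = (Idn V x \<boxtimes> (Idn V y \<boxtimes> LUnit V ?I)) \<cdot> Assoc V x y (?I \<otimes> ?I) \<cdot> Assoc V (x \<otimes> y) ?I ?I"
    by (simp only: pentagon[OF x y tunit tunit])
  also have "\<dots> = Assoc V x y ?I \<cdot> (Idn V (x \<otimes> y) \<boxtimes> LUnit V ?I) \<cdot> Assoc V (x \<otimes> y) ?I ?I"
    using assoc_nat[of "Idn V x" x x "Idn V y" y y "LUnit V ?I" "?I \<otimes> ?I" ?I]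
    by (simp add: Hom_iff flip: comp_assoc)
  also have "\<dots> = Assoc V x y ?I \<cdot> (?r \<boxtimes> ?i)"
    using triangle[of "x \<otimes> y" ?I] by simp
  finally have eq: "Assoc V x y ?I \<cdot> (?l \<boxtimes> ?i) = Assoc V x y ?I \<cdot> (?r \<boxtimes> ?i)" .
  from iso_mono[OF _ _ _ _ _ eq] show "?l \<boxtimes> ?i = ?r \<boxtimes> ?i" by simp
qed

text \<open>The hexagon at \<open>x, I, I\<close>, followed by left unitors, shows that
  \<open>?t\<close> and \<open>RUnit V x\<close> agree after tensoring with \<open>I\<close> and
  composing with \<open>?t\<close>. As \<open>?t\<close> is invertible and tensoring with
  \<open>I\<close> is faithful, they agree.\<close>

lemma lunit_symm:
  assumes x: "x \<in> Obj V"
  shows "LUnit V x \<cdot> Symm V x (TUnit V) = RUnit V x" (is "?t = _")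
proof (rule runit_faithful)
  note [simp] = x
  let ?I = "TUnit V"
  let ?i = "Idn V (TUnit V)"
  show "?t \<in> Hom V (x \<otimes> ?I) x" "RUnit V x \<in> Hom V (x \<otimes> ?I) x"
    by (simp_all add: Hom_iff)
  \<comment> \<open>Both sides become equal after \<open>RUnit V x\<close>, by naturality of the
    unitor at itself.\<close>
  have rr: "RUnit V (x \<otimes> ?I) = RUnit V x \<boxtimes> ?i"
    using runit_nat[of "RUnit V x" "x \<otimes> ?I" x]
    by - (rule iso_mono[of "RUnit V x"], simp_all add: Hom_iff)
  have "LUnit V x \<cdot> (?i \<boxtimes> LUnit V x) \<cdot> Assoc V ?I ?I x \<cdot> Symm V x (?I \<otimes> ?I) \<cdot> Assoc V x ?I ?I =
      LUnit V x \<cdot> (RUnit V ?I \<boxtimes> Idn V x) \<cdot> Symm V x (?I \<otimes> ?I) \<cdot> Assoc V x ?I ?I"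
    using triangle[of ?I x] by (simp flip: comp_assoc)
  also have "\<dots> = LUnit V x \<cdot> Symm V x ?I \<cdot> (Idn V x \<boxtimes> RUnit V ?I) \<cdot> Assoc V x ?I ?I"
    using symm_nat[of "Idn V x" x x "RUnit V ?I" "?I \<otimes> ?I" ?I]
    by (simp add: Hom_iff flip: comp_assoc)
  also have "\<dots> = ?t \<cdot> (RUnit V x \<boxtimes> ?i)"
    by (simp add: runit_tens rr comp_assoc)
  finally have 1: "LUnit V x \<cdot> (?i \<boxtimes> LUnit V x) \<cdot> Assoc V ?I ?I x \<cdot> Symm V x (?I \<otimes> ?I) \<cdot> Assoc V x ?I ?I
      = ?t \<cdot> (RUnit V x \<boxtimes> ?i)" .
  have "LUnit V x \<cdot> (?i \<boxtimes> LUnit V x) \<cdot> (?i \<boxtimes> Symm V x ?I) \<cdot> Assoc V ?I x ?I \<cdot> (Symm V x ?I \<boxtimes> ?i) =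
      LUnit V x \<cdot> (?i \<boxtimes> ?t) \<cdot> Assoc V ?I x ?I \<cdot> (Symm V x ?I \<boxtimes> ?i)"
    by simp
  also have "\<dots> = ?t \<cdot> LUnit V (x \<otimes> ?I) \<cdot> Assoc V ?I x ?I \<cdot> (Symm V x ?I \<boxtimes> ?i)"
    using lunit_nat[of ?t "x \<otimes> ?I" x] by (simp add: Hom_iff flip: comp_assoc)
  also have "\<dots> = ?t \<cdot> (LUnit V x \<boxtimes> ?i) \<cdot> (Symm V x ?I \<boxtimes> ?i)"
    using lunit_tens[of x ?I] by (simp flip: comp_assoc del: tens_comp tens_comp')
  also have "\<dots> = ?t \<cdot> (?t \<boxtimes> ?i)" by simp
  finally have eq: "?t \<cdot> (?t \<boxtimes> ?i) = ?t \<cdot> (RUnit V x \<boxtimes> ?i)"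
    using 1 unfolding hexagon[OF x tunit tunit] by simp
  have "is_iso V ?t" by (simp add: iso_comp)
  from iso_mono[OF this _ _ _ _ eq] show "?t \<boxtimes> ?i = RUnit V x \<boxtimes> ?i" by simp
qed

lemma runit_symm: "x \<in> Obj V \<Longrightarrow> RUnit V x \<cdot> Symm V (TUnit V) x = LUnit V x"
  using symm_symm[of "TUnit V" x] by (simp add: comp_assoc flip: lunit_symm)

text \<open>The hexagon for a tensor product in the first argument is the inverse of the given
  hexagon at \<open>z, x, y\<close>, since each symmetry is inverse to the opposite one. Both sides
  are therefore compared after precomposition with \<open>?e\<close>.\<close>

lemma hexagon2:
  assumes x: "x \<in> Obj V" and y: "y \<in> Obj V" and z: "z \<in> Obj V"
  shows "Symm V (x \<otimes> y) z = Assoc V z x y \<cdot> (Symm V x z \<boxtimes> Idn V y) \<cdot>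
    inverse_arr V (Assoc V x z y) \<cdot> (Idn V x \<boxtimes> Symm V y z) \<cdot> Assoc V x y z" (is "_ = ?r")
proof -
  note [simp] = x y z
  let ?a = "Assoc V x z y"
  note [simp] = inverse_arrD(1-3)[OF assoc_arr(4)[OF x z y]]
  let ?e = "Symm V z (x \<otimes> y) \<cdot> Assoc V z x y"
  have "?r \<cdot> ?e = Assoc V z x y \<cdot> (Symm V x z \<boxtimes> Idn V y) \<cdot>
    inverse_arr V ?a \<cdot> (Idn V x \<boxtimes> Symm V y z) \<cdot> Assoc V x y z \<cdot> Symm V z (x \<otimes> y) \<cdot> Assoc V z x y"
    by (simp add: comp_assoc)
  also have "\<dots> = Assoc V z x y \<cdot> (Symm V x z \<boxtimes> Idn V y) \<cdot>
    inverse_arr V ?a \<cdot> (Idn V x \<boxtimes> Symm V y z) \<cdot> (Idn V x \<boxtimes> Symm V z y) \<cdot> ?a \<cdot> (Symm V z x \<boxtimes> Idn V y)"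
    by (simp only: hexagon[OF z x y])
  also have "\<dots> = Assoc V z x y \<cdot> (Symm V x z \<boxtimes> Idn V y) \<cdot>
    (inverse_arr V ?a \<cdot> ?a) \<cdot> (Symm V z x \<boxtimes> Idn V y)"
    using symm_symm[of z y] by (simp add: comp_assoc)
  also have "\<dots> = Assoc V z x y"
    using symm_symm[of z x] inverse_arrD(4)[OF assoc_arr(4)[OF x z y]] by simp
  also have "\<dots> = Symm V (x \<otimes> y) z \<cdot> ?e"
    using symm_symm[of z "x \<otimes> y"] by (simp flip: comp_assoc)
  finally have eq: "?r \<cdot> ?e = Symm V (x \<otimes> y) z \<cdot> ?e" .
  have "is_iso V ?e" by (simp add: iso_comp)
  from iso_epi[OF this _ _ _ _ eq[symmetric]] show ?thesis by simp
qed

text \<open>The coherence behind the associativity of composition in an opposite category.\<close>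
lemma symm_assoc:
  assumes x: "x \<in> Obj V" and y: "y \<in> Obj V" and z: "z \<in> Obj V"
  shows "(Idn V z \<boxtimes> Symm V x y) \<cdot> Symm V (x \<otimes> y) z =
    Assoc V z y x \<cdot> (Symm V y z \<boxtimes> Idn V x) \<cdot> Symm V x (y \<otimes> z) \<cdot> Assoc V x y z"
proof -
  note [simp] = x y z
  let ?a = "Assoc V x z y"
  note [simp] = inverse_arrD(1-3)[OF assoc_arr(4)[OF x z y]]
  have "Assoc V z y x \<cdot> (Symm V y z \<boxtimes> Idn V x) \<cdot> Symm V x (y \<otimes> z) \<cdot> Assoc V x y z =
      Assoc V z y x \<cdot> Symm V x (z \<otimes> y) \<cdot> (Idn V x \<boxtimes> Symm V y z) \<cdot> Assoc V x y z"
    using symm_nat[of "Idn V x" x x "Symm V y z" "y \<otimes> z" "z \<otimes> y"]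
    by (simp add: Hom_iff flip: comp_assoc)
  \<comment> \<open>Inserting an associator and its inverse exposes the left side of the hexagon at
    \<open>x, z, y\<close>; what is left over is \<open>hexagon2\<close>.\<close>
  also have "\<dots> = Assoc V z y x \<cdot> Symm V x (z \<otimes> y) \<cdot> (?a \<cdot> inverse_arr V ?a) \<cdot>
      (Idn V x \<boxtimes> Symm V y z) \<cdot> Assoc V x y z"
    using inverse_arrD(5)[OF assoc_arr(4)[OF x z y]] by simp
  also have "\<dots> = (Assoc V z y x \<cdot> Symm V x (z \<otimes> y) \<cdot> ?a) \<cdot> inverse_arr V ?a \<cdot>
      (Idn V x \<boxtimes> Symm V y z) \<cdot> Assoc V x y z"
    by (simp add: comp_assoc)
  also have "\<dots> = (Idn V z \<boxtimes> Symm V x y) \<cdot> Symm V (x \<otimes> y) z"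
    unfolding hexagon[OF x z y] hexagon2[OF x y z] by (simp add: comp_assoc)
  finally show ?thesis ..
qed

end

section \<open>Enriched categories through generalised elements\<close>

context smcc begin

text \<open>
  Composition of generalised elements \<open>f : P \<rightarrow> A(x,y)\<close> and \<open>g : Q \<rightarrow> A(y,z)\<close>.
\<close>
definition gc :: "('o, 'a, 'c) vcat \<Rightarrow> 'c \<Rightarrow> 'c \<Rightarrow> 'c \<Rightarrow> 'a \<Rightarrow> 'a \<Rightarrow> 'a" where
  "gc A x y z g f = VComp A x y z \<cdot> (g \<boxtimes> f)"

lemma vcatD:
  assumes "is_vcat V A" "x \<in> VOb A" "y \<in> VOb A"
  shows vcat_hom: "VHom A x y \<in> Obj V"
    and vcat_comp: "z \<in> VOb A \<Longrightarrow> VComp A x y z \<in> Hom V (VHom A y z \<otimes> VHom A x y) (VHom A x z)"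
    and vcat_id: "VId A x \<in> Hom V (TUnit V) (VHom A x x)"
  using assms unfolding is_vcat_def by blast+

lemma gc_in:
  assumes "is_vcat V A" "x \<in> VOb A" "y \<in> VOb A" "z \<in> VOb A"
    "g \<in> Hom V Q (VHom A y z)" "f \<in> Hom V P (VHom A x y)"
  shows "gc A x y z g f \<in> Hom V (Q \<otimes> P) (VHom A x z)"
  unfolding gc_def using assms by (intro comp_in[OF tens_in vcat_comp])

lemma gc_comp:
  assumes "is_vcat V A" "x \<in> VOb A" "y \<in> VOb A" "z \<in> VOb A"
    "g \<in> Hom V Q (VHom A y z)" "f \<in> Hom V P (VHom A x y)" "u \<in> Hom V Q' Q" "v \<in> Hom V P' P"
  shows "gc A x y z (g \<cdot> u) (f \<cdot> v) = gc A x y z g f \<cdot> (u \<boxtimes> v)"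
  using assms(5-) vcat_comp[OF assms(1-4)] unfolding gc_def Hom_iff by (simp add: comp_assoc)

lemma gc_comp_left:
  assumes "is_vcat V A" "x \<in> VOb A" "y \<in> VOb A" "z \<in> VOb A"
    "g \<in> Hom V Q (VHom A y z)" "f \<in> Hom V P (VHom A x y)" "u \<in> Hom V Q' Q"
  shows "gc A x y z (g \<cdot> u) f = gc A x y z g f \<cdot> (u \<boxtimes> Idn V P)"
  using gc_comp[OF assms, of "Idn V P" P] assms(6) by (auto simp: Hom_iff)

lemma gc_comp_right:
  assumes "is_vcat V A" "x \<in> VOb A" "y \<in> VOb A" "z \<in> VOb A"
    "g \<in> Hom V Q (VHom A y z)" "f \<in> Hom V P (VHom A x y)" "v \<in> Hom V P' P"
  shows "gc A x y z g (f \<cdot> v) = gc A x y z g f \<cdot> (Idn V Q \<boxtimes> v)"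
  using gc_comp[OF assms(1-6) _ assms(7), of "Idn V Q" Q] assms(5) by (auto simp: Hom_iff)

lemma gc_Idn:
  assumes "is_vcat V A" "x \<in> VOb A" "y \<in> VOb A" "z \<in> VOb A"
  shows "gc A x y z (Idn V (VHom A y z)) (Idn V (VHom A x y)) = VComp A x y z"
  using vcat_comp[OF assms] vcat_hom[OF assms(1)] assms unfolding gc_def Hom_iff by simp

lemma gc_assoc:
  assumes A: "is_vcat V A" and w: "w \<in> VOb A" and x: "x \<in> VOb A" and y: "y \<in> VOb A"
    and z: "z \<in> VOb A" and a: "a \<in> Hom V P (VHom A y z)" and b: "b \<in> Hom V Q (VHom A x y)"
    and c: "c \<in> Hom V R (VHom A w x)"
  shows "gc A w x z (gc A x y z a b) c = gc A w y z a (gc A w x y b c) \<cdot> Assoc V P Q R"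
proof -
  note [simp] = hom_obj[OF a] hom_obj[OF b] hom_obj[OF c]
  have t [simp]: "a \<in> Arr V" "Dom V a = P" "Cod V a = VHom A y z"
    "b \<in> Arr V" "Dom V b = Q" "Cod V b = VHom A x y"
    "c \<in> Arr V" "Dom V c = R" "Cod V c = VHom A w x"
    using a b c by (auto simp: Hom_iff)
  have [simp]: "VComp A x y z \<in> Arr V" "Dom V (VComp A x y z) = VHom A y z \<otimes> VHom A x y"
    "Cod V (VComp A x y z) = VHom A x z" if "x \<in> VOb A" "y \<in> VOb A" "z \<in> VOb A" for x y z
    using vcat_comp[OF A that] by (auto simp: Hom_iff)
  have law: "VComp A w x z \<cdot> (VComp A x y z \<boxtimes> Idn V (VHom A w x)) =
        VComp A w y z \<cdot> (Idn V (VHom A y z) \<boxtimes> VComp A w x y) \<cdot>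
          Assoc V (VHom A y z) (VHom A x y) (VHom A w x)"
    using A w x y z unfolding is_vcat_def by blast
  have "gc A w x z (gc A x y z a b) c =
      (VComp A w x z \<cdot> (VComp A x y z \<boxtimes> Idn V (VHom A w x))) \<cdot> ((a \<boxtimes> b) \<boxtimes> c)"
    using w x y z by (simp add: gc_def comp_assoc)
  also have "\<dots> = VComp A w y z \<cdot> (Idn V (VHom A y z) \<boxtimes> VComp A w x y) \<cdot>
      (a \<boxtimes> (b \<boxtimes> c)) \<cdot> Assoc V P Q R"
    unfolding law using w x y z by (simp add: comp_assoc assoc_nat[OF a b c])
  also have "\<dots> = gc A w y z a (gc A w x y b c) \<cdot> Assoc V P Q R"
    using w x y z by (simp add: gc_def comp_assoc)
  finally show ?thesis .
qed

lemma gc_id_left: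
  assumes A: "is_vcat V A" and x: "x \<in> VOb A" and y: "y \<in> VOb A"
    and f: "f \<in> Hom V P (VHom A x y)"
  shows "gc A x y y (VId A y) f = f \<cdot> LUnit V P"
proof -
  have [simp]: "f \<in> Arr V" "Dom V f = P" "Cod V f = VHom A x y" using f by (auto simp: Hom_iff)
  have "gc A x y y (VId A y \<cdot> Idn V (TUnit V)) (Idn V (VHom A x y) \<cdot> f) =
      gc A x y y (VId A y) (Idn V (VHom A x y)) \<cdot> (Idn V (TUnit V) \<boxtimes> f)"
    by (rule gc_comp[OF A x y y vcat_id[OF A y y] idn_in[OF vcat_hom[OF A x y]] idn_in[OF tunit] f])
  moreover have "gc A x y y (VId A y) (Idn V (VHom A x y)) = LUnit V (VHom A x y)"
    using A x y unfolding is_vcat_def gc_def by blast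
  ultimately show ?thesis
    using vcat_id[OF A y y] lunit_nat[OF f] by (simp add: Hom_iff)
qed

lemma gc_id_right:
  assumes A: "is_vcat V A" and x: "x \<in> VOb A" and y: "y \<in> VOb A"
    and f: "f \<in> Hom V P (VHom A x y)"
  shows "gc A x x y f (VId A x) = f \<cdot> RUnit V P"
proof -
  have [simp]: "f \<in> Arr V" "Dom V f = P" "Cod V f = VHom A x y" using f by (auto simp: Hom_iff)
  have "gc A x x y (Idn V (VHom A x y) \<cdot> f) (VId A x \<cdot> Idn V (TUnit V)) =
      gc A x x y (Idn V (VHom A x y)) (VId A x) \<cdot> (f \<boxtimes> Idn V (TUnit V))"
    by (rule gc_comp[OF A x x y idn_in[OF vcat_hom[OF A x y]] vcat_id[OF A x x] f idn_in[OF tunit]])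
  moreover have "gc A x x y (Idn V (VHom A x y)) (VId A x) = RUnit V (VHom A x y)"
    using A x y unfolding is_vcat_def gc_def by blast
  ultimately show ?thesis
    using vcat_id[OF A x x] runit_nat[OF f] by (simp add: Hom_iff)
qed

text \<open>The identity of a hom-object is its generic element, so laws that hold for all
  generalised elements give the axioms on instantiating them at identities.\<close>

lemma is_vcatI:
  assumes h: "\<And>x y. x \<in> VOb A \<Longrightarrow> y \<in> VOb A \<Longrightarrow> VHom A x y \<in> Obj V"
    and c: "\<And>x y z. x \<in> VOb A \<Longrightarrow> y \<in> VOb A \<Longrightarrow> z \<in> VOb A \<Longrightarrow>
      VComp A x y z \<in> Hom V (VHom A y z \<otimes> VHom A x y) (VHom A x z)"
    and i: "\<And>x. x \<in> VOb A \<Longrightarrow> VId A x \<in> Hom V (TUnit V) (VHom A x x)"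
    and assoc: "\<And>w x y z P Q R a b c. \<lbrakk>w \<in> VOb A; x \<in> VOb A; y \<in> VOb A; z \<in> VOb A;
      a \<in> Hom V P (VHom A y z); b \<in> Hom V Q (VHom A x y); c \<in> Hom V R (VHom A w x)\<rbrakk> \<Longrightarrow>
      gc A w x z (gc A x y z a b) c = gc A w y z a (gc A w x y b c) \<cdot> Assoc V P Q R"
    and l: "\<And>x y P f. \<lbrakk>x \<in> VOb A; y \<in> VOb A; f \<in> Hom V P (VHom A x y)\<rbrakk> \<Longrightarrow>
      gc A x y y (VId A y) f = f \<cdot> LUnit V P"
    and r: "\<And>x y P f. \<lbrakk>x \<in> VOb A; y \<in> VOb A; f \<in> Hom V P (VHom A x y)\<rbrakk> \<Longrightarrow>
      gc A x x y f (VId A x) = f \<cdot> RUnit V P"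
  shows "is_vcat V A"
  unfolding is_vcat_def
proof (intro conjI ballI)
  fix w x y z assume o: "w \<in> VOb A" "x \<in> VOb A" "y \<in> VOb A" "z \<in> VOb A"
  have g: "gc A x y z (Idn V (VHom A y z)) (Idn V (VHom A x y)) = VComp A x y z"
    if "x \<in> VOb A" "y \<in> VOb A" "z \<in> VOb A" for x y z
    using c[of x y z] that h by (simp add: gc_def Hom_iff)
  have "gc A w x z (VComp A x y z) (Idn V (VHom A w x)) =
      gc A w y z (Idn V (VHom A y z)) (VComp A w x y) \<cdot> Assoc V (VHom A y z) (VHom A x y) (VHom A w x)"
    using assoc[OF o idn_in idn_in idn_in, OF h h h] o by (simp add: g)
  then show "VComp A w x z \<cdot> (VComp A x y z \<boxtimes> Idn V (VHom A w x)) =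
        VComp A w y z \<cdot> (Idn V (VHom A y z) \<boxtimes> VComp A w x y) \<cdot>
          Assoc V (VHom A y z) (VHom A x y) (VHom A w x)"
    using o c[of w y z] c[of w x y] h by (simp add: gc_def Hom_iff comp_assoc)
next
  fix x y assume "x \<in> VOb A" "y \<in> VOb A"
  then show "VComp A x y y \<cdot> (VId A y \<boxtimes> Idn V (VHom A x y)) = LUnit V (VHom A x y)"
    "VComp A x x y \<cdot> (Idn V (VHom A x y) \<boxtimes> VId A x) = RUnit V (VHom A x y)"
    using l[of x y "Idn V (VHom A x y)" "VHom A x y"] r[of x y "Idn V (VHom A x y)" "VHom A x y"] h
    by (simp_all add: gc_def idn_in)
qed (use h c i in auto)

text \<open>The two elements trade places; naturality of the symmetry moves it from the hom-objects
  to the stages \<open>Q\<close> and \<open>P\<close>.\<close>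

lemma gc_vop:
  assumes A: "is_vcat V A" and x: "x \<in> VOb A" and y: "y \<in> VOb A" and z: "z \<in> VOb A"
    and g: "g \<in> Hom V Q (VHom A z y)" and f: "f \<in> Hom V P (VHom A y x)"
  shows "gc (vop V A) x y z g f = gc A z y x f g \<cdot> Symm V Q P"
proof -
  have "gc (vop V A) x y z g f = (VComp A z y x \<cdot> Symm V (VHom A z y) (VHom A y x)) \<cdot> (g \<boxtimes> f)"
    by (simp add: gc_def vop_def)
  also have "\<dots> = gc A z y x f g \<cdot> Symm V Q P"
    using symm_nat[OF g f] g f vcat_comp[OF A z y x] vcat_hom[OF A z y] vcat_hom[OF A y x]
    hom_obj[OF g] hom_obj[OF f] by (simp add: gc_def Hom_iff comp_assoc)
  finally show ?thesis .
qed

lemma vop_simps [simp]: "VOb (vop V A) = VOb A" "VHom (vop V A) x y = VHom A y x"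
    "VId (vop V A) = VId A"
  by (simp_all add: vop_def)

text \<open>At elements, associativity in the opposite category is associativity in \<open>A\<close>
  read backwards, up to a permutation of the three stages. That permutation is settled by
  \<open>symm_assoc\<close>; the unit laws exchange the two unitors through
  \<open>lunit_symm\<close> and \<open>runit_symm\<close>.\<close>

lemma vop_vcat:
  assumes A: "is_vcat V A" shows "is_vcat V (vop V A)"
proof (rule is_vcatI, unfold vop_simps)
  fix x y assume o: "x \<in> VOb A" "y \<in> VOb A"
  then show "VHom A y x \<in> Obj V" by (simp add: vcat_hom[OF A])
next
  fix x assume "x \<in> VOb A"
  then show "VId A x \<in> Hom V (TUnit V) (VHom A x x)" by (simp add: vcat_id[OF A])
next
  fix x y z assume "x \<in> VOb A" "y \<in> VOb A" "z \<in> VOb A"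
  then show "VComp (vop V A) x y z \<in> Hom V (VHom A z y \<otimes> VHom A y x) (VHom A z x)"
    using vcat_comp[OF A, of z y x] by (simp add: vop_def Hom_iff vcat_hom[OF A])
next
  fix w x y z P Q R a b c assume o: "w \<in> VOb A" "x \<in> VOb A" "y \<in> VOb A" "z \<in> VOb A"
    and a: "a \<in> Hom V P (VHom A z y)" and b: "b \<in> Hom V Q (VHom A y x)"
    and c: "c \<in> Hom V R (VHom A x w)"
  note [simp] = hom_obj[OF a] hom_obj[OF b] hom_obj[OF c]
  note ba = gc_in[OF A o(4,3,2) b a] and cb = gc_in[OF A o(3,2,1) c b]
  note cba = gc_in[OF A o(4,2,1) c ba]
  have s: "Symm V x y \<in> Hom V (x \<otimes> y) (y \<otimes> x)" if "x \<in> Obj V" "y \<in> Obj V" for x y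
    using that by (simp add: Hom_iff)
  have "gc (vop V A) w x z (gc (vop V A) x y z a b) c =
      gc A z x w c (gc A z y x b a \<cdot> Symm V P Q) \<cdot> Symm V (P \<otimes> Q) R"
    using gc_vop[OF A o(2,3,4) a b] gc_vop[OF A o(1,2,4) comp_in[OF s ba] c] by simp
  also have "\<dots> = gc A z x w c (gc A z y x b a) \<cdot> (Idn V R \<boxtimes> Symm V P Q) \<cdot> Symm V (P \<otimes> Q) R"
    using gc_comp_right[OF A o(4,2,1) c ba s] cba by (simp add: Hom_iff comp_assoc)
  also have "\<dots> = gc A z x w c (gc A z y x b a) \<cdot> Assoc V R Q P \<cdot> (Symm V Q R \<boxtimes> Idn V P) \<cdot>
      Symm V P (Q \<otimes> R) \<cdot> Assoc V P Q R"
    using symm_assoc[of P Q R] by simp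
  also have "\<dots> = (gc A z y w (gc A y x w c b) a \<cdot> (Symm V Q R \<boxtimes> Idn V P)) \<cdot>
      Symm V P (Q \<otimes> R) \<cdot> Assoc V P Q R"
    using gc_assoc[OF A o(4,3,2,1) c b a] cba by (simp add: Hom_iff comp_assoc)
  also have "\<dots> = gc A z y w (gc A y x w c b \<cdot> Symm V Q R) a \<cdot> Symm V P (Q \<otimes> R) \<cdot> Assoc V P Q R"
    using gc_comp_left[OF A o(4,3,1) cb a s] by simp
  also have "\<dots> = gc (vop V A) w y z a (gc (vop V A) w x y b c) \<cdot> Assoc V P Q R"
    using gc_vop[OF A o(1,2,3) b c] gc_vop[OF A o(1,3,4) a comp_in[OF s cb]]
      gc_in[OF A o(4,3,1) comp_in[OF s cb] a] by (simp add: Hom_iff comp_assoc)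
  finally show "gc (vop V A) w x z (gc (vop V A) x y z a b) c =
    gc (vop V A) w y z a (gc (vop V A) w x y b c) \<cdot> Assoc V P Q R" .
next
  fix x y P f assume o: "x \<in> VOb A" "y \<in> VOb A" and f: "f \<in> Hom V P (VHom A y x)"
  note [simp] = hom_obj[OF f]
  show "gc (vop V A) x y y (VId A y) f = f \<cdot> LUnit V P"
    using gc_vop[OF A o o(2) vcat_id[OF A o(2,2)] f] gc_id_right[OF A o(2,1) f] f
      runit_symm[of P] by (simp add: Hom_iff comp_assoc)
  show "gc (vop V A) x x y f (VId A x) = f \<cdot> RUnit V P"
    using gc_vop[OF A o(1,1,2) f vcat_id[OF A o(1,1)]] gc_id_left[OF A o(2,1) f] f
      lunit_symm[of P] by (simp add: Hom_iff comp_assoc)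
qed

section \<open>Functors in terms of generalised elements\<close>

lemma vfunctorD:
  assumes "is_vfunctor V A B F"
  shows vfun_vcat: "is_vcat V A" "is_vcat V B"
    and vfun_ob: "x \<in> VOb A \<Longrightarrow> FOb F x \<in> VOb B"
    and vfun_hom: "x \<in> VOb A \<Longrightarrow> y \<in> VOb A \<Longrightarrow>
      FHom F x y \<in> Hom V (VHom A x y) (VHom B (FOb F x) (FOb F y))"
    and vfun_id: "x \<in> VOb A \<Longrightarrow> FHom F x x \<cdot> VId A x = VId B (FOb F x)"
    and vfun_eq: "F = restrict_vfun A (FOb F) (FHom F)"
  using assms unfolding is_vfunctor_def by blast+

lemma vfun_gc:
  assumes F: "is_vfunctor V A B F" and x: "x \<in> VOb A" and y: "y \<in> VOb A" and z: "z \<in> VOb A"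
    and g: "g \<in> Hom V Q (VHom A y z)" and f: "f \<in> Hom V P (VHom A x y)"
  shows "FHom F x z \<cdot> gc A x y z g f =
    gc B (FOb F x) (FOb F y) (FOb F z) (FHom F y z \<cdot> g) (FHom F x y \<cdot> f)"
proof -
  note A = vfun_vcat(1)[OF F] and B = vfun_vcat(2)[OF F] and h = vfun_hom[OF F] and o = vfun_ob[OF F]
  have "FHom F x z \<cdot> VComp A x y z =
      VComp B (FOb F x) (FOb F y) (FOb F z) \<cdot> (FHom F y z \<boxtimes> FHom F x y)"
    using F x y z unfolding is_vfunctor_def by blast
  then have "FHom F x z \<cdot> gc A x y z g f =
      (VComp B (FOb F x) (FOb F y) (FOb F z) \<cdot> (FHom F y z \<boxtimes> FHom F x y)) \<cdot> (g \<boxtimes> f)"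
    using vcat_comp[OF A x y z] h[OF x z] f g by (simp add: gc_def Hom_iff flip: comp_assoc)
  then show ?thesis
    using vcat_comp[OF B o[OF x] o[OF y] o[OF z]] h[OF x y] h[OF y z] f g
    by (simp add: gc_def Hom_iff comp_assoc)
qed

lemma vfunctorI:
  assumes A: "is_vcat V A" and B: "is_vcat V B"
    and eq: "F = restrict_vfun A (FOb F) (FHom F)"
    and o: "\<And>x. x \<in> VOb A \<Longrightarrow> FOb F x \<in> VOb B"
    and h: "\<And>x y. x \<in> VOb A \<Longrightarrow> y \<in> VOb A \<Longrightarrow>
      FHom F x y \<in> Hom V (VHom A x y) (VHom B (FOb F x) (FOb F y))"
    and i: "\<And>x. x \<in> VOb A \<Longrightarrow> FHom F x x \<cdot> VId A x = VId B (FOb F x)"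
    and c: "\<And>x y z P Q f g. \<lbrakk>x \<in> VOb A; y \<in> VOb A; z \<in> VOb A;
      g \<in> Hom V Q (VHom A y z); f \<in> Hom V P (VHom A x y)\<rbrakk> \<Longrightarrow>
      FHom F x z \<cdot> gc A x y z g f =
        gc B (FOb F x) (FOb F y) (FOb F z) (FHom F y z \<cdot> g) (FHom F x y \<cdot> f)"
  shows "is_vfunctor V A B F"
  unfolding is_vfunctor_def
proof (intro conjI ballI A B eq o h i)
  fix x y z assume o: "x \<in> VOb A" "y \<in> VOb A" "z \<in> VOb A"
  show "FHom F x z \<cdot> VComp A x y z =
      VComp B (FOb F x) (FOb F y) (FOb F z) \<cdot> (FHom F y z \<boxtimes> FHom F x y)"
    using c[OF o idn_in idn_in, OF vcat_hom[OF A o(2,3)] vcat_hom[OF A o(1,2)]]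
      gc_Idn[OF A o] h[OF o(1,2)] h[OF o(2,3)] by (simp add: gc_def Hom_iff)
qed

lemma vfun_comp_simps [simp]:
  "x \<in> VOb A \<Longrightarrow> FOb (vfun_comp V A G F) x = FOb G (FOb F x)"
  "x \<in> VOb A \<Longrightarrow> y \<in> VOb A \<Longrightarrow>
    FHom (vfun_comp V A G F) x y = FHom G (FOb F x) (FOb F y) \<cdot> FHom F x y"
  by (simp_all add: vfun_comp_def restrict_vfun_def)

lemma restrict_vfun_simps [simp]:
  "x \<in> VOb A \<Longrightarrow> FOb (restrict_vfun A Fo Fh) x = Fo x"
  "x \<in> VOb A \<Longrightarrow> y \<in> VOb A \<Longrightarrow> FHom (restrict_vfun A Fo Fh) x y = Fh x y"
  by (simp_all add: restrict_vfun_def)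

text \<open>Supplies the extensionality clause of \<open>is_vfunctor\<close> for every functor built
  by \<open>restrict_vfun\<close>.\<close>

lemma restrict_vfun_idem:
  "restrict_vfun A Fo Fh =
    restrict_vfun A (FOb (restrict_vfun A Fo Fh)) (FHom (restrict_vfun A Fo Fh))"
  by (simp add: restrict_vfun_def restrict_def fun_eq_iff)

lemma vfun_comp_functor:
  assumes F: "is_vfunctor V A B F" and G: "is_vfunctor V B C G"
  shows "is_vfunctor V A C (vfun_comp V A G F)"
proof (rule vfunctorI)
  show "is_vcat V A" "is_vcat V C" by (fact vfun_vcat[OF F] vfun_vcat[OF G])+
  show "vfun_comp V A G F =
      restrict_vfun A (FOb (vfun_comp V A G F)) (FHom (vfun_comp V A G F))"
    unfolding vfun_comp_def by (rule restrict_vfun_idem)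
next
  fix x assume x: "x \<in> VOb A"
  show "FOb (vfun_comp V A G F) x \<in> VOb C" using x vfun_ob[OF F] vfun_ob[OF G] by simp
  show "FHom (vfun_comp V A G F) x x \<cdot> VId A x = VId C (FOb (vfun_comp V A G F) x)"
    using vfun_id[OF F x] vfun_id[OF G vfun_ob[OF F x]] x vfun_hom[OF F x x]
      vfun_hom[OF G vfun_ob[OF F x] vfun_ob[OF F x]] vcat_id[OF vfun_vcat(1)[OF F] x x]
    by (simp add: Hom_iff comp_assoc)
next
  fix x y assume "x \<in> VOb A" "y \<in> VOb A"
  then show "FHom (vfun_comp V A G F) x y \<in>
      Hom V (VHom A x y) (VHom C (FOb (vfun_comp V A G F) x) (FOb (vfun_comp V A G F) y))"
    using comp_in[OF vfun_hom[OF F] vfun_hom[OF G vfun_ob[OF F] vfun_ob[OF F]]] by simp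
next
  fix x y z P Q f g assume o: "x \<in> VOb A" "y \<in> VOb A" "z \<in> VOb A"
    and g: "g \<in> Hom V Q (VHom A y z)" and f: "f \<in> Hom V P (VHom A x y)"
  note h = vfun_hom[OF F] and h' = vfun_hom[OF G vfun_ob[OF F] vfun_ob[OF F]]
  note fg = gc_in[OF vfun_vcat(1)[OF F] o g f]
  have "FHom (vfun_comp V A G F) x z \<cdot> gc A x y z g f =
      FHom G (FOb F x) (FOb F z) \<cdot> (FHom F x z \<cdot> gc A x y z g f)"
    using o h[of x z] h'[of x z] fg by (simp add: comp_assoc Hom_iff)
  also have "\<dots> = FHom G (FOb F x) (FOb F z) \<cdot>
      gc B (FOb F x) (FOb F y) (FOb F z) (FHom F y z \<cdot> g) (FHom F x y \<cdot> f)"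
    by (simp add: vfun_gc[OF F o g f])
  also have "\<dots> = gc C (FOb G (FOb F x)) (FOb G (FOb F y)) (FOb G (FOb F z))
      (FHom G (FOb F y) (FOb F z) \<cdot> FHom F y z \<cdot> g) (FHom G (FOb F x) (FOb F y) \<cdot> FHom F x y \<cdot> f)"
    using o f g h by (intro vfun_gc[OF G] vfun_ob[OF F]) (auto intro: comp_in)
  finally show "FHom (vfun_comp V A G F) x z \<cdot> gc A x y z g f =
      gc C (FOb (vfun_comp V A G F) x) (FOb (vfun_comp V A G F) y) (FOb (vfun_comp V A G F) z)
        (FHom (vfun_comp V A G F) y z \<cdot> g) (FHom (vfun_comp V A G F) x y \<cdot> f)"
    using o f g h[of x y] h'[of x y] h[of y z] h'[of y z] by (simp add: Hom_iff comp_assoc)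
qed

section \<open>Natural families in terms of generalised elements\<close>

lemma nat_family_iff:
  assumes F: "is_vfunctor V A B F" and G: "is_vfunctor V A B G"
  shows "nat_family V A B F G W p \<longleftrightarrow> W \<in> Obj V \<and>
     (\<forall>x\<in>VOb A. p x \<in> Hom V W (VHom B (FOb F x) (FOb G x))) \<and>
     (\<forall>x\<in>VOb A. \<forall>y\<in>VOb A. gc B (FOb F x) (FOb F y) (FOb G y) (p y) (FHom F x y) =
       gc B (FOb F x) (FOb G x) (FOb G y) (FHom G x y) (p x) \<cdot> Symm V W (VHom A x y))"
proof -
  note A = vfun_vcat(1)[OF F] and B = vfun_vcat(2)[OF F]
  have "gc B (FOb F x) (FOb G x) (FOb G y) (FHom G x y) (p x) \<cdot> Symm V W (VHom A x y) =
      VComp B (FOb F x) (FOb G x) (FOb G y) \<cdot> (FHom G x y \<boxtimes> p x) \<cdot> Symm V W (VHom A x y)"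
    if o: "x \<in> VOb A" "y \<in> VOb A" and "W \<in> Obj V" "p x \<in> Hom V W (VHom B (FOb F x) (FOb G x))" for x y
    using vcat_comp[OF B vfun_ob[OF F o(1)] vfun_ob[OF G o(1)] vfun_ob[OF G o(2)]]
      vfun_hom[OF G o] that vcat_hom[OF A o] by (simp add: gc_def Hom_iff comp_assoc)
  then show ?thesis unfolding nat_family_def by (auto simp: gc_def)
qed

lemma nat_familyD:
  assumes "nat_family V A B F G W p"
  shows nat_obj: "W \<in> Obj V"
    and nat_in: "x \<in> VOb A \<Longrightarrow> p x \<in> Hom V W (VHom B (FOb F x) (FOb G x))"
  using assms unfolding nat_family_def by blast+

text \<open>The defining square is the case of the generic element of \<open>A(x,y)\<close>.
  Precomposition with \<open>a\<close> gives all others, and naturality moves the symmetry onto the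
  stages.\<close>

lemma nat_gc:
  assumes F: "is_vfunctor V A B F" and G: "is_vfunctor V A B G" and p: "nat_family V A B F G W p"
    and x: "x \<in> VOb A" and y: "y \<in> VOb A" and a: "a \<in> Hom V P (VHom A x y)"
  shows "gc B (FOb F x) (FOb F y) (FOb G y) (p y) (FHom F x y \<cdot> a) =
    gc B (FOb F x) (FOb G x) (FOb G y) (FHom G x y \<cdot> a) (p x) \<cdot> Symm V W P"
proof -
  note B = vfun_vcat(2)[OF F] and fx = vfun_ob[OF F x] and fy = vfun_ob[OF F y]
    and gx = vfun_ob[OF G x] and gy = vfun_ob[OF G y]
  note W = nat_obj[OF p] and px = nat_in[OF p x] and py = nat_in[OF p y]
  note [simp] = hom_obj[OF a] W
  have "gc B (FOb F x) (FOb F y) (FOb G y) (p y) (FHom F x y \<cdot> a) =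
      gc B (FOb F x) (FOb F y) (FOb G y) (p y) (FHom F x y) \<cdot> (Idn V W \<boxtimes> a)"
    by (rule gc_comp_right[OF B fx fy gy py vfun_hom[OF F x y] a])
  also have "\<dots> = (gc B (FOb F x) (FOb G x) (FOb G y) (FHom G x y) (p x) \<cdot> Symm V W (VHom A x y)) \<cdot>
      (Idn V W \<boxtimes> a)"
    using p x y unfolding nat_family_iff[OF F G] by simp
  also have "\<dots> = (gc B (FOb F x) (FOb G x) (FOb G y) (FHom G x y) (p x) \<cdot> (a \<boxtimes> Idn V W)) \<cdot> Symm V W P"
    using symm_nat[OF idn_in[OF W] a] gc_in[OF B fx gx gy vfun_hom[OF G x y] px] a
    by (simp add: Hom_iff comp_assoc)
  also have "\<dots> = gc B (FOb F x) (FOb G x) (FOb G y) (FHom G x y \<cdot> a) (p x) \<cdot> Symm V W P"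
    by (simp add: gc_comp_left[OF B fx gx gy vfun_hom[OF G x y] px a])
  finally show ?thesis .
qed

lemma nat_familyI:
  assumes F: "is_vfunctor V A B F" and G: "is_vfunctor V A B G" and "W \<in> Obj V"
    and "\<And>x. x \<in> VOb A \<Longrightarrow> p x \<in> Hom V W (VHom B (FOb F x) (FOb G x))"
    and n: "\<And>x y P a. \<lbrakk>x \<in> VOb A; y \<in> VOb A; a \<in> Hom V P (VHom A x y)\<rbrakk> \<Longrightarrow>
      gc B (FOb F x) (FOb F y) (FOb G y) (p y) (FHom F x y \<cdot> a) =
      gc B (FOb F x) (FOb G x) (FOb G y) (FHom G x y \<cdot> a) (p x) \<cdot> Symm V W P"
  shows "nat_family V A B F G W p"
  unfolding nat_family_iff[OF F G]
proof (intro conjI ballI assms(3,4))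
  fix x y assume o: "x \<in> VOb A" "y \<in> VOb A"
  note h = idn_in[OF vcat_hom[OF vfun_vcat(1)[OF F] o]]
  show "gc B (FOb F x) (FOb F y) (FOb G y) (p y) (FHom F x y) =
      gc B (FOb F x) (FOb G x) (FOb G y) (FHom G x y) (p x) \<cdot> Symm V W (VHom A x y)"
    using n[OF o h] vfun_hom[OF F o] vfun_hom[OF G o] by (simp add: Hom_iff)
qed

lemma nat_familyI':
  assumes F: "is_vfunctor V A B F" and G: "is_vfunctor V A B G" and "W \<in> Obj V"
    and "\<And>x. x \<in> VOb A \<Longrightarrow> p x \<in> Hom V W (VHom B (FOb F x) (FOb G x))"
    and n: "\<And>x y. \<lbrakk>x \<in> VOb A; y \<in> VOb A\<rbrakk> \<Longrightarrow>
      gc B (FOb F x) (FOb F y) (FOb G y) (p y) (FHom F x y) =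
      gc B (FOb F x) (FOb G x) (FOb G y) (FHom G x y) (p x) \<cdot> Symm V W (VHom A x y)"
  shows "nat_family V A B F G W p"
  unfolding nat_family_iff[OF F G] using assms by blast

end

section \<open>Representable functors and the Yoneda lemma\<close>

text \<open>
  A \<open>V\<close>-category \<open>S\<close> with a fully faithful functor to \<open>V\<close>, sending \<open>x\<close> to \<open>car x\<close> and presented by
  evaluation maps rather than by its action on hom-objects. The two instances are \<open>V\<close> itself and,
  over the larger base, the base change of \<open>V\<close>.
\<close>
locale concrete = smcc V for V :: "('o, 'a) smcc" (structure) +
  fixes S :: "('o, 'a, 'd) vcat" and car :: "'d \<Rightarrow> 'o" and ev :: "'d \<Rightarrow> 'd \<Rightarrow> 'a"
  assumes S_hom: "\<lbrakk>x \<in> VOb S; y \<in> VOb S\<rbrakk> \<Longrightarrow> VHom S x y \<in> Obj V"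
    and S_comp: "\<lbrakk>x \<in> VOb S; y \<in> VOb S; z \<in> VOb S\<rbrakk> \<Longrightarrow>
      VComp S x y z \<in> Hom V (VHom S y z \<otimes> VHom S x y) (VHom S x z)"
    and S_id: "x \<in> VOb S \<Longrightarrow> VId S x \<in> Hom V (TUnit V) (VHom S x x)"
    and car: "x \<in> VOb S \<Longrightarrow> car x \<in> Obj V"
    and ev_in: "\<lbrakk>x \<in> VOb S; y \<in> VOb S\<rbrakk> \<Longrightarrow> ev x y \<in> Hom V (VHom S x y \<otimes> car x) (car y)"
    and ev_universal: "\<lbrakk>x \<in> VOb S; y \<in> VOb S; W \<in> Obj V; f \<in> Hom V (W \<otimes> car x) (car y)\<rbrakk> \<Longrightarrow>
      \<exists>!g. g \<in> Hom V W (VHom S x y) \<and> ev x y \<cdot> (g \<boxtimes> Idn V (car x)) = f"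
    and ev_comp: "\<lbrakk>x \<in> VOb S; y \<in> VOb S; z \<in> VOb S\<rbrakk> \<Longrightarrow>
      ev x z \<cdot> (VComp S x y z \<boxtimes> Idn V (car x)) =
      ev y z \<cdot> (Idn V (VHom S y z) \<boxtimes> ev x y) \<cdot> Assoc V (VHom S y z) (VHom S x y) (car x)"
    and ev_id: "x \<in> VOb S \<Longrightarrow> ev x x \<cdot> (VId S x \<boxtimes> Idn V (car x)) = LUnit V (car x)"
begin

text \<open>This is \<open>s(k)\<close>: an element of the hom-object applied to an element of the
  carrier of its source.\<close>

definition ap :: "'d \<Rightarrow> 'd \<Rightarrow> 'a \<Rightarrow> 'a \<Rightarrow> 'a" where
  "ap x y s k = ev x y \<cdot> (s \<boxtimes> k)"

lemma ap_in:
  assumes "x \<in> VOb S" "y \<in> VOb S" "s \<in> Hom V P (VHom S x y)" "k \<in> Hom V K (car x)"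
  shows "ap x y s k \<in> Hom V (P \<otimes> K) (car y)"
  unfolding ap_def by (intro comp_in[OF tens_in ev_in] assms)

lemma ap_comp:
  assumes "x \<in> VOb S" "y \<in> VOb S" "s \<in> Hom V P (VHom S x y)" "k \<in> Hom V K (car x)"
    "u \<in> Hom V P' P" "v \<in> Hom V K' K"
  shows "ap x y (s \<cdot> u) (k \<cdot> v) = ap x y s k \<cdot> (u \<boxtimes> v)"
  using assms(3-) ev_in[OF assms(1-2)] unfolding ap_def Hom_iff by (simp add: comp_assoc)

lemma ap_comp_left:
  assumes "x \<in> VOb S" "y \<in> VOb S" "s \<in> Hom V P (VHom S x y)" "k \<in> Hom V K (car x)"
    "u \<in> Hom V P' P"
  shows "ap x y (s \<cdot> u) k = ap x y s k \<cdot> (u \<boxtimes> Idn V K)"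
  using ap_comp[OF assms, of "Idn V K" K] assms(4) by (auto simp: Hom_iff)

lemma ap_comp_right:
  assumes "x \<in> VOb S" "y \<in> VOb S" "s \<in> Hom V P (VHom S x y)" "k \<in> Hom V K (car x)"
    "v \<in> Hom V K' K"
  shows "ap x y s (k \<cdot> v) = ap x y s k \<cdot> (Idn V P \<boxtimes> v)"
  using ap_comp[OF assms(1-4) _ assms(5), of "Idn V P" P] assms(3) by (auto simp: Hom_iff)

lemma ap_Idn:
  assumes "x \<in> VOb S" "y \<in> VOb S" "s \<in> Hom V P (VHom S x y)" "k \<in> Hom V K (car x)"
  shows "ap x y s k = ap x y s (Idn V (car x)) \<cdot> (Idn V P \<boxtimes> k)"
  using ap_comp_right[OF assms(1-3) idn_in assms(4)] assms(4) car[OF assms(1)]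
  by (simp add: Hom_iff)

lemma ap_gc:
  assumes x: "x \<in> VOb S" and y: "y \<in> VOb S" and z: "z \<in> VOb S"
    and s: "s \<in> Hom V P (VHom S y z)" and r: "r \<in> Hom V Q (VHom S x y)"
    and k: "k \<in> Hom V K (car x)"
  shows "ap x z (gc S x y z s r) k = ap y z s (ap x y r k) \<cdot> Assoc V P Q K"
proof -
  note [simp] = hom_obj[OF s] hom_obj[OF r] hom_obj[OF k]
  note t = s[unfolded Hom_iff] r[unfolded Hom_iff] k[unfolded Hom_iff]
    ev_in[OF x y, unfolded Hom_iff] ev_in[OF y z, unfolded Hom_iff] ev_in[OF x z, unfolded Hom_iff]
    S_comp[OF x y z, unfolded Hom_iff]
  have "ap x z (gc S x y z s r) k =
      (ev x z \<cdot> (VComp S x y z \<boxtimes> Idn V (car x))) \<cdot> ((s \<boxtimes> r) \<boxtimes> k)"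
    using t by (simp add: ap_def gc_def comp_assoc)
  also have "\<dots> = ev y z \<cdot> (Idn V (VHom S y z) \<boxtimes> ev x y) \<cdot>
      (s \<boxtimes> (r \<boxtimes> k)) \<cdot> Assoc V P Q K"
    unfolding ev_comp[OF x y z] using t by (simp add: comp_assoc assoc_nat[OF s r k])
  also have "\<dots> = ap y z s (ap x y r k) \<cdot> Assoc V P Q K"
    using t by (simp add: ap_def comp_assoc)
  finally show ?thesis .
qed

lemma ap_id:
  assumes x: "x \<in> VOb S" and k: "k \<in> Hom V K (car x)"
  shows "ap x x (VId S x) k = k \<cdot> LUnit V K"
  using ap_Idn[OF x x S_id[OF x] k] ev_id[OF x] lunit_nat[OF k] by (simp add: ap_def)

text \<open>Uniqueness in \<open>ev_universal\<close>: the identity of the carrier is its generic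
  element, so a morphism is determined by its value there.\<close>

lemma ap_ext:
  assumes "x \<in> VOb S" "y \<in> VOb S" "s \<in> Hom V P (VHom S x y)" "r \<in> Hom V P (VHom S x y)"
    "ap x y s (Idn V (car x)) = ap x y r (Idn V (car x))"
  shows "s = r"
  using ev_universal[OF assms(1,2) hom_obj(1)[OF assms(3)]
    ap_in[OF assms(1-3) idn_in[OF car[OF assms(1)]]]] assms(3-5)
  unfolding ap_def by metis

lemma ap_obtain:
  assumes "x \<in> VOb S" "y \<in> VOb S" "P \<in> Obj V" "f \<in> Hom V (P \<otimes> car x) (car y)"
  obtains s where "s \<in> Hom V P (VHom S x y)" "ap x y s (Idn V (car x)) = f"
  using ev_universal[OF assms] unfolding ap_def by blast

lemma gc_S_in:
  assumes "x \<in> VOb S" "y \<in> VOb S" "z \<in> VOb S"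
    "s \<in> Hom V P (VHom S y z)" "r \<in> Hom V Q (VHom S x y)"
  shows "gc S x y z s r \<in> Hom V (P \<otimes> Q) (VHom S x z)"
  unfolding gc_def by (intro comp_in[OF tens_in S_comp] assms)

text \<open>The locale fixes composition and identities only through their evaluation. Since
  evaluation detects equality, the category laws follow from the monoidal coherence laws.\<close>

lemma S_vcat: "is_vcat V S"
proof (rule is_vcatI)
  fix w x y z P Q R a b c assume o: "w \<in> VOb S" "x \<in> VOb S" "y \<in> VOb S" "z \<in> VOb S"
    and a: "a \<in> Hom V P (VHom S y z)" and b: "b \<in> Hom V Q (VHom S x y)"
    and c: "c \<in> Hom V R (VHom S w x)"
  note [simp] = hom_obj(1)[OF a] hom_obj(1)[OF b] hom_obj(1)[OF c] car[OF o(1)]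
  note i = idn_in[OF car[OF o(1)]]
  note bc = gc_S_in[OF o(1-3) b c] and ab = gc_S_in[OF o(2-4) a b]
  let ?K = "car w" and ?i = "Idn V (car w)"
  note ck = ap_in[OF o(1,2) c i] note bck = ap_in[OF o(2,3) b ck] note abck = ap_in[OF o(3,4) a bck]
  note abc = gc_S_in[OF o(1,3,4) a bc]
  have al: "Assoc V x y z \<in> Hom V ((x \<otimes> y) \<otimes> z) (x \<otimes> (y \<otimes> z))" if "x \<in> Obj V" "y \<in> Obj V" "z \<in> Obj V" for x y z
    using that by (simp add: Hom_iff)
  show "gc S w x z (gc S x y z a b) c = gc S w y z a (gc S w x y b c) \<cdot> Assoc V P Q R"
  proof (rule ap_ext[OF o(1,4)])
    show "gc S w x z (gc S x y z a b) c \<in> Hom V ((P \<otimes> Q) \<otimes> R) (VHom S w z)"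
      by (rule gc_S_in[OF o(1,2,4) ab c])
    show "gc S w y z a (gc S w x y b c) \<cdot> Assoc V P Q R \<in> Hom V ((P \<otimes> Q) \<otimes> R) (VHom S w z)"
      by (rule comp_in[OF al abc]) simp_all
    have "ap w z (gc S w x z (gc S x y z a b) c) ?i =
        (ap y z a (ap x y b (ap w x c ?i)) \<cdot> Assoc V P Q (R \<otimes> ?K)) \<cdot> Assoc V (P \<otimes> Q) R ?K"
      by (simp add: ap_gc[OF o(1,2,4) ab c i] ap_gc[OF o(2-4) a b ck])
    \<comment> \<open>The pentagon reconciles the two ways of bracketing three morphisms and their
      argument.\<close>
    also have "\<dots> = ap y z a (ap x y b (ap w x c ?i)) \<cdot>
        (Idn V P \<boxtimes> Assoc V Q R ?K) \<cdot> Assoc V P (Q \<otimes> R) ?K \<cdot> (Assoc V P Q R \<boxtimes> ?i)"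
      using abck pentagon[of P Q R ?K] by (simp add: comp_assoc Hom_iff)
    also have "\<dots> = ap y z a (ap x y b (ap w x c ?i) \<cdot> Assoc V Q R ?K) \<cdot>
        Assoc V P (Q \<otimes> R) ?K \<cdot> (Assoc V P Q R \<boxtimes> ?i)"
      using abck by (simp add: ap_comp_right[OF o(3,4) a bck al] comp_assoc Hom_iff)
    also have "\<dots> = ap w z (gc S w y z a (gc S w x y b c)) ?i \<cdot> (Assoc V P Q R \<boxtimes> ?i)"
      using ap_in[OF o(3,4) a comp_in[OF al bck]]
      by (simp add: ap_gc[OF o(1,3,4) a bc i] ap_gc[OF o(1,2,3) b c i] comp_assoc Hom_iff)
    also have "\<dots> = ap w z (gc S w y z a (gc S w x y b c) \<cdot> Assoc V P Q R) ?i"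
      by (simp add: ap_comp_left[OF o(1,4) abc i al])
    finally show "ap w z (gc S w x z (gc S x y z a b) c) ?i =
      ap w z (gc S w y z a (gc S w x y b c) \<cdot> Assoc V P Q R) ?i" .
  qed
next
  fix x y P f assume o: "x \<in> VOb S" "y \<in> VOb S" and f: "f \<in> Hom V P (VHom S x y)"
  note [simp] = hom_obj(1)[OF f] car[OF o(1)]
  note i = idn_in[OF car[OF o(1)]]
  note fi = ap_in[OF o f i]
  let ?i = "Idn V (car x)"
  have lr: "LUnit V P \<in> Hom V (TUnit V \<otimes> P) P" "RUnit V P \<in> Hom V (P \<otimes> TUnit V) P"
    "LUnit V (car x) \<in> Hom V (TUnit V \<otimes> car x) (car x)"
    by (simp_all add: Hom_iff)
  show "gc S x y y (VId S y) f = f \<cdot> LUnit V P"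
  proof (rule ap_ext[OF o gc_S_in[OF o o(2) S_id[OF o(2)] f] comp_in[OF lr(1) f]])
    show "ap x y (gc S x y y (VId S y) f) ?i = ap x y (f \<cdot> LUnit V P) ?i"
      using fi lunit_tens[of P "car x"]
      by (simp add: ap_gc[OF o o(2) S_id[OF o(2)] f i] ap_comp_left[OF o f i lr(1)]
        ap_id[OF o(2) fi] comp_assoc Hom_iff)
  qed
  show "gc S x x y f (VId S x) = f \<cdot> RUnit V P"
  proof (rule ap_ext[OF o gc_S_in[OF o(1) o f S_id[OF o(1)]] comp_in[OF lr(2) f]])
    show "ap x y (gc S x x y f (VId S x)) ?i = ap x y (f \<cdot> RUnit V P) ?i"
      using fi triangle[of P "car x"] ap_comp_right[OF o f i lr(3)]
      by (simp add: ap_gc[OF o(1) o f S_id[OF o(1)] i] ap_comp_left[OF o f i lr(2)]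
        ap_id[OF o(1) i] comp_assoc Hom_iff)
  qed
qed (use S_hom S_comp S_id in auto)

text \<open>\<open>L\<close> is the action on hom-objects of the functor \<open>A(c,-)\<close>, regarded as a functor into \<open>S\<close>.\<close>
definition is_rep :: "('o, 'a, 'c) vcat \<Rightarrow> 'c \<Rightarrow> ('c \<Rightarrow> 'd) \<Rightarrow> ('c \<Rightarrow> 'c \<Rightarrow> 'a) \<Rightarrow> bool" where
  "is_rep A c h L \<longleftrightarrow> c \<in> VOb A \<and> (\<forall>x\<in>VOb A. h x \<in> VOb S \<and> car (h x) = VHom A c x) \<and>
    (\<forall>x\<in>VOb A. \<forall>y\<in>VOb A. L x y \<in> Hom V (VHom A x y) (VHom S (h x) (h y)) \<and>
      ev (h x) (h y) \<cdot> (L x y \<boxtimes> Idn V (VHom A c x)) = VComp A c x y)"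

lemma is_repD:
  assumes "is_rep A c h L" "x \<in> VOb A"
  shows "c \<in> VOb A" "h x \<in> VOb S" "car (h x) = VHom A c x"
    "y \<in> VOb A \<Longrightarrow> L x y \<in> Hom V (VHom A x y) (VHom S (h x) (h y))"
    "y \<in> VOb A \<Longrightarrow> ev (h x) (h y) \<cdot> (L x y \<boxtimes> Idn V (VHom A c x)) = VComp A c x y"
  using assms unfolding is_rep_def by blast+

lemma rep_ap:
  assumes L: "is_rep A c h L" and A: "is_vcat V A" and x: "x \<in> VOb A" and y: "y \<in> VOb A"
    and a: "a \<in> Hom V P (VHom A x y)" and k: "k \<in> Hom V K (VHom A c x)"
  shows "ap (h x) (h y) (L x y \<cdot> a) k = gc A c x y a k"
proof -
  note r = is_repD[OF L x] note r' = r(4)[OF y]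
  have "ap (h x) (h y) (L x y \<cdot> a) k = (ev (h x) (h y) \<cdot> (L x y \<boxtimes> Idn V (VHom A c x))) \<cdot> (a \<boxtimes> k)"
    using ev_in[OF r(2) is_repD(2)[OF L y]] r r' a k vcat_hom[OF A r(1) x]
    by (simp add: ap_def comp_assoc Hom_iff)
  then show ?thesis by (simp add: r(5)[OF y] gc_def)
qed

lemma rep_id:
  assumes L: "is_rep A c h L" and A: "is_vcat V A" and x: "x \<in> VOb A"
  shows "L x x \<cdot> VId A x = VId S (h x)"
proof (rule ap_ext)
  note r = is_repD[OF L x]
  show "h x \<in> VOb S" "h x \<in> VOb S" by (fact r(2))+
  show "L x x \<cdot> VId A x \<in> Hom V (TUnit V) (VHom S (h x) (h x))"
    by (rule comp_in[OF vcat_id[OF A x x] r(4)[OF x]])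
  show "VId S (h x) \<in> Hom V (TUnit V) (VHom S (h x) (h x))" by (rule S_id[OF r(2)])
  have k: "Idn V (car (h x)) \<in> Hom V (car (h x)) (VHom A c x)"
    using r idn_in[OF vcat_hom[OF A r(1) x]] by simp
  show "ap (h x) (h x) (L x x \<cdot> VId A x) (Idn V (car (h x))) =
      ap (h x) (h x) (VId S (h x)) (Idn V (car (h x)))"
    using rep_ap[OF L A x x vcat_id[OF A x x] k] gc_id_left[OF A r(1) x k]
      ap_id[OF r(2) idn_in[OF car[OF r(2)]]] by simp
qed

text \<open>Evaluated at an element \<open>k\<close>, functoriality of \<open>A(c,-)\<close> reads
  \<open>(b a) k = b (a k)\<close>, which is associativity in \<open>A\<close>.\<close>

lemma rep_gc:
  assumes L: "is_rep A c h L" and A: "is_vcat V A" and x: "x \<in> VOb A" and y: "y \<in> VOb A"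
    and z: "z \<in> VOb A" and b: "b \<in> Hom V Q (VHom A y z)" and a: "a \<in> Hom V P (VHom A x y)"
  shows "L x z \<cdot> gc A x y z b a = gc S (h x) (h y) (h z) (L y z \<cdot> b) (L x y \<cdot> a)"
proof (rule ap_ext)
  note rx = is_repD[OF L x] and ry = is_repD[OF L y] and rz = is_repD[OF L z]
  note c = rx(1)
  note Lb = comp_in[OF b ry(4)[OF z]] and La = comp_in[OF a rx(4)[OF y]]
  show "h x \<in> VOb S" "h z \<in> VOb S" by (fact rx(2) rz(2))+
  show "L x z \<cdot> gc A x y z b a \<in> Hom V (Q \<otimes> P) (VHom S (h x) (h z))"
    by (rule comp_in[OF gc_in[OF A x y z b a] rx(4)[OF z]])
  show "gc S (h x) (h y) (h z) (L y z \<cdot> b) (L x y \<cdot> a) \<in> Hom V (Q \<otimes> P) (VHom S (h x) (h z))"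
    by (rule gc_S_in[OF rx(2) ry(2) rz(2) Lb La])
  have k: "Idn V (car (h x)) \<in> Hom V (VHom A c x) (VHom A c x)"
    and k': "Idn V (car (h x)) \<in> Hom V (VHom A c x) (car (h x))"
    using rx idn_in[OF vcat_hom[OF A c x]] by simp_all
  have ak: "gc A c x y a (Idn V (car (h x))) \<in> Hom V (P \<otimes> VHom A c x) (VHom A c y)"
    by (rule gc_in[OF A c x y a k])
  have "ap (h x) (h z) (L x z \<cdot> gc A x y z b a) (Idn V (car (h x))) =
      gc A c y z b (gc A c x y a (Idn V (car (h x)))) \<cdot> Assoc V Q P (VHom A c x)"
    by (simp add: rep_ap[OF L A x z gc_in[OF A x y z b a] k] gc_assoc[OF A c x y z b a k])
  also have "\<dots> = ap (h y) (h z) (L y z \<cdot> b) (ap (h x) (h y) (L x y \<cdot> a) (Idn V (car (h x)))) \<cdot>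
      Assoc V Q P (VHom A c x)"
    by (simp add: rep_ap[OF L A y z b ak] rep_ap[OF L A x y a k])
  also have "\<dots> = ap (h x) (h z) (gc S (h x) (h y) (h z) (L y z \<cdot> b) (L x y \<cdot> a)) (Idn V (car (h x)))"
    by (rule ap_gc[OF rx(2) ry(2) rz(2) Lb La k', symmetric])
  finally show "ap (h x) (h z) (L x z \<cdot> gc A x y z b a) (Idn V (car (h x))) = \<dots>" .
qed

end

context smcc begin

section \<open>The base enriched in itself and the functors represented by objects\<close>

lemma vself_simps [simp]: "VOb (vself V) = Obj V" "VHom (vself V) = IHom V"
  by (simp_all add: vself_def)

lemma vself_concrete: "concrete V (vself V) (\<lambda>x. x) (Eval V)"
proof -
  have c: "VComp (vself V) x y z \<in> Hom V (VHom (vself V) y z \<otimes> VHom (vself V) x y) (VHom (vself V) x z) \<and>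
      Eval V x z \<cdot> (VComp (vself V) x y z \<boxtimes> Idn V x) =
      Eval V y z \<cdot> (Idn V (IHom V y z) \<boxtimes> Eval V x y) \<cdot> Assoc V (IHom V y z) (IHom V x y) x"
    if [simp]: "x \<in> Obj V" "y \<in> Obj V" "z \<in> Obj V" for x y z
    unfolding vself_def using transpose_arr[of x z "IHom V y z \<otimes> IHom V x y"]
    by (simp add: Hom_iff)
  have i: "VId (vself V) x \<in> Hom V (TUnit V) (IHom V x x) \<and>
      Eval V x x \<cdot> (VId (vself V) x \<boxtimes> Idn V x) = LUnit V x"
    if [simp]: "x \<in> Obj V" for x
    unfolding vself_def using transpose_arr[of x x "TUnit V"] by (simp add: Hom_iff)
  show ?thesis
    using c i eval_universal by unfold_locales (auto simp: Hom_iff)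
qed

lemma vself_vcat: "is_vcat V (vself V)"
proof -
  interpret vs: concrete V "vself V" "\<lambda>x. x" "Eval V" by (rule vself_concrete)
  show ?thesis by (rule vs.S_vcat)
qed

lemma hom_from_simps [simp]:
  "x \<in> VOb A \<Longrightarrow> FOb (hom_from V A b) x = VHom A b x"
  by (simp add: hom_from_def)

lemma hom_from_rep:
  assumes A: "is_vcat V A" and b: "b \<in> VOb A"
  shows "concrete.is_rep V (vself V) (\<lambda>x. x) (Eval V) A b (VHom A b) (FHom (hom_from V A b))"
proof -
  interpret vs: concrete V "vself V" "\<lambda>x. x" "Eval V" by (rule vself_concrete)
  show ?thesis unfolding vs.is_rep_def
    using b vcat_hom[OF A] transpose_arr[OF _ _ _ vcat_comp[OF A]] by (simp add: hom_from_def)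
qed

lemma hom_from_functor:
  assumes A: "is_vcat V A" and b: "b \<in> VOb A"
  shows "is_vfunctor V A (vself V) (hom_from V A b)"
proof -
  interpret vs: concrete V "vself V" "\<lambda>x. x" "Eval V" by (rule vself_concrete)
  note L = hom_from_rep[OF A b]
  show ?thesis
  proof (rule vfunctorI[OF A vself_vcat])
    show "hom_from V A b = restrict_vfun A (FOb (hom_from V A b)) (FHom (hom_from V A b))"
      unfolding hom_from_def by (rule restrict_vfun_idem)
  next
    fix x assume x: "x \<in> VOb A"
    show "FOb (hom_from V A b) x \<in> VOb (vself V)" using x vcat_hom[OF A b] by simp
    show "FHom (hom_from V A b) x x \<cdot> VId A x = VId (vself V) (FOb (hom_from V A b) x)"
      using vs.rep_id[OF L A x] x by simp
  next
    fix x y assume o: "x \<in> VOb A" "y \<in> VOb A"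
    then show "FHom (hom_from V A b) x y \<in>
      Hom V (VHom A x y) (VHom (vself V) (FOb (hom_from V A b) x) (FOb (hom_from V A b) y))"
      using vs.is_repD(4)[OF L o] by simp
  next
    fix x y z P Q f g assume o: "x \<in> VOb A" "y \<in> VOb A" "z \<in> VOb A"
      and g: "g \<in> Hom V Q (VHom A y z)" and f: "f \<in> Hom V P (VHom A x y)"
    then show "FHom (hom_from V A b) x z \<cdot> gc A x y z g f =
      gc (vself V) (FOb (hom_from V A b) x) (FOb (hom_from V A b) y) (FOb (hom_from V A b) z)
        (FHom (hom_from V A b) y z \<cdot> g) (FHom (hom_from V A b) x y \<cdot> f)"
      using vs.rep_gc[OF L A o g f] by simp
  qed
qed

text \<open>Composition in \<open>vop V A\<close> contains exactly the symmetry that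
  \<open>hom_to\<close> inserts, so results on covariant representables also serve for contravariant
  ones.\<close>

lemma hom_to_eq: "hom_to V A b = hom_from V (vop V A) b"
  by (simp add: hom_to_def hom_from_def restrict_vfun_def vop_def)

end

text \<open>The hom-bifunctor of \<open>A\<close> through its two one-sided actions,
  post-composition \<open>L\<close> and pre-composition \<open>R\<close>. Only the carrier of
  \<open>h c x\<close> is tied to the hom-object, because in the intended instance
  \<open>h c x\<close> is an object of \<open>V\<close> while the hom-objects of \<open>A\<close>
  lie in \<open>W\<close>.\<close>

locale bimodule = concrete V S car ev
  for V :: "('o, 'a) smcc" (structure) and S :: "('o, 'a, 'd) vcat" and car ev +
  fixes A :: "('o, 'a, 'c) vcat" and h :: "'c \<Rightarrow> 'c \<Rightarrow> 'd"
    and L R :: "'c \<Rightarrow> 'c \<Rightarrow> 'c \<Rightarrow> 'a"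
  assumes A: "is_vcat V A"
    and L: "c \<in> VOb A \<Longrightarrow> is_rep A c (h c) (L c)"
    and R: "x \<in> VOb A \<Longrightarrow> is_rep (vop V A) x (\<lambda>c. h c x) (R x)"
begin

lemma h_ob: "c \<in> VOb A \<Longrightarrow> x \<in> VOb A \<Longrightarrow> h c x \<in> VOb S"
  and car_h: "c \<in> VOb A \<Longrightarrow> x \<in> VOb A \<Longrightarrow> car (h c x) = VHom A c x"
  using is_repD[OF L] by blast+

lemma L_in: "\<lbrakk>c \<in> VOb A; x \<in> VOb A; y \<in> VOb A\<rbrakk> \<Longrightarrow> L c x y \<in> Hom V (VHom A x y) (VHom S (h c x) (h c y))"
  using is_repD(4)[OF L] by blast

lemma R_in: "\<lbrakk>x \<in> VOb A; c \<in> VOb A; d \<in> VOb A\<rbrakk> \<Longrightarrow> R x c d \<in> Hom V (VHom A d c) (VHom S (h c x) (h d x))"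
  using is_repD(4)[OF R, of x c d] by simp

lemmas L_ap = rep_ap[OF L A]

lemma R_ap:
  assumes x: "x \<in> VOb A" and c: "c \<in> VOb A" and d: "d \<in> VOb A"
    and u: "u \<in> Hom V U (VHom A d c)" and k: "k \<in> Hom V K (VHom A c x)"
  shows "ap (h c x) (h d x) (R x c d \<cdot> u) k = gc A d c x k u \<cdot> Symm V U K"
  using rep_ap[OF R[OF x] vop_vcat[OF A], of c d u U k K] gc_vop[OF A x c d u k] assms by simp

text \<open>Evaluated at \<open>k\<close> this is \<open>(a k) u = a (k u)\<close>; the hexagon absorbs the symmetries.\<close>
lemma R_L_commute:
  assumes o: "c \<in> VOb A" "d \<in> VOb A" "x \<in> VOb A" "y \<in> VOb A"
    and u: "u \<in> Hom V U (VHom A d c)" and a: "a \<in> Hom V P (VHom A x y)"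
  shows "gc S (h c x) (h c y) (h d y) (R y c d \<cdot> u) (L c x y \<cdot> a) =
    gc S (h c x) (h d x) (h d y) (L d x y \<cdot> a) (R x c d \<cdot> u) \<cdot> Symm V U P"
proof (rule ap_ext)
  note hs = h_ob[OF o(1,3)] h_ob[OF o(1,4)] h_ob[OF o(2,3)] h_ob[OF o(2,4)]
  show "h c x \<in> VOb S" "h d y \<in> VOb S" by (fact hs)+
  note Ry = comp_in[OF u R_in[OF o(4,1,2)]] and Rx = comp_in[OF u R_in[OF o(3,1,2)]]
  note Lc = comp_in[OF a L_in[OF o(1,3,4)]] and Ld = comp_in[OF a L_in[OF o(2,3,4)]]
  note l = gc_S_in[OF hs(1,2,4) Ry Lc] and r = gc_S_in[OF hs(1,3,4) Ld Rx]
  note [simp] = hom_obj(1)[OF u] hom_obj(1)[OF a] vcat_hom[OF A o(1,3)]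
  let ?K = "VHom A c x"
  let ?k = "Idn V ?K"
  note k = idn_in[OF vcat_hom[OF A o(1,3)]]
  have s: "Symm V x y \<in> Hom V (x \<otimes> y) (y \<otimes> x)" if "x \<in> Obj V" "y \<in> Obj V" for x y
    using that by (simp add: Hom_iff)
  note k' = k[folded car_h[OF o(1,3)]]
  have k'': "?k \<in> Hom V ?K (car (h c x))" using k by (simp add: car_h[OF o(1,3)])
  note ku = gc_in[OF A o(2,1,3) k u] note aku = gc_in[OF A o(2,3,4) a ku]
  show "gc S (h c x) (h c y) (h d y) (R y c d \<cdot> u) (L c x y \<cdot> a) \<in> Hom V (U \<otimes> P) (VHom S (h c x) (h d y))"
    by (fact l)
  show "gc S (h c x) (h d x) (h d y) (L d x y \<cdot> a) (R x c d \<cdot> u) \<cdot> Symm V U P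
      \<in> Hom V (U \<otimes> P) (VHom S (h c x) (h d y))"
    by (rule comp_in[OF s r]) simp_all
  have "ap (h c x) (h d y) (gc S (h c x) (h c y) (h d y) (R y c d \<cdot> u) (L c x y \<cdot> a)) ?k =
      (gc A d c y (gc A c x y a ?k) u \<cdot> Symm V U (P \<otimes> ?K)) \<cdot> Assoc V U P ?K"
    using ap_gc[OF hs(1,2,4) Ry Lc k''] R_ap[OF o(4,1,2) u gc_in[OF A o(1,3,4) a k]]
      L_ap[OF o(1,3,4) a k] by simp
  also have "\<dots> = gc A d x y a (gc A d c x ?k u) \<cdot>
      Assoc V P ?K U \<cdot> Symm V U (P \<otimes> ?K) \<cdot> Assoc V U P ?K"
    using gc_assoc[OF A o(2,1,3,4) a k u] aku by (simp add: Hom_iff comp_assoc)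
  also have "\<dots> = gc A d x y a (gc A d c x ?k u) \<cdot>
      (Idn V P \<boxtimes> Symm V U ?K) \<cdot> Assoc V P U ?K \<cdot> (Symm V U P \<boxtimes> ?k)"
    using hexagon[of U P ?K] by simp
  also have "\<dots> = gc A d x y a (gc A d c x ?k u \<cdot> Symm V U ?K) \<cdot> Assoc V P U ?K \<cdot> (Symm V U P \<boxtimes> ?k)"
    using gc_comp_right[OF A o(2,3,4) a ku s] aku by (simp add: Hom_iff comp_assoc)
  also have "\<dots> = ap (h c x) (h d y) (gc S (h c x) (h d x) (h d y) (L d x y \<cdot> a) (R x c d \<cdot> u)) ?k \<cdot>
      (Symm V U P \<boxtimes> ?k)"
    using ap_gc[OF hs(1,3,4) Ld Rx k''] R_ap[OF o(3,1,2) u k] L_ap[OF o(2,3,4) a comp_in[OF s ku]]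
      gc_in[OF A o(2,3,4) a comp_in[OF s ku]] by (simp add: Hom_iff comp_assoc)
  also have "\<dots> = ap (h c x) (h d y) (gc S (h c x) (h d x) (h d y) (L d x y \<cdot> a) (R x c d \<cdot> u) \<cdot> Symm V U P) ?k"
    by (simp add: ap_comp_left[OF hs(1,4) r k'' s])
  finally show "ap (h c x) (h d y) (gc S (h c x) (h c y) (h d y) (R y c d \<cdot> u) (L c x y \<cdot> a)) (Idn V (car (h c x))) =
    ap (h c x) (h d y) (gc S (h c x) (h d x) (h d y) (L d x y \<cdot> a) (R x c d \<cdot> u) \<cdot> Symm V U P) (Idn V (car (h c x)))"
    by (simp add: car_h[OF o(1,3)])
qed

text \<open>\<open>R_L_commute\<close> with the symmetry moved to the other side, where it is its
  own inverse up to swapping arguments.\<close>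

lemma L_R_commute:
  assumes o: "c \<in> VOb A" "d \<in> VOb A" "x \<in> VOb A" "y \<in> VOb A"
    and u: "u \<in> Hom V U (VHom A d c)" and a: "a \<in> Hom V P (VHom A x y)"
  shows "gc S (h c x) (h d x) (h d y) (L d x y \<cdot> a) (R x c d \<cdot> u) =
    gc S (h c x) (h c y) (h d y) (R y c d \<cdot> u) (L c x y \<cdot> a) \<cdot> Symm V P U"
  using R_L_commute[OF assms] symm_symm[of P U] hom_obj(1)[OF u] hom_obj(1)[OF a]
    gc_S_in[OF h_ob[OF o(1,3)] h_ob[OF o(2,3)] h_ob[OF o(2,4)]
      comp_in[OF a L_in[OF o(2,3,4)]] comp_in[OF u R_in[OF o(3,1,2)]]]
  by (simp add: Hom_iff comp_assoc)

text \<open>The faithful half of Yoneda: post-composition with \<open>a\<close>, evaluated at the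
  identity of \<open>x\<close>, returns \<open>a\<close> up to the right unitor.\<close>

lemma L_inject:
  assumes x: "x \<in> VOb A" and y: "y \<in> VOb A"
    and a: "a \<in> Hom V P (VHom A x y)" and b: "b \<in> Hom V P (VHom A x y)"
    and eq: "L x x y \<cdot> a = L x x y \<cdot> b"
  shows "a = b"
proof -
  have "gc A x x y a (VId A x) = gc A x x y b (VId A x)"
    using L_ap[OF x x y a vcat_id[OF A x x]] L_ap[OF x x y b vcat_id[OF A x x]] eq by simp
  then have "a \<cdot> RUnit V P = b \<cdot> RUnit V P"
    by (simp add: gc_id_right[OF A x y a] gc_id_right[OF A x y b])
  then show ?thesis
    using a b hom_obj(1)[OF a] by (intro iso_epi[of "RUnit V P" a b]) (simp_all add: Hom_iff)
qed

text \<open>The element \<open>a\<close> is \<open>q x\<close> evaluated at the identity of \<open>x\<close>.\<close>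
lemma yoneda:
  assumes x: "x \<in> VOb A" and y: "y \<in> VOb A" and Z: "Z \<in> Obj V"
    and q: "\<And>c. c \<in> VOb A \<Longrightarrow> q c \<in> Hom V Z (VHom S (h c x) (h c y))"
    and nat: "\<And>c d U u. \<lbrakk>c \<in> VOb A; d \<in> VOb A; u \<in> Hom V U (VHom A d c)\<rbrakk> \<Longrightarrow>
      gc S (h c x) (h d x) (h d y) (q d) (R x c d \<cdot> u) =
      gc S (h c x) (h c y) (h d y) (R y c d \<cdot> u) (q c) \<cdot> Symm V Z U"
  obtains a where "a \<in> Hom V Z (VHom A x y)" "\<And>c. c \<in> VOb A \<Longrightarrow> L c x y \<cdot> a = q c"
proof
  let ?I = "TUnit V"
  note hxx = h_ob[OF x x] and hxy = h_ob[OF x y]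
  note [simp] = Z
  have id: "VId A x \<in> Hom V ?I (car (h x x))"
    using vcat_id[OF A x x] by (simp add: car_h[OF x x])
  \<comment> \<open>The identity of \<open>x\<close> is an element at stage \<open>I\<close>, so
    \<open>?b\<close> lives at stage \<open>Z \<otimes> I\<close>; the inverse unitor in
    \<open>?a\<close> returns it to stage \<open>Z\<close>.\<close>
  let ?b = "ap (h x x) (h x y) (q x) (VId A x)"
  let ?a = "?b \<cdot> inverse_arr V (RUnit V Z)"
  have b: "?b \<in> Hom V (Z \<otimes> ?I) (VHom A x y)"
    using ap_in[OF hxx hxy q[OF x] id] by (simp add: car_h[OF x y])
  note i = inverse_arrD[OF runit_arr(4)[OF Z]]
  show a: "?a \<in> Hom V Z (VHom A x y)"
    using b i(1-3) by (simp add: Hom_iff)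
  have ab: "?b = ?a \<cdot> RUnit V Z"
    using b i by (simp add: Hom_iff comp_assoc)
  have s: "Symm V x y \<in> Hom V (x \<otimes> y) (y \<otimes> x)" if "x \<in> Obj V" "y \<in> Obj V" for x y
    using that by (simp add: Hom_iff)
  have rho: "RUnit V x \<in> Hom V (x \<otimes> ?I) x" if "x \<in> Obj V" for x
    using that by (simp add: Hom_iff)
  fix c assume c: "c \<in> VOb A"
  note hcx = h_ob[OF c x] and hcy = h_ob[OF c y]
  let ?K = "VHom A c x"
  let ?k = "Idn V ?K"
  note K [simp] = vcat_hom[OF A c x]
  note k = idn_in[OF K]
  have k': "?k \<in> Hom V ?K (car (h c x))" using k by (simp add: car_h[OF c x])
  show "L c x y \<cdot> ?a = q c"
  proof (rule ap_ext[OF hcx hcy comp_in[OF a L_in[OF c x y]] q[OF c]])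
    note qk = ap_in[OF hcx hcy q[OF c] k', unfolded car_h[OF c y]]
    note ak = gc_in[OF A c x y a k]
    note Rk = comp_in[OF k R_in[OF x x c]] and Rk' = comp_in[OF k R_in[OF y x c]]
    \<comment> \<open>Naturality of \<open>q\<close> is used from \<open>x\<close> to
      \<open>c\<close> at the generic element \<open>?k\<close> of \<open>A(c,x)\<close>, and
      evaluated at the identity of \<open>x\<close>. Its left side collapses to \<open>q c\<close>
      at \<open>?k\<close>, because the identity of \<open>x\<close> after \<open>?k\<close> is
      \<open>?k\<close>.\<close>
    have "ap (h x x) (h c y) (gc S (h x x) (h c x) (h c y) (q c) (R x x c \<cdot> ?k)) (VId A x) =
        ap (h c x) (h c y) (q c) (gc A c x x (VId A x) ?k \<cdot> Symm V ?K ?I) \<cdot> Assoc V Z ?K ?I"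
      using ap_gc[OF hxx hcx hcy q[OF c] Rk id] R_ap[OF x x c k vcat_id[OF A x x]] by simp
    also have "gc A c x x (VId A x) ?k \<cdot> Symm V ?K ?I = ?k \<cdot> RUnit V ?K"
      using gc_id_left[OF A c x k] lunit_symm[of ?K] by simp
    also have "ap (h c x) (h c y) (q c) (?k \<cdot> RUnit V ?K) \<cdot> Assoc V Z ?K ?I =
        ap (h c x) (h c y) (q c) ?k \<cdot> RUnit V (Z \<otimes> ?K)"
      unfolding ap_comp_right[OF hcx hcy q[OF c] k' rho[OF K]]
      using qk runit_tens[OF Z K] by (simp add: Hom_iff comp_assoc)
    finally have 1: "ap (h x x) (h c y) (gc S (h x x) (h c x) (h c y) (q c) (R x x c \<cdot> ?k)) (VId A x) =
      ap (h c x) (h c y) (q c) ?k \<cdot> RUnit V (Z \<otimes> ?K)" .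
    note g = gc_S_in[OF hxx hxy hcy Rk' q[OF x]]
    \<comment> \<open>The right side becomes \<open>?a\<close> composed with \<open>?k\<close>: once
      the unit factor has been moved outwards, the two opposite symmetries meet and cancel. Both
      sides then end in the same invertible unitor.\<close>
    have "ap (h x x) (h c y) (gc S (h x x) (h x y) (h c y) (R y x c \<cdot> ?k) (q x) \<cdot> Symm V Z ?K) (VId A x) =
       ((gc A c x y ?b ?k \<cdot> Symm V ?K (Z \<otimes> ?I)) \<cdot> Assoc V ?K Z ?I) \<cdot> (Symm V Z ?K \<boxtimes> Idn V ?I)"
      using ap_comp_left[OF hxx hcy g id s[OF Z K]] ap_gc[OF hxx hxy hcy Rk' q[OF x] id]
        R_ap[OF y x c k b] by simp
    also have "gc A c x y ?b ?k = gc A c x y ?a ?k \<cdot> (RUnit V Z \<boxtimes> ?k)"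
      unfolding ab[symmetric] using gc_comp_left[OF A c x y a k rho[OF Z], folded ab] .
    also have "((gc A c x y ?a ?k \<cdot> (RUnit V Z \<boxtimes> ?k)) \<cdot> Symm V ?K (Z \<otimes> ?I)) \<cdot> Assoc V ?K Z ?I =
       gc A c x y ?a ?k \<cdot> ((RUnit V Z \<boxtimes> ?k) \<cdot> Symm V ?K (Z \<otimes> ?I)) \<cdot> Assoc V ?K Z ?I"
      using ak by (simp add: Hom_iff comp_assoc)
    also have "(RUnit V Z \<boxtimes> ?k) \<cdot> Symm V ?K (Z \<otimes> ?I) = Symm V ?K Z \<cdot> (?k \<boxtimes> RUnit V Z)"
      using symm_nat[OF k rho[OF Z]] by simp
    also have "(gc A c x y ?a ?k \<cdot> (Symm V ?K Z \<cdot> (?k \<boxtimes> RUnit V Z)) \<cdot> Assoc V ?K Z ?I) \<cdot>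
        (Symm V Z ?K \<boxtimes> Idn V ?I) =
      gc A c x y ?a ?k \<cdot> Symm V ?K Z \<cdot> RUnit V (?K \<otimes> Z) \<cdot> (Symm V Z ?K \<boxtimes> Idn V ?I)"
      using ak runit_tens[OF K Z] by (simp add: Hom_iff comp_assoc flip: runit_tens[OF K Z])
    also have "RUnit V (?K \<otimes> Z) \<cdot> (Symm V Z ?K \<boxtimes> Idn V ?I) = Symm V Z ?K \<cdot> RUnit V (Z \<otimes> ?K)"
      by (rule runit_nat[OF s[OF Z K]])
    also have "gc A c x y ?a ?k \<cdot> Symm V ?K Z \<cdot> Symm V Z ?K \<cdot> RUnit V (Z \<otimes> ?K) =
        gc A c x y ?a ?k \<cdot> (Symm V ?K Z \<cdot> Symm V Z ?K) \<cdot> RUnit V (Z \<otimes> ?K)"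
      by (simp add: comp_assoc)
    also have "\<dots> = gc A c x y ?a ?k \<cdot> RUnit V (Z \<otimes> ?K)"
      by (simp add: symm_symm)
    finally have 2: "ap (h x x) (h c y) (gc S (h x x) (h x y) (h c y) (R y x c \<cdot> ?k) (q x) \<cdot> Symm V Z ?K) (VId A x) =
      gc A c x y ?a ?k \<cdot> RUnit V (Z \<otimes> ?K)" .
    have "gc A c x y ?a ?k = ap (h c x) (h c y) (q c) ?k"
      by (rule iso_epi[of "RUnit V (Z \<otimes> ?K)"])
        (use 1 2 nat[OF x c k] ak qk in \<open>simp_all add: Hom_iff\<close>)
    then show "ap (h c x) (h c y) (L c x y \<cdot> ?a) (Idn V (car (h c x))) =
        ap (h c x) (h c y) (q c) (Idn V (car (h c x)))"
      by (simp add: car_h[OF c x] L_ap[OF c x y a k])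
  qed
qed

end

section \<open>Powers\<close>

context smcc begin

text \<open>Yoneda in the base: if composition with \<open>f\<close> is bijective on elements at
  every stage, the preimage of the identity is an inverse.\<close>

lemma iso_if_universal:
  assumes f: "f \<in> Hom V x y"
    and u: "\<And>Z g. g \<in> Hom V Z y \<Longrightarrow> \<exists>!h. h \<in> Hom V Z x \<and> f \<cdot> h = g"
  shows "is_iso V f"
proof -
  note y = hom_obj(2)[OF f] and x = hom_obj(1)[OF f]
  obtain g where g: "g \<in> Hom V y x" "f \<cdot> g = Idn V y"
    using u[OF idn_in[OF y]] by blast
  \<comment> \<open>\<open>g \<cdot> f\<close> and the identity of \<open>x\<close> have the same
    image \<open>f\<close>, so uniqueness identifies them.\<close>
  have "f \<cdot> (g \<cdot> f) = (f \<cdot> g) \<cdot> f"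
    using f g(1) by (simp add: Hom_iff comp_assoc)
  then have "f \<cdot> (g \<cdot> f) = f" "f \<cdot> Idn V x = f"
    using f g by (simp_all add: Hom_iff)
  then have "g \<cdot> f = Idn V x"
    using u[OF f] comp_in[OF f g(1)] idn_in[OF x] by blast
  then show ?thesis using f g by (blast intro: isoI)
qed

lemma name_of_in:
  assumes f: "f \<in> Hom V x y"
  shows "name_of V f \<in> Hom V (TUnit V) (IHom V x y)"
    "concrete.ap V (Eval V) x y (name_of V f) (Idn V x) = f \<cdot> LUnit V x"
proof -
  interpret vs: concrete V "vself V" "\<lambda>x. x" "Eval V" by (rule vself_concrete)
  have "f \<cdot> LUnit V x \<in> Hom V (TUnit V \<otimes> x) y"
    using f hom_obj(1)[OF f] by (simp add: Hom_iff)
  from transpose_arr[OF hom_obj[OF f] tunit this] f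
  show "name_of V f \<in> Hom V (TUnit V) (IHom V x y)"
    "vs.ap x y (name_of V f) (Idn V x) = f \<cdot> LUnit V x"
    unfolding name_of_def vs.ap_def Hom_iff by auto
qed

lemma name_of_ap:
  assumes f: "f \<in> Hom V x y" and k: "k \<in> Hom V K x"
  shows "concrete.ap V (Eval V) x y (name_of V f) k = f \<cdot> k \<cdot> LUnit V K"
proof -
  interpret vs: concrete V "vself V" "\<lambda>x. x" "Eval V" by (rule vself_concrete)
  have "vs.ap x y (name_of V f) k = (f \<cdot> LUnit V x) \<cdot> (Idn V (TUnit V) \<boxtimes> k)"
    using vs.ap_Idn[of x y "name_of V f" "TUnit V" k K] name_of_in[OF f] hom_obj[OF f] k by simp
  then show ?thesis
    using lunit_nat[OF k] f k hom_obj(1)[OF f] by (simp add: Hom_iff comp_assoc)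
qed

text \<open>For functors into the base, enriched naturality is ordinary naturality of generalised elements.\<close>
lemma vnat_iff:
  assumes F: "is_vfunctor V B (vself V) F" and G: "is_vfunctor V B (vself V) G"
    and psi': "\<forall>b\<in>VOb B. \<psi> b \<in> Hom V (FOb F b) (FOb G b)"
  shows "is_vnat V B (vself V) F G (\<lambda>b. name_of V (\<psi> b)) \<longleftrightarrow>
    (\<forall>b\<in>VOb B. \<forall>b'\<in>VOb B. \<forall>U K u k. u \<in> Hom V U (VHom B b b') \<longrightarrow> k \<in> Hom V K (FOb F b) \<longrightarrow>
      \<psi> b' \<cdot> concrete.ap V (Eval V) (FOb F b) (FOb F b') (FHom F b b' \<cdot> u) k =
      concrete.ap V (Eval V) (FOb G b) (FOb G b') (FHom G b b' \<cdot> u) (\<psi> b \<cdot> k))" (is "_ \<longleftrightarrow> ?N")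
proof -
  interpret vs: concrete V "vself V" "\<lambda>x. x" "Eval V" by (rule vself_concrete)
  let ?I = "TUnit V"
  note psi = psi'[rule_format]
  note n = name_of_in(1)[OF psi] and n_ap = name_of_ap[OF psi]
  have fo: "FOb F b \<in> VOb (vself V)" "FOb G b \<in> VOb (vself V)" if "b \<in> VOb B" for b
    using vfun_ob[OF F that] vfun_ob[OF G that] by auto
  \<comment> \<open>Evaluated at \<open>k\<close>, each leg of the naturality square is one side of
    the claimed equation followed by the same invertible arrow
    \<open>LUnit V U \<boxtimes> Idn V K\<close>. One direction cancels this arrow, the other takes
    \<open>k\<close> generic and applies \<open>ap_ext\<close>.\<close>
  have key: "vs.ap (FOb F b) (FOb G b') (gc (vself V) (FOb F b) (FOb F b') (FOb G b')
        (name_of V (\<psi> b')) (FHom F b b' \<cdot> u)) k =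
      (\<psi> b' \<cdot> vs.ap (FOb F b) (FOb F b') (FHom F b b' \<cdot> u) k) \<cdot> (LUnit V U \<boxtimes> Idn V K)"
     "vs.ap (FOb F b) (FOb G b') (gc (vself V) (FOb F b) (FOb G b) (FOb G b')
        (FHom G b b' \<cdot> u) (name_of V (\<psi> b)) \<cdot> Symm V ?I U) k =
      vs.ap (FOb G b) (FOb G b') (FHom G b b' \<cdot> u) (\<psi> b \<cdot> k) \<cdot> (LUnit V U \<boxtimes> Idn V K)"
    if b: "b \<in> VOb B" and b': "b' \<in> VOb B" and u: "u \<in> Hom V U (VHom B b b')"
      and k: "k \<in> Hom V K (FOb F b)" for b b' U K u k
  proof -
    note [simp] = hom_obj(1)[OF u] hom_obj(1)[OF k]
    note Fu = comp_in[OF u vfun_hom[OF F b b']] and Gu = comp_in[OF u vfun_hom[OF G b b']]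
    note Fuk = vs.ap_in[OF fo(1)[OF b] fo(1)[OF b'] Fu k]
    note nb = n[OF b, folded vself_simps(2)] and nb' = n[OF b', folded vself_simps(2)]
    have s: "Symm V ?I U \<in> Hom V (?I \<otimes> U) (U \<otimes> ?I)" by (simp add: Hom_iff)
    have l: "LUnit V K \<in> Hom V (?I \<otimes> K) K" by (simp add: Hom_iff)
    show "vs.ap (FOb F b) (FOb G b') (gc (vself V) (FOb F b) (FOb F b') (FOb G b')
        (name_of V (\<psi> b')) (FHom F b b' \<cdot> u)) k =
      (\<psi> b' \<cdot> vs.ap (FOb F b) (FOb F b') (FHom F b b' \<cdot> u) k) \<cdot> (LUnit V U \<boxtimes> Idn V K)"
      using vs.ap_gc[OF fo(1)[OF b] fo(1)[OF b'] fo(2)[OF b'] nb' Fu k]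
        n_ap[OF b' Fuk] Fuk psi[OF b'] lunit_tens[of U K]
      by (simp add: Hom_iff comp_assoc)
    note pk = comp_in[OF k psi[OF b]]
    have "vs.ap (FOb F b) (FOb G b') (gc (vself V) (FOb F b) (FOb G b) (FOb G b')
        (FHom G b b' \<cdot> u) (name_of V (\<psi> b)) \<cdot> Symm V ?I U) k =
      (vs.ap (FOb G b) (FOb G b') (FHom G b b' \<cdot> u) (vs.ap (FOb F b) (FOb G b) (name_of V (\<psi> b)) k) \<cdot>
        Assoc V U ?I K) \<cdot> (Symm V ?I U \<boxtimes> Idn V K)"
      using vs.ap_comp_left[OF fo(1)[OF b] fo(2)[OF b'] vs.gc_S_in[OF fo(1)[OF b] fo(2)[OF b] fo(2)[OF b'] Gu nb] k s]
        vs.ap_gc[OF fo(1)[OF b] fo(2)[OF b] fo(2)[OF b'] Gu nb k] by simp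
    also have "vs.ap (FOb F b) (FOb G b) (name_of V (\<psi> b)) k = (\<psi> b \<cdot> k) \<cdot> LUnit V K"
      using n_ap[OF b k] psi[OF b] k by (simp add: Hom_iff comp_assoc)
    also have "(vs.ap (FOb G b) (FOb G b') (FHom G b b' \<cdot> u) ((\<psi> b \<cdot> k) \<cdot> LUnit V K) \<cdot>
        Assoc V U ?I K) \<cdot> (Symm V ?I U \<boxtimes> Idn V K) =
      vs.ap (FOb G b) (FOb G b') (FHom G b b' \<cdot> u) (\<psi> b \<cdot> k) \<cdot>
        ((Idn V U \<boxtimes> LUnit V K) \<cdot> Assoc V U ?I K) \<cdot> (Symm V ?I U \<boxtimes> Idn V K)"
      unfolding vs.ap_comp_right[OF fo(2)[OF b] fo(2)[OF b'] Gu pk l]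
      using vs.ap_in[OF fo(2)[OF b] fo(2)[OF b'] Gu pk] by (simp add: Hom_iff comp_assoc)
    \<comment> \<open>The triangle produces the right unitor of \<open>U\<close>, and the symmetry
      turns it into the left one.\<close>
    also have "((Idn V U \<boxtimes> LUnit V K) \<cdot> Assoc V U ?I K) \<cdot> (Symm V ?I U \<boxtimes> Idn V K) =
        LUnit V U \<boxtimes> Idn V K"
      by (simp add: triangle runit_symm)
    finally show "vs.ap (FOb F b) (FOb G b') (gc (vself V) (FOb F b) (FOb G b) (FOb G b')
        (FHom G b b' \<cdot> u) (name_of V (\<psi> b)) \<cdot> Symm V ?I U) k =
      vs.ap (FOb G b) (FOb G b') (FHom G b b' \<cdot> u) (\<psi> b \<cdot> k) \<cdot> (LUnit V U \<boxtimes> Idn V K)" .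
  qed
  show ?thesis
  proof
    assume nat: "is_vnat V B (vself V) F G (\<lambda>b. name_of V (\<psi> b))"
    show ?N
    proof (intro ballI allI impI)
      fix b b' U K u k assume b: "b \<in> VOb B" and b': "b' \<in> VOb B"
        and u: "u \<in> Hom V U (VHom B b b')" and k: "k \<in> Hom V K (FOb F b)"
      note [simp] = hom_obj(1)[OF u] hom_obj(1)[OF k]
      note e = key[OF b b' u k, unfolded nat_gc[OF F G nat[unfolded is_vnat_def] b b' u]]
      show "\<psi> b' \<cdot> vs.ap (FOb F b) (FOb F b') (FHom F b b' \<cdot> u) k =
        vs.ap (FOb G b) (FOb G b') (FHom G b b' \<cdot> u) (\<psi> b \<cdot> k)"
        using vs.ap_in[OF fo(1)[OF b] fo(1)[OF b'] comp_in[OF u vfun_hom[OF F b b']] k] psi[OF b']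
         vs.ap_in[OF fo(2)[OF b] fo(2)[OF b'] comp_in[OF u vfun_hom[OF G b b']] comp_in[OF k psi[OF b]]]
        by - (rule iso_epi[OF _ _ _ _ _ trans[OF e(1)[symmetric] e(2)]], auto simp: Hom_iff tens_iso iso_idn)
    qed
  next
    assume nat: ?N
    show "is_vnat V B (vself V) F G (\<lambda>b. name_of V (\<psi> b))"
      unfolding is_vnat_def
    proof (rule nat_familyI[OF F G tunit])
      fix b assume "b \<in> VOb B"
      then show "name_of V (\<psi> b) \<in> Hom V ?I (VHom (vself V) (FOb F b) (FOb G b))"
        using n by simp
    next
      fix b b' U u assume b: "b \<in> VOb B" and b': "b' \<in> VOb B" and u: "u \<in> Hom V U (VHom B b b')"
      note Fu = comp_in[OF u vfun_hom[OF F b b']] and Gu = comp_in[OF u vfun_hom[OF G b b']]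
      note nb = n[OF b, folded vself_simps(2)] and nb' = n[OF b', folded vself_simps(2)]
      have s: "Symm V ?I U \<in> Hom V (?I \<otimes> U) (U \<otimes> ?I)"
        using hom_obj(1)[OF u] by (simp add: Hom_iff)
      note k = idn_in[OF fo(1)[OF b, unfolded vself_simps]]
      show "gc (vself V) (FOb F b) (FOb F b') (FOb G b') (name_of V (\<psi> b')) (FHom F b b' \<cdot> u) =
        gc (vself V) (FOb F b) (FOb G b) (FOb G b') (FHom G b b' \<cdot> u) (name_of V (\<psi> b)) \<cdot> Symm V ?I U"
        using key[OF b b' u k] nat b b' u k
        by - (rule vs.ap_ext[OF fo(1)[OF b] fo(2)[OF b'] vs.gc_S_in[OF fo(1)[OF b] fo(1)[OF b'] fo(2)[OF b'] nb' Fu]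
          comp_in[OF s vs.gc_S_in[OF fo(1)[OF b] fo(2)[OF b] fo(2)[OF b'] Gu nb]]], simp_all)
    qed
  qed
qed

text \<open>
  Powers in terms of the counit \<open>\<kappa>\<close>, with all objects \<open>Z\<close> of \<open>V\<close> as domains in place of the internal
  hom.
\<close>
definition power_universal :: "('o, 'a, 'c) vcat \<Rightarrow> 'o \<Rightarrow> 'c \<Rightarrow> 'c \<Rightarrow> 'a \<Rightarrow> bool" where
  "power_universal A X c P \<kappa> \<longleftrightarrow> P \<in> VOb A \<and> \<kappa> \<in> Hom V X (VHom A P c) \<and>
    (\<forall>b\<in>VOb A. \<forall>Z\<in>Obj V. \<forall>g\<in>Hom V (X \<otimes> Z) (VHom A b c).
      \<exists>!h. h \<in> Hom V Z (VHom A b P) \<and> gc A b P c \<kappa> h = g)"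

text \<open>The target functor takes values in internal homs out of \<open>X\<close>, and evaluating
  these at the identity of \<open>X\<close> loses nothing by \<open>ap_ext\<close>. The actions of
  the representables thereby turn into plain composition in the opposite category.\<close>

lemma power_vnat_iff:
  assumes A: "is_vcat V A" and X: "X \<in> Obj V" and c: "c \<in> VOb A" and P: "P \<in> VOb A"
    and psi0: "\<forall>b\<in>VOb A. \<psi> b \<in> Hom V (VHom A b P) (IHom V X (VHom A b c))"
  shows "is_vnat V (vop V A) (vself V) (hom_to V A P)
       (vfun_comp V (vop V A) (hom_from V (vself V) X) (hom_to V A c)) (\<lambda>b. name_of V (\<psi> b)) \<longleftrightarrow>
    (\<forall>b\<in>VOb A. \<forall>b'\<in>VOb A. \<forall>U K u k. u \<in> Hom V U (VHom A b' b) \<longrightarrow> k \<in> Hom V K (VHom A b P) \<longrightarrow>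
      concrete.ap V (Eval V) X (VHom A b' c) (\<psi> b' \<cdot> gc (vop V A) P b b' u k) (Idn V X) =
      gc (vop V A) c b b' u (concrete.ap V (Eval V) X (VHom A b c) (\<psi> b \<cdot> k) (Idn V X)) \<cdot> Assoc V U K X)"
proof -
  interpret vs: concrete V "vself V" "\<lambda>x. x" "Eval V" by (rule vself_concrete)
  note psi = psi0[rule_format]
  let ?B = "vop V A"
  let ?F = "hom_from V ?B P"
  let ?H = "hom_from V ?B c"
  let ?L = "hom_from V (vself V) X"
  let ?G = "vfun_comp V ?B ?L ?H"
  have B: "is_vcat V ?B" and oB [simp]: "VOb ?B = VOb A" by (simp_all add: vop_vcat[OF A])
  have cB: "c \<in> VOb ?B" and PB: "P \<in> VOb ?B" and XS: "X \<in> VOb (vself V)" using c P X by simp_all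
  note F = hom_from_functor[OF B PB] and H = hom_from_functor[OF B cB]
    and L = hom_from_functor[OF vself_vcat XS]
  note G = vfun_comp_functor[OF H L]
  have psi': "\<forall>b\<in>VOb ?B. \<psi> b \<in> Hom V (FOb ?F b) (FOb ?G b)"
    using psi vcat_hom[OF A _ c] by simp
  note rF = hom_from_rep[OF B PB] and rH = hom_from_rep[OF B cB]
    and rL = hom_from_rep[OF vself_vcat XS]
  have eq: "vs.ap X (VHom A b' c) (vs.ap (FOb ?G b) (FOb ?G b') (FHom ?G b b' \<cdot> u) (\<psi> b \<cdot> k)) (Idn V X) =
      gc ?B c b b' u (vs.ap X (VHom A b c) (\<psi> b \<cdot> k) (Idn V X)) \<cdot> Assoc V U K X"
    and eqF: "vs.ap (FOb ?F b) (FOb ?F b') (FHom ?F b b' \<cdot> u) k = gc ?B P b b' u k"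
    and t: "vs.ap (FOb ?G b) (FOb ?G b') (FHom ?G b b' \<cdot> u) (\<psi> b \<cdot> k) \<in> Hom V (U \<otimes> K) (IHom V X (VHom A b' c))"
    and t': "\<psi> b' \<cdot> gc ?B P b b' u k \<in> Hom V (U \<otimes> K) (IHom V X (VHom A b' c))"
    if b: "b \<in> VOb A" and b': "b' \<in> VOb A" and u: "u \<in> Hom V U (VHom A b' b)"
      and k: "k \<in> Hom V K (VHom A b P)" for b b' U K u k
  proof -
    have bB: "b \<in> VOb ?B" "b' \<in> VOb ?B" using b b' by simp_all
    have uB: "u \<in> Hom V U (VHom ?B b b')" using u by simp
    have hb: "VHom A b c \<in> VOb (vself V)" "VHom A b' c \<in> VOb (vself V)"
      using vcat_hom[OF A b c] vcat_hom[OF A b' c] by simp_all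
    have pk: "\<psi> b \<cdot> k \<in> Hom V K (IHom V X (VHom A b c))" by (rule comp_in[OF k psi[OF b]])
    note pk' = pk[folded vself_simps(2)]
    have Hu: "FHom ?H b b' \<cdot> u \<in> Hom V U (VHom (vself V) (VHom A b c) (VHom A b' c))"
      using comp_in[OF uB vfun_hom[OF H bB]] bB by simp
    show "vs.ap (FOb ?F b) (FOb ?F b') (FHom ?F b b' \<cdot> u) k = gc ?B P b b' u k"
      using vs.rep_ap[OF rF B bB uB, of k K] bB k by simp
    show "\<psi> b' \<cdot> gc ?B P b b' u k \<in> Hom V (U \<otimes> K) (IHom V X (VHom A b' c))"
      using gc_in[OF B PB bB uB, of k K] k by (intro comp_in[OF _ psi[OF b']]) simp
    have pkG: "\<psi> b \<cdot> k \<in> Hom V K (FOb ?G b)"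
      using pk bB hb by simp
    show t: "vs.ap (FOb ?G b) (FOb ?G b') (FHom ?G b b' \<cdot> u) (\<psi> b \<cdot> k) \<in> Hom V (U \<otimes> K) (IHom V X (VHom A b' c))"
      using vs.ap_in[OF vfun_ob[OF G bB(1)] vfun_ob[OF G bB(2)] comp_in[OF uB vfun_hom[OF G bB]] pkG]
        bB hb by simp
    have "FHom ?G b b' \<cdot> u = FHom ?L (VHom A b c) (VHom A b' c) \<cdot> (FHom ?H b b' \<cdot> u)"
      using vfun_hom[OF H bB] vfun_hom[OF L hb] uB bB by (simp add: Hom_iff comp_assoc)
    then have "vs.ap (FOb ?G b) (FOb ?G b') (FHom ?G b b' \<cdot> u) (\<psi> b \<cdot> k) =
        gc (vself V) X (VHom A b c) (VHom A b' c) (FHom ?H b b' \<cdot> u) (\<psi> b \<cdot> k)"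
      using vs.rep_ap[OF rL vself_vcat hb Hu, of "\<psi> b \<cdot> k" K] pk bB hb by simp
    then show "vs.ap X (VHom A b' c) (vs.ap (FOb ?G b) (FOb ?G b') (FHom ?G b b' \<cdot> u) (\<psi> b \<cdot> k)) (Idn V X) =
      gc ?B c b b' u (vs.ap X (VHom A b c) (\<psi> b \<cdot> k) (Idn V X)) \<cdot> Assoc V U K X"
      using vs.ap_gc[OF XS hb Hu pk' idn_in[OF X]] vs.rep_ap[OF rH B bB uB] bB
        vs.ap_in[OF XS hb(1) pk' idn_in[OF X]] by simp
  qed
  have iff: "(\<psi> b' \<cdot> vs.ap (FOb ?F b) (FOb ?F b') (FHom ?F b b' \<cdot> u) k =
      vs.ap (FOb ?G b) (FOb ?G b') (FHom ?G b b' \<cdot> u) (\<psi> b \<cdot> k)) \<longleftrightarrow>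
    (vs.ap X (VHom A b' c) (\<psi> b' \<cdot> gc ?B P b b' u k) (Idn V X) =
      gc ?B c b b' u (vs.ap X (VHom A b c) (\<psi> b \<cdot> k) (Idn V X)) \<cdot> Assoc V U K X)"
    if b: "b \<in> VOb A" and b': "b' \<in> VOb A" and u: "u \<in> Hom V U (VHom A b' b)"
      and k: "k \<in> Hom V K (VHom A b P)" for b b' U K u k
    unfolding eqF[OF that] eq[OF that, symmetric]
    using vs.ap_ext[of X "VHom A b' c", OF _ _ t'[OF that, folded vself_simps(2)] t[OF that, folded vself_simps(2)]]
      X vcat_hom[OF A b' c] by auto
  have conv: "(\<forall>b\<in>VOb ?B. \<forall>b'\<in>VOb ?B. \<forall>U K u k. u \<in> Hom V U (VHom ?B b b') \<longrightarrow>
      k \<in> Hom V K (FOb ?F b) \<longrightarrow> Q b b' U K u k) \<longleftrightarrow>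
    (\<forall>b\<in>VOb A. \<forall>b'\<in>VOb A. \<forall>U K u k. u \<in> Hom V U (VHom A b' b) \<longrightarrow>
      k \<in> Hom V K (VHom A b P) \<longrightarrow> Q b b' U K u k)" for Q
    by simp
  show ?thesis
    unfolding hom_to_eq
    by (subst vnat_iff[OF F G psi'], subst conv, intro ball_cong all_cong1 imp_cong refl)
      (rule iff)
qed

text \<open>Yoneda for powers: naturality forces \<open>\<psi> b\<close> to send \<open>h\<close> to
  the transpose of the composite of \<open>\<kappa>\<close> and \<open>h\<close>, and conversely
  this formula defines a natural isomorphism when \<open>\<kappa>\<close> is universal. A symmetry
  intervenes because evaluation has stage \<open>Z \<otimes> X\<close> and the composite has stage
  \<open>X \<otimes> Z\<close>.\<close>

lemma power_iff:
  assumes A: "is_vcat V A" and X: "X \<in> Obj V" and c: "c \<in> VOb A"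
  shows "is_power_with_counit V A X c P \<kappa> \<longleftrightarrow> power_universal A X c P \<kappa>"
proof
  interpret vs: concrete V "vself V" "\<lambda>x. x" "Eval V" by (rule vself_concrete)
  let ?B = "vop V A" and ?i = "Idn V X" and ?I = "TUnit V"
  note B = vop_vcat[OF A]
  note [simp] = X
  have hc: "VHom A b c \<in> VOb (vself V)" if "b \<in> VOb A" for b using vcat_hom[OF A that c] by simp
  have XS: "X \<in> VOb (vself V)" by simp
  note iX = idn_in[OF X]
  have lX: "LUnit V X \<in> Hom V (?I \<otimes> X) X" by (simp add: Hom_iff)
  note il = inverse_arrD[OF lunit_arr(4)[OF X]]
  {
    assume "is_power_with_counit V A X c P \<kappa>"
    then obtain \<psi> where pow: "is_power V A X c P \<psi>" and \<kappa>: "\<kappa> = power_counit V A X c P \<psi>"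
      unfolding is_power_with_counit_def by blast
    have P: "P \<in> VOb A" and psi0: "\<forall>b\<in>VOb A. \<psi> b \<in> Hom V (VHom A b P) (IHom V X (VHom A b c))"
      and iso: "\<And>b. b \<in> VOb A \<Longrightarrow> is_iso V (\<psi> b)"
      and nat: "is_vnat V (vop V A) (vself V) (hom_to V A P)
       (vfun_comp V (vop V A) (hom_from V (vself V) X) (hom_to V A c)) (\<lambda>b. name_of V (\<psi> b))"
      using pow unfolding is_power_def by blast+
    note psi = psi0[rule_format]
    note N = iffD1[OF power_vnat_iff[OF A X c P psi0] nat, rule_format]
    note id = vcat_id[OF A P P]
    have k1: "vs.ap X (VHom A P c) (\<psi> P \<cdot> VId A P) ?i \<in> Hom V (?I \<otimes> X) (VHom A P c)"
      by (rule vs.ap_in[OF XS hc[OF P] _ iX]) (use comp_in[OF id psi[OF P]] in simp)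
    have \<kappa>eq: "\<kappa> = vs.ap X (VHom A P c) (\<psi> P \<cdot> VId A P) ?i \<cdot> inverse_arr V (LUnit V X)"
      unfolding \<kappa> power_counit_def vs.ap_def
      using id psi[OF P] il X vcat_hom[OF A P c] by (simp add: comp_assoc Hom_iff)
    have \<kappa>in: "\<kappa> \<in> Hom V X (VHom A P c)"
      unfolding \<kappa>eq using k1 il by (simp add: Hom_iff)
    have \<kappa>l: "vs.ap X (VHom A P c) (\<psi> P \<cdot> VId A P) ?i = \<kappa> \<cdot> LUnit V X"
      unfolding \<kappa>eq using k1 il by (simp add: comp_assoc Hom_iff)
    \<comment> \<open>Naturality from \<open>P\<close> to \<open>b\<close> along \<open>h\<close>,
      applied to the identity of \<open>P\<close>, whose image under \<open>\<psi> P\<close> is the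
      counit.\<close>
    have hat: "vs.ap X (VHom A b c) (\<psi> b \<cdot> h) ?i = gc A b P c \<kappa> h \<cdot> Symm V Z X"
      if b: "b \<in> VOb A" and h: "h \<in> Hom V Z (VHom A b P)" for b h Z
    proof -
      note Z [simp] = hom_obj(1)[OF h]
      have rZ: "RUnit V Z \<in> Hom V (Z \<otimes> ?I) Z" by (simp add: Hom_iff)
      have ph: "\<psi> b \<cdot> h \<in> Hom V Z (VHom (vself V) X (VHom A b c))"
        using comp_in[OF h psi[OF b]] by simp
      have "gc ?B P P b h (VId A P) = h \<cdot> RUnit V Z"
        using gc_id_right[OF B, of P b h Z] P b h by simp
      then have "vs.ap X (VHom A b c) (\<psi> b \<cdot> h \<cdot> RUnit V Z) ?i =
          gc ?B c P b h (\<kappa> \<cdot> LUnit V X) \<cdot> Assoc V Z ?I X"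
        using N[OF P b h id] by (simp add: \<kappa>l)
      moreover have "vs.ap X (VHom A b c) (\<psi> b \<cdot> h \<cdot> RUnit V Z) ?i =
          vs.ap X (VHom A b c) (\<psi> b \<cdot> h) ?i \<cdot> (RUnit V Z \<boxtimes> ?i)"
        using vs.ap_comp_left[OF XS hc[OF b] ph iX rZ] h psi[OF b] by (simp add: Hom_iff comp_assoc)
      moreover have "gc ?B c P b h (\<kappa> \<cdot> LUnit V X) \<cdot> Assoc V Z ?I X =
          gc ?B c P b h \<kappa> \<cdot> (RUnit V Z \<boxtimes> ?i)"
        using gc_comp_right[OF B, of c P b h Z \<kappa> X "LUnit V X" "?I \<otimes> X"]
          gc_in[OF B, of c P b h Z \<kappa> X] c P b h \<kappa>in lX
        by (simp add: Hom_iff comp_assoc triangle)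
      ultimately have "vs.ap X (VHom A b c) (\<psi> b \<cdot> h) ?i = gc ?B c P b h \<kappa>"
        using gc_in[OF B, of c P b h Z \<kappa> X] c P b h \<kappa>in vs.ap_in[OF XS hc[OF b] ph iX]
        by - (rule iso_epi[of "RUnit V Z \<boxtimes> ?i"], simp_all add: tens_iso iso_idn Hom_iff)
      then show ?thesis by (simp add: gc_vop[OF A c P b h \<kappa>in])
    qed
    have "\<exists>!h. h \<in> Hom V Z (VHom A b P) \<and> gc A b P c \<kappa> h = g"
      if b: "b \<in> VOb A" and Z: "Z \<in> Obj V" and g: "g \<in> Hom V (X \<otimes> Z) (VHom A b c)" for b Z g
    proof -
      note [simp] = Z
      have "g \<cdot> Symm V Z X \<in> Hom V (Z \<otimes> X) (VHom A b c)"
        using g by (simp add: Hom_iff)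
      from vs.ap_obtain[OF XS hc[OF b] Z this]
      obtain s where s: "s \<in> Hom V Z (VHom (vself V) X (VHom A b c))"
        and sg: "vs.ap X (VHom A b c) s ?i = g \<cdot> Symm V Z X" by blast
      note ip = inverse_arrD[OF iso[OF b]]
      \<comment> \<open>\<open>s\<close> is the transpose of \<open>g\<close>, and its preimage
        under the invertible \<open>\<psi> b\<close> is the required factorisation.\<close>
      define h where "h = inverse_arr V (\<psi> b) \<cdot> s"
      have h: "h \<in> Hom V Z (VHom A b P)" and ph: "\<psi> b \<cdot> h = s"
        using s ip psi[OF b] by (simp_all add: h_def Hom_iff flip: comp_assoc)
      have "gc A b P c \<kappa> h = g"
        using hat[OF b h] sg gc_in[OF A b P c \<kappa>in h] g unfolding ph
        by - (rule iso_epi[of "Symm V Z X"], simp_all add: Hom_iff)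
      moreover have "h' = h" if h': "h' \<in> Hom V Z (VHom A b P)" and "gc A b P c \<kappa> h' = g" for h'
      proof -
        have "\<psi> b \<cdot> h' = s"
          using hat[OF b h'] that sg s comp_in[OF h' psi[OF b]]
          by - (rule vs.ap_ext[OF XS hc[OF b], of _ Z], simp_all)
        then show ?thesis
          using iso_mono[OF iso[OF b], of h' h] ph h h' psi[OF b] by (simp add: Hom_iff)
      qed
      ultimately show ?thesis using h by blast
    qed
    then show "power_universal A X c P \<kappa>"
      unfolding power_universal_def using P \<kappa>in by blast
  next
    assume pu: "power_universal A X c P \<kappa>"
    then have P: "P \<in> VOb A" and \<kappa>in: "\<kappa> \<in> Hom V X (VHom A P c)"
      and u: "\<And>b Z g. \<lbrakk>b \<in> VOb A; Z \<in> Obj V; g \<in> Hom V (X \<otimes> Z) (VHom A b c)\<rbrakk> \<Longrightarrow>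
        \<exists>!h. h \<in> Hom V Z (VHom A b P) \<and> gc A b P c \<kappa> h = g"
      unfolding power_universal_def by blast+
    have cB: "c \<in> VOb ?B" and PB: "P \<in> VOb ?B" using c P by simp_all
    have \<kappa>B: "\<kappa> \<in> Hom V X (VHom ?B c P)" using \<kappa>in by simp
    \<comment> \<open>Composition with \<open>\<kappa>\<close>, taken at the generic element of
      \<open>A(b,P)\<close> and transposed.\<close>
    define \<psi> where "\<psi> b = transpose_arr V (VHom A b P) X (VHom A b c)
      (gc ?B c P b (Idn V (VHom A b P)) \<kappa>)" for b
    have psi: "\<psi> b \<in> Hom V (VHom A b P) (IHom V X (VHom A b c))"
      and psi1: "vs.ap X (VHom A b c) (\<psi> b) ?i = gc ?B c P b (Idn V (VHom A b P)) \<kappa>"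
      if b: "b \<in> VOb A" for b
    proof -
      note k = idn_in[OF vcat_hom[OF A b P]]
      have "gc ?B c P b (Idn V (VHom A b P)) \<kappa> \<in> Hom V (VHom A b P \<otimes> X) (VHom A b c)"
        using gc_in[OF B cB PB, of b "Idn V (VHom A b P)" "VHom A b P" \<kappa> X] b k \<kappa>B by simp
      from transpose_arr[OF X _ _ this] show "\<psi> b \<in> Hom V (VHom A b P) (IHom V X (VHom A b c))"
        "vs.ap X (VHom A b c) (\<psi> b) ?i = gc ?B c P b (Idn V (VHom A b P)) \<kappa>"
        using vcat_hom[OF A b c] vcat_hom[OF A b P] unfolding \<psi>_def vs.ap_def by blast+
    qed
    have hat: "vs.ap X (VHom A b c) (\<psi> b \<cdot> h) ?i = gc ?B c P b h \<kappa>"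
      if b: "b \<in> VOb A" and h: "h \<in> Hom V Z (VHom A b P)" for b h Z
    proof -
      have k: "Idn V (VHom A b P) \<in> Hom V (VHom A b P) (VHom ?B P b)"
        using idn_in[OF vcat_hom[OF A b P]] by simp
      have bB: "b \<in> VOb ?B" using b by simp
      show ?thesis
        using vs.ap_comp_left[OF XS hc[OF b] psi[OF b, folded vself_simps(2)] iX h] psi1[OF b]
          gc_comp_left[OF B cB PB bB k \<kappa>B h] h by (simp add: Hom_iff)
    qed
    \<comment> \<open>Naturality in \<open>b\<close> amounts to
      \<open>(\<kappa> k) u = \<kappa> (k u)\<close>, associativity read in the opposite
      category.\<close>
    have nat: "is_vnat V (vop V A) (vself V) (hom_to V A P)
       (vfun_comp V (vop V A) (hom_from V (vself V) X) (hom_to V A c)) (\<lambda>b. name_of V (\<psi> b))"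
    proof (subst power_vnat_iff[OF A X c P], use psi in blast, intro ballI allI impI)
      fix b b' U K uu k assume b: "b \<in> VOb A" and b': "b' \<in> VOb A"
        and uu: "uu \<in> Hom V U (VHom A b' b)" and k: "k \<in> Hom V K (VHom A b P)"
      have bB: "b \<in> VOb ?B" "b' \<in> VOb ?B" using b b' by simp_all
      have uuB: "uu \<in> Hom V U (VHom ?B b b')" and kB: "k \<in> Hom V K (VHom ?B P b)"
        using uu k by simp_all
      have "gc ?B P b b' uu k \<in> Hom V (U \<otimes> K) (VHom A b' P)"
        using gc_in[OF B PB bB uuB kB] by simp
      from hat[OF b' this] show "vs.ap X (VHom A b' c) (\<psi> b' \<cdot> gc ?B P b b' uu k) ?i =
        gc ?B c b b' uu (vs.ap X (VHom A b c) (\<psi> b \<cdot> k) ?i) \<cdot> Assoc V U K X"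
        by (simp add: hat[OF b k] gc_assoc[OF B cB PB bB uuB kB \<kappa>B])
    qed
    have iso: "is_iso V (\<psi> b)" if b: "b \<in> VOb A" for b
    proof (rule iso_if_universal[OF psi[OF b]])
      fix Z s assume s: "s \<in> Hom V Z (IHom V X (VHom A b c))"
      note s' = s[folded vself_simps(2)]
      note Z [simp] = hom_obj(1)[OF s]
      have sym: "is_iso V (Symm V Z X)" by simp
      let ?g = "vs.ap X (VHom A b c) s ?i \<cdot> Symm V X Z"
      have "vs.ap X (VHom A b c) s ?i \<in> Hom V (Z \<otimes> X) (VHom A b c)"
        by (rule vs.ap_in[OF XS hc[OF b] s' iX])
      then have g: "?g \<in> Hom V (X \<otimes> Z) (VHom A b c)"
        and gs: "?g \<cdot> Symm V Z X = vs.ap X (VHom A b c) s ?i"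
        by (simp_all add: Hom_iff comp_assoc symm_symm)
      \<comment> \<open>Transposition turns the equation for a preimage of \<open>s\<close> into the
        factorisation problem that \<open>\<kappa>\<close> solves uniquely.\<close>
      have iff: "\<psi> b \<cdot> h = s \<longleftrightarrow> gc A b P c \<kappa> h = ?g" if h: "h \<in> Hom V Z (VHom A b P)" for h
      proof
        have hat': "vs.ap X (VHom A b c) (\<psi> b \<cdot> h) ?i = gc A b P c \<kappa> h \<cdot> Symm V Z X"
          using hat[OF b h] gc_vop[OF A c P b h \<kappa>in] by simp
        show "gc A b P c \<kappa> h = ?g" if "\<psi> b \<cdot> h = s"
          using hat' gs that gc_in[OF A b P c \<kappa>in h] g
          by - (rule iso_epi[OF sym], simp_all add: Hom_iff)
        show "\<psi> b \<cdot> h = s" if e: "gc A b P c \<kappa> h = ?g"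
        proof (rule vs.ap_ext[OF XS hc[OF b] _ s'])
          show "\<psi> b \<cdot> h \<in> Hom V Z (VHom (vself V) X (VHom A b c))" using comp_in[OF h psi[OF b]] by simp
          show "vs.ap X (VHom A b c) (\<psi> b \<cdot> h) ?i = vs.ap X (VHom A b c) s ?i"
            unfolding hat' e gs ..
        qed
      qed
      show "\<exists>!h. h \<in> Hom V Z (VHom A b P) \<and> \<psi> b \<cdot> h = s"
        using u[OF b Z g] iff by metis
    qed
    have "power_counit V A X c P \<psi> = \<kappa>"
    proof -
      note id = vcat_id[OF A P P]
      have "power_counit V A X c P \<psi> = vs.ap X (VHom A P c) (\<psi> P \<cdot> VId A P) ?i \<cdot> inverse_arr V (LUnit V X)"
        unfolding power_counit_def vs.ap_def
        using id psi[OF P] il X vcat_hom[OF A P c] by (simp add: comp_assoc Hom_iff)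
      also have "\<dots> = (\<kappa> \<cdot> LUnit V X) \<cdot> inverse_arr V (LUnit V X)"
        using gc_id_left[OF B cB PB \<kappa>B] hat[OF P id] by simp
      also have "\<dots> = \<kappa>" using \<kappa>in il by (simp add: Hom_iff comp_assoc)
      finally show ?thesis .
    qed
    then show "is_power_with_counit V A X c P \<kappa>"
      unfolding is_power_with_counit_def is_power_def using P psi iso nat by blast
  }
qed

text \<open>An element of \<open>[Y, A(b,P)]\<close> at stage \<open>Z\<close> is an element of
  \<open>A(b,P)\<close> at stage \<open>Z \<otimes> Y\<close>. The claim is thus universality of
  \<open>\<kappa>\<close> at that stage, after reassociating \<open>X\<close>, \<open>Z\<close> and
  \<open>Y\<close>; this is why \<open>power_universal\<close> ranges over all stages.\<close>

lemma hom_from_preserves_power: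
  assumes A: "is_vcat V A" and X: "X \<in> Obj V" and b: "b \<in> VOb A" and c: "c \<in> VOb A"
    and pu: "power_universal A X c P \<kappa>"
  shows "power_universal (vself V) X (VHom A b c) (VHom A b P) (FHom (hom_from V A b) P c \<cdot> \<kappa>)"
proof -
  interpret vs: concrete V "vself V" "\<lambda>x. x" "Eval V" by (rule vself_concrete)
  have P: "P \<in> VOb A" and \<kappa>: "\<kappa> \<in> Hom V X (VHom A P c)"
    and u: "\<And>b Z g. \<lbrakk>b \<in> VOb A; Z \<in> Obj V; g \<in> Hom V (X \<otimes> Z) (VHom A b c)\<rbrakk> \<Longrightarrow>
      \<exists>!h. h \<in> Hom V Z (VHom A b P) \<and> gc A b P c \<kappa> h = g"
    using pu unfolding power_universal_def by blast+
  note rep = hom_from_rep[OF A b]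
  have hc: "VHom A b c \<in> VOb (vself V)" and hP: "VHom A b P \<in> VOb (vself V)"
    using vcat_hom[OF A b c] vcat_hom[OF A b P] by simp_all
  let ?\<kappa> = "FHom (hom_from V A b) P c \<cdot> \<kappa>"
  have L\<kappa>: "?\<kappa> \<in> Hom V X (VHom (vself V) (VHom A b P) (VHom A b c))"
    by (rule comp_in[OF \<kappa> vs.is_repD(4)[OF rep P c]])
  have "\<exists>!h. h \<in> Hom V Z (VHom (vself V) Y (VHom A b P)) \<and>
      gc (vself V) Y (VHom A b P) (VHom A b c) ?\<kappa> h = g"
    if Y: "Y \<in> VOb (vself V)" and Z: "Z \<in> Obj V" and g: "g \<in> Hom V (X \<otimes> Z) (VHom (vself V) Y (VHom A b c))"
    for Y Z g
  proof -
    note [simp] = X Z Y[unfolded vself_simps]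
    note iY = idn_in[OF Y[unfolded vself_simps]]
    let ?a = "Assoc V X Z Y" and ?i = "Idn V Y"
    have ia: "is_iso V ?a" by simp
    have ap: "vs.ap Y (VHom A b c) (gc (vself V) Y (VHom A b P) (VHom A b c) ?\<kappa> h) ?i =
        gc A b P c \<kappa> (vs.ap Y (VHom A b P) h ?i) \<cdot> ?a"
      if h: "h \<in> Hom V Z (VHom (vself V) Y (VHom A b P))" for h
      using vs.ap_gc[OF Y hP hc L\<kappa> h iY] vs.rep_ap[OF rep A P c \<kappa> vs.ap_in[OF Y hP h iY]] by simp
    have apt: "vs.ap Y (VHom A b P) h ?i \<in> Hom V (Z \<otimes> Y) (VHom A b P)"
      if h: "h \<in> Hom V Z (VHom (vself V) Y (VHom A b P))" for h
      by (rule vs.ap_in[OF Y hP h iY])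
    note ai = inverse_arrD[OF ia]
    note gt = vs.ap_in[OF Y hc g iY]
    let ?g = "vs.ap Y (VHom A b c) g ?i \<cdot> inverse_arr V ?a"
    have g': "?g \<in> Hom V (X \<otimes> (Z \<otimes> Y)) (VHom A b c)" and ga: "?g \<cdot> ?a = vs.ap Y (VHom A b c) g ?i"
      using gt ai by (simp_all add: Hom_iff comp_assoc)
    have ex: "\<exists>!k. k \<in> Hom V (Z \<otimes> Y) (VHom A b P) \<and> gc A b P c \<kappa> k = ?g"
      by (rule u[OF b _ g']) simp
    have iff: "gc (vself V) Y (VHom A b P) (VHom A b c) ?\<kappa> h = g \<longleftrightarrow>
        gc A b P c \<kappa> (vs.ap Y (VHom A b P) h ?i) = ?g"
      if h: "h \<in> Hom V Z (VHom (vself V) Y (VHom A b P))" for h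
    proof
      show "gc A b P c \<kappa> (vs.ap Y (VHom A b P) h ?i) = ?g"
        if "gc (vself V) Y (VHom A b P) (VHom A b c) ?\<kappa> h = g"
        using ap[OF h] that ga gc_in[OF A b P c \<kappa> apt[OF h]] g'
        by - (rule iso_epi[OF ia], simp_all add: Hom_iff)
      show "gc (vself V) Y (VHom A b P) (VHom A b c) ?\<kappa> h = g"
        if "gc A b P c \<kappa> (vs.ap Y (VHom A b P) h ?i) = ?g"
        by (rule vs.ap_ext[OF Y hc vs.gc_S_in[OF Y hP hc L\<kappa> h] g]) (simp only: ap[OF h] that ga)
    qed
    obtain k where k: "k \<in> Hom V (Z \<otimes> Y) (VHom A b P)" "gc A b P c \<kappa> k = ?g"
      using ex by blast
    obtain h where h: "h \<in> Hom V Z (VHom (vself V) Y (VHom A b P))" "vs.ap Y (VHom A b P) h ?i = k"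
      using vs.ap_obtain[OF Y hP Z k(1)] by blast
    moreover have "h' = h" if h': "h' \<in> Hom V Z (VHom (vself V) Y (VHom A b P))"
      and "gc (vself V) Y (VHom A b P) (VHom A b c) ?\<kappa> h' = g" for h'
    proof -
      have "vs.ap Y (VHom A b P) h' ?i = vs.ap Y (VHom A b P) h ?i"
        using ex k h iff[OF h'] apt[OF h'] that by blast
      then show ?thesis by (rule vs.ap_ext[OF Y hP h' h(1)])
    qed
    ultimately show ?thesis using iff[OF h(1)] k by blast
  qed
  then show ?thesis
    unfolding power_universal_def using hP L\<kappa> by blast
qed

lemma bracket_ob_algebra:
  assumes C: "is_vcat V C" and c: "c \<in> VOb C" and J: "J \<subseteq> Obj V"
    and E: "E \<in> algebras V J T C"
  shows "bracket_ob V T C c E \<in> algebras V J T (vself V)"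
proof -
  have F: "is_vfunctor V T C E" and pres: "preserves_powers V J T C E"
    using E unfolding algebras_def by blast+
  note T = vfun_vcat(1)[OF F] and H = hom_from_functor[OF C c]
  have "preserves_powers V J T (vself V) (vfun_comp V T (hom_from V C c) E)"
    unfolding preserves_powers_def
  proof (intro ballI allI impI)
    fix X t P \<kappa> assume XJ: "X \<in> J" and t: "t \<in> VOb T" and pow: "is_power_with_counit V T X t P \<kappa>"
    have X: "X \<in> Obj V" using XJ J by blast
    have pu: "power_universal T X t P \<kappa>" using pow power_iff[OF T X t] by blast
    then have P: "P \<in> VOb T" and \<kappa>: "\<kappa> \<in> Hom V X (VHom T P t)"
      unfolding power_universal_def by blast+
    note Et = vfun_ob[OF F t] and EP = vfun_ob[OF F P]
    have "is_power_with_counit V C X (FOb E t) (FOb E P) (FHom E P t \<cdot> \<kappa>)"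
      using pres XJ t pow unfolding preserves_powers_def by blast
    then have "power_universal C X (FOb E t) (FOb E P) (FHom E P t \<cdot> \<kappa>)"
      using power_iff[OF C X Et] by blast
    from hom_from_preserves_power[OF C X c Et this]
    have "power_universal (vself V) X (VHom C c (FOb E t)) (VHom C c (FOb E P))
      (FHom (hom_from V C c) (FOb E P) (FOb E t) \<cdot> FHom E P t \<cdot> \<kappa>)" .
    moreover have "FHom (vfun_comp V T (hom_from V C c) E) P t \<cdot> \<kappa> =
        FHom (hom_from V C c) (FOb E P) (FOb E t) \<cdot> FHom E P t \<cdot> \<kappa>"
      using P t \<kappa> vfun_hom[OF F P t] vfun_hom[OF H EP Et] by (simp add: Hom_iff comp_assoc)
    ultimately show "is_power_with_counit V (vself V) X (FOb (vfun_comp V T (hom_from V C c) E) t)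
      (FOb (vfun_comp V T (hom_from V C c) E) P) (FHom (vfun_comp V T (hom_from V C c) E) P t \<cdot> \<kappa>)"
      using power_iff[OF vself_vcat X] vcat_hom[OF C c Et] P t Et EP by simp
  qed
  then show ?thesis
    unfolding algebras_def bracket_ob_def using vfun_comp_functor[OF F H] by blast
qed

end

section \<open>Change of base\<close>

text \<open>\<open>comparison_iso\<close> is the clause on powers in
  \<open>preserves_limits\<close>; it lets base-changed hom-objects of \<open>V\<close> be tested at
  every object of \<open>W\<close>, not only at those in the image of \<open>M\<close>.\<close>

locale embedding = V: smcc V + W: smcc W
  for V :: "('o, 'a) smcc" and W :: "('p, 'b) smcc" (structure) +
  fixes M :: "('o, 'a, 'p, 'b) mon_functor"
  assumes monoidal: "is_symmetric_strong_monoidal V W M"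
    and fully_faithful: "is_fully_faithful V W (MOb M) (MArr M)"
    and comparison_iso: "\<lbrakk>x \<in> Obj V; y \<in> Obj V\<rbrakk> \<Longrightarrow>
      is_iso W (transpose_arr W (MOb M (IHom V x y)) (MOb M x) (MOb M y)
          (MArr M (Eval V x y) \<cdot> Mu M (IHom V x y) x))"
begin

lemma M_functor: "is_functor V W (MOb M) (MArr M)"
  using monoidal unfolding is_symmetric_strong_monoidal_def by (elim conjE)

lemma M_ob [simp]: "x \<in> Obj V \<Longrightarrow> MOb M x \<in> Obj W"
  and M_idn [simp]: "x \<in> Obj V \<Longrightarrow> MArr M (Idn V x) = Idn W (MOb M x)"
  using M_functor unfolding is_functor_def by blast+

lemma M_arr [simp]:
  assumes "f \<in> Arr V"
  shows "MArr M f \<in> Arr W" "Dom W (MArr M f) = MOb M (Dom V f)" "Cod W (MArr M f) = MOb M (Cod V f)"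
  using M_functor assms unfolding is_functor_def Hom_iff by blast+

lemma M_in: "f \<in> Hom V x y \<Longrightarrow> MArr M f \<in> Hom W (MOb M x) (MOb M y)"
  by (auto simp: Hom_iff)

lemma M_comp:
  "\<lbrakk>f \<in> Arr V; g \<in> Arr V; Cod V f = Dom V g\<rbrakk> \<Longrightarrow> MArr M (g \<cdot>\<^bsub>V\<^esub> f) = MArr M g \<cdot> MArr M f"
  using M_functor unfolding is_functor_def by blast

lemma eps [simp]: "Eps M \<in> Arr W" "Dom W (Eps M) = TUnit W" "Cod W (Eps M) = MOb M (TUnit V)"
    "is_iso W (Eps M)"
proof -
  have "Eps M \<in> Hom W (TUnit W) (MOb M (TUnit V))"
    using monoidal unfolding is_symmetric_strong_monoidal_def by (elim conjE)
  moreover have "is_iso W (Eps M)"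
    using monoidal unfolding is_symmetric_strong_monoidal_def by (elim conjE)
  ultimately show "Eps M \<in> Arr W" "Dom W (Eps M) = TUnit W" "Cod W (Eps M) = MOb M (TUnit V)"
    "is_iso W (Eps M)" by (simp_all add: Hom_iff)
qed

lemma mu [simp]:
  assumes "x \<in> Obj V" "y \<in> Obj V"
  shows "Mu M x y \<in> Arr W" "Dom W (Mu M x y) = MOb M x \<otimes> MOb M y"
    "Cod W (Mu M x y) = MOb M (x \<otimes>\<^bsub>V\<^esub> y)" "is_iso W (Mu M x y)"
proof -
  have "\<forall>x\<in>Obj V. \<forall>y\<in>Obj V. is_iso W (Mu M x y) \<and>
        Mu M x y \<in> Hom W (MOb M x \<otimes> MOb M y) (MOb M (x \<otimes>\<^bsub>V\<^esub> y))"
    using monoidal unfolding is_symmetric_strong_monoidal_def by (elim conjE)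
  then show "Mu M x y \<in> Arr W" "Dom W (Mu M x y) = MOb M x \<otimes> MOb M y"
    "Cod W (Mu M x y) = MOb M (x \<otimes>\<^bsub>V\<^esub> y)" "is_iso W (Mu M x y)"
    using assms by (auto simp: Hom_iff)
qed

lemma mu_nat:
  assumes "f \<in> Hom V x x'" "g \<in> Hom V y y'"
  shows "Mu M x' y' \<cdot> (MArr M f \<boxtimes> MArr M g) = MArr M (f \<boxtimes>\<^bsub>V\<^esub> g) \<cdot> Mu M x y"
proof -
  have "\<forall>f\<in>Arr V. \<forall>g\<in>Arr V.
        Mu M (Cod V f) (Cod V g) \<cdot> (MArr M f \<boxtimes> MArr M g) =
        MArr M (f \<boxtimes>\<^bsub>V\<^esub> g) \<cdot> Mu M (Dom V f) (Dom V g)"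
    using monoidal unfolding is_symmetric_strong_monoidal_def by (elim conjE)
  then show ?thesis using assms by (auto simp: Hom_iff)
qed

lemma mu_assoc:
  assumes "x \<in> Obj V" "y \<in> Obj V" "z \<in> Obj V"
  shows "MArr M (Assoc V x y z) \<cdot> Mu M (x \<otimes>\<^bsub>V\<^esub> y) z \<cdot> (Mu M x y \<boxtimes> Idn W (MOb M z)) =
        Mu M x (y \<otimes>\<^bsub>V\<^esub> z) \<cdot> (Idn W (MOb M x) \<boxtimes> Mu M y z) \<cdot>
          Assoc W (MOb M x) (MOb M y) (MOb M z)"
proof -
  have "\<forall>x\<in>Obj V. \<forall>y\<in>Obj V. \<forall>z\<in>Obj V.
        MArr M (Assoc V x y z) \<cdot> Mu M (x \<otimes>\<^bsub>V\<^esub> y) z \<cdot> (Mu M x y \<boxtimes> Idn W (MOb M z)) =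
        Mu M x (y \<otimes>\<^bsub>V\<^esub> z) \<cdot> (Idn W (MOb M x) \<boxtimes> Mu M y z) \<cdot>
          Assoc W (MOb M x) (MOb M y) (MOb M z)"
    using monoidal unfolding is_symmetric_strong_monoidal_def by (elim conjE)
  then show ?thesis using assms by blast
qed

lemma mu_unit:
  assumes "x \<in> Obj V"
  shows mu_lunit: "MArr M (LUnit V x) \<cdot> Mu M (TUnit V) x \<cdot> (Eps M \<boxtimes> Idn W (MOb M x)) =
        LUnit W (MOb M x)"
    and mu_runit: "MArr M (RUnit V x) \<cdot> Mu M x (TUnit V) \<cdot> (Idn W (MOb M x) \<boxtimes> Eps M) =
        RUnit W (MOb M x)"
proof -
  have "\<forall>x\<in>Obj V. MArr M (LUnit V x) \<cdot> Mu M (TUnit V) x \<cdot> (Eps M \<boxtimes> Idn W (MOb M x)) =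
        LUnit W (MOb M x)"
    using monoidal unfolding is_symmetric_strong_monoidal_def by (elim conjE)
  moreover have "\<forall>x\<in>Obj V. MArr M (RUnit V x) \<cdot> Mu M x (TUnit V) \<cdot> (Idn W (MOb M x) \<boxtimes> Eps M) =
        RUnit W (MOb M x)"
    using monoidal unfolding is_symmetric_strong_monoidal_def by (elim conjE)
  ultimately show "MArr M (LUnit V x) \<cdot> Mu M (TUnit V) x \<cdot> (Eps M \<boxtimes> Idn W (MOb M x)) =
        LUnit W (MOb M x)"
    "MArr M (RUnit V x) \<cdot> Mu M x (TUnit V) \<cdot> (Idn W (MOb M x) \<boxtimes> Eps M) =
        RUnit W (MOb M x)"
    using assms by blast+
qed

lemma mu_symm:
  assumes "x \<in> Obj V" "y \<in> Obj V"
  shows "MArr M (Symm V x y) \<cdot> Mu M x y = Mu M y x \<cdot> Symm W (MOb M x) (MOb M y)"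
proof -
  have "\<forall>x\<in>Obj V. \<forall>y\<in>Obj V.
        MArr M (Symm V x y) \<cdot> Mu M x y = Mu M y x \<cdot> Symm W (MOb M x) (MOb M y)"
    using monoidal unfolding is_symmetric_strong_monoidal_def by (elim conjE)
  then show ?thesis using assms by blast
qed

lemma M_faithful:
  assumes "f \<in> Hom V x y" "g \<in> Hom V x y" "MArr M f = MArr M g"
  shows "f = g"
  using fully_faithful V.hom_obj[OF assms(1)] assms
  unfolding is_fully_faithful_def bij_betw_def inj_on_def by blast

lemma M_full:
  assumes "x \<in> Obj V" "y \<in> Obj V" "g \<in> Hom W (MOb M x) (MOb M y)"
  obtains f where "f \<in> Hom V x y" "MArr M f = g"
proof -
  have "MArr M ` Hom V x y = Hom W (MOb M x) (MOb M y)"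
    using fully_faithful assms unfolding is_fully_faithful_def bij_betw_def by blast
  then show ?thesis using assms(3) that by (metis image_iff)
qed

abbreviation base where "base \<equiv> base_cat W M"

lemma base_simps [simp]: "VOb (base A) = VOb A" "VHom (base A) x y = MOb M (VHom A x y)"
  by (simp_all add: base_cat_def)

text \<open>Naturality of \<open>Mu\<close> moves it to the front, so that composites of
  base-changed arrows can be computed inside \<open>V\<close>.\<close>

lemma M_comp_mu:
  assumes c: "c \<in> Hom V (x \<otimes>\<^bsub>V\<^esub> y) z" and g: "g \<in> Hom V x' x" and f: "f \<in> Hom V y' y"
  shows "(MArr M c \<cdot> Mu M x y) \<cdot> (MArr M g \<boxtimes> MArr M f) =
    MArr M (c \<cdot>\<^bsub>V\<^esub> (g \<boxtimes>\<^bsub>V\<^esub> f)) \<cdot> Mu M x' y'"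
proof -
  note [simp] = V.hom_obj[OF g] V.hom_obj[OF f]
  have "(MArr M c \<cdot> Mu M x y) \<cdot> (MArr M g \<boxtimes> MArr M f) =
      MArr M c \<cdot> MArr M (g \<boxtimes>\<^bsub>V\<^esub> f) \<cdot> Mu M x' y'"
    using c g f by (simp add: Hom_iff W.comp_assoc flip: mu_nat[OF g f])
  then show ?thesis
    using c g f by (simp add: Hom_iff M_comp W.comp_assoc)
qed

lemma base_gc:
  assumes A: "is_vcat V A" and x: "x \<in> VOb A" and y: "y \<in> VOb A" and z: "z \<in> VOb A"
    and g: "g \<in> Hom V Q (VHom A y z)" and f: "f \<in> Hom V P (VHom A x y)"
  shows "W.gc (base A) x y z (MArr M g) (MArr M f) = MArr M (V.gc A x y z g f) \<cdot> Mu M Q P"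
  using M_comp_mu[OF V.vcat_comp[OF A x y z] g f] by (simp add: W.gc_def V.gc_def base_cat_def)

text \<open>
  Compatibility of base change with associativity, stated for arbitrary arrows so that it applies
  to composition in an enriched category and to evaluation alike.
\<close>
lemma M_assoc_law:
  assumes c: "c \<in> Hom V (u \<otimes>\<^bsub>V\<^esub> x) w" and d: "d \<in> Hom V (z \<otimes>\<^bsub>V\<^esub> y) u"
    and c': "c' \<in> Hom V (z \<otimes>\<^bsub>V\<^esub> v) w" and d': "d' \<in> Hom V (y \<otimes>\<^bsub>V\<^esub> x) v"
    and o [simp]: "x \<in> Obj V" "y \<in> Obj V" "z \<in> Obj V"
    and law: "c \<cdot>\<^bsub>V\<^esub> (d \<boxtimes>\<^bsub>V\<^esub> Idn V x) = c' \<cdot>\<^bsub>V\<^esub> (Idn V z \<boxtimes>\<^bsub>V\<^esub> d') \<cdot>\<^bsub>V\<^esub> Assoc V z y x"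
  shows "(MArr M c \<cdot> Mu M u x) \<cdot> ((MArr M d \<cdot> Mu M z y) \<boxtimes> Idn W (MOb M x)) =
    (MArr M c' \<cdot> Mu M z v) \<cdot> (Idn W (MOb M z) \<boxtimes> (MArr M d' \<cdot> Mu M y x)) \<cdot>
      Assoc W (MOb M z) (MOb M y) (MOb M x)"
proof -
  note [simp] = V.hom_obj[OF d] V.hom_obj[OF d']
  have "(MArr M c \<cdot> Mu M u x) \<cdot> ((MArr M d \<cdot> Mu M z y) \<boxtimes> Idn W (MOb M x)) =
      ((MArr M c \<cdot> Mu M u x) \<cdot> (MArr M d \<boxtimes> MArr M (Idn V x))) \<cdot> (Mu M z y \<boxtimes> Idn W (MOb M x))"
    using c d by (simp add: Hom_iff W.comp_assoc)
  also have "\<dots> = MArr M (c' \<cdot>\<^bsub>V\<^esub> (Idn V z \<boxtimes>\<^bsub>V\<^esub> d')) \<cdot> MArr M (Assoc V z y x) \<cdot>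
      Mu M (z \<otimes>\<^bsub>V\<^esub> y) x \<cdot> (Mu M z y \<boxtimes> Idn W (MOb M x))"
    unfolding M_comp_mu[OF c d V.idn_in[OF o(1)]] law
    using c' d' by (simp add: Hom_iff W.comp_assoc M_comp)
  also have "\<dots> = (MArr M (c' \<cdot>\<^bsub>V\<^esub> (Idn V z \<boxtimes>\<^bsub>V\<^esub> d')) \<cdot> Mu M z (y \<otimes>\<^bsub>V\<^esub> x)) \<cdot>
      (Idn W (MOb M z) \<boxtimes> Mu M y x) \<cdot> Assoc W (MOb M z) (MOb M y) (MOb M x)"
    unfolding mu_assoc[OF o(3,2,1)] using c' d' by (simp add: Hom_iff W.comp_assoc)
  also have "\<dots> = (MArr M c' \<cdot> Mu M z v) \<cdot> (MArr M (Idn V z) \<boxtimes> MArr M d') \<cdot>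
      (Idn W (MOb M z) \<boxtimes> Mu M y x) \<cdot> Assoc W (MOb M z) (MOb M y) (MOb M x)"
    unfolding M_comp_mu[OF c' V.idn_in[OF o(3)] d', symmetric]
    using c' d' by (simp add: Hom_iff W.comp_assoc)
  also have "\<dots> = (MArr M c' \<cdot> Mu M z v) \<cdot> (Idn W (MOb M z) \<boxtimes> (MArr M d' \<cdot> Mu M y x)) \<cdot>
      Assoc W (MOb M z) (MOb M y) (MOb M x)"
    using c' d' by (simp add: Hom_iff)
  finally show ?thesis .
qed

lemma M_unit_law:
  assumes c: "c \<in> Hom V (u \<otimes>\<^bsub>V\<^esub> x) x" and i: "i \<in> Hom V (TUnit V) u" and x [simp]: "x \<in> Obj V"
    and law: "c \<cdot>\<^bsub>V\<^esub> (i \<boxtimes>\<^bsub>V\<^esub> Idn V x) = LUnit V x"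
  shows "(MArr M c \<cdot> Mu M u x) \<cdot> ((MArr M i \<cdot> Eps M) \<boxtimes> Idn W (MOb M x)) = LUnit W (MOb M x)"
proof -
  note [simp] = V.hom_obj[OF i]
  have "(MArr M c \<cdot> Mu M u x) \<cdot> ((MArr M i \<cdot> Eps M) \<boxtimes> Idn W (MOb M x)) =
      ((MArr M c \<cdot> Mu M u x) \<cdot> (MArr M i \<boxtimes> MArr M (Idn V x))) \<cdot> (Eps M \<boxtimes> Idn W (MOb M x))"
    using c i by (simp add: Hom_iff W.comp_assoc)
  also have "\<dots> = LUnit W (MOb M x)"
    unfolding M_comp_mu[OF c i V.idn_in[OF x]] law by (simp add: W.comp_assoc mu_lunit)
  finally show ?thesis .
qed

lemma base_vcat:
  assumes A: "is_vcat V A" shows "is_vcat W (base A)"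
  unfolding is_vcat_def
proof (intro conjI ballI, unfold base_simps)
  note h = V.vcat_hom[OF A] and c = V.vcat_comp[OF A] and i = V.vcat_id[OF A]
  fix x y assume o: "x \<in> VOb A" "y \<in> VOb A"
  then show "MOb M (VHom A x y) \<in> Obj W" by (simp add: h)
  show "VId (base A) x \<in> Hom W (TUnit W) (MOb M (VHom A x x))"
    using i[OF o(1,1)] by (simp add: base_cat_def Hom_iff)
  have law: "VComp A x y y \<cdot>\<^bsub>V\<^esub> (VId A y \<boxtimes>\<^bsub>V\<^esub> Idn V (VHom A x y)) = LUnit V (VHom A x y)"
    "VComp A x x y \<cdot>\<^bsub>V\<^esub> (Idn V (VHom A x y) \<boxtimes>\<^bsub>V\<^esub> VId A x) = RUnit V (VHom A x y)"
    using A o unfolding is_vcat_def by blast+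
  show "VComp (base A) x y y \<cdot> (VId (base A) y \<boxtimes> Idn W (MOb M (VHom A x y))) =
      LUnit W (MOb M (VHom A x y))"
    using M_unit_law[OF c[OF o o(2)] i[OF o(2,2)] h[OF o] law(1)] by (simp add: base_cat_def)
  note [simp] = h[OF o] h[OF o(1,1)]
  have "VComp (base A) x x y \<cdot> (Idn W (MOb M (VHom A x y)) \<boxtimes> VId (base A) x) =
      ((MArr M (VComp A x x y) \<cdot> Mu M (VHom A x y) (VHom A x x)) \<cdot>
        (MArr M (Idn V (VHom A x y)) \<boxtimes> MArr M (VId A x))) \<cdot> (Idn W (MOb M (VHom A x y)) \<boxtimes> Eps M)"
    using c[OF o(1) o] i[OF o(1,1)] by (simp add: base_cat_def Hom_iff W.comp_assoc)
  also have "\<dots> = RUnit W (MOb M (VHom A x y))"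
    unfolding M_comp_mu[OF c[OF o(1) o] V.idn_in[OF h[OF o]] i[OF o(1,1)]] law(2)
    by (simp add: W.comp_assoc mu_runit)
  finally show "VComp (base A) x x y \<cdot> (Idn W (MOb M (VHom A x y)) \<boxtimes> VId (base A) x) =
      RUnit W (MOb M (VHom A x y))" .
  fix z assume z: "z \<in> VOb A"
  show "VComp (base A) x y z \<in> Hom W (MOb M (VHom A y z) \<otimes> MOb M (VHom A x y)) (MOb M (VHom A x z))"
    using c[OF o z] h[OF o(2) z] by (simp add: base_cat_def Hom_iff)
  fix w assume w: "w \<in> VOb A"
  have "VComp A w x z \<cdot>\<^bsub>V\<^esub> (VComp A x y z \<boxtimes>\<^bsub>V\<^esub> Idn V (VHom A w x)) =
      VComp A w y z \<cdot>\<^bsub>V\<^esub> (Idn V (VHom A y z) \<boxtimes>\<^bsub>V\<^esub> VComp A w x y) \<cdot>\<^bsub>V\<^esub>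
        Assoc V (VHom A y z) (VHom A x y) (VHom A w x)"
    using A w z o unfolding is_vcat_def by blast
  from M_assoc_law[OF c[OF w o(1) z] c[OF o z] c[OF w o(2) z] c[OF w o] h[OF w o(1)] h[OF o] h[OF o(2) z] this]
  show "VComp (base A) w x z \<cdot> (VComp (base A) x y z \<boxtimes> Idn W (MOb M (VHom A w x))) =
        VComp (base A) w y z \<cdot> (Idn W (MOb M (VHom A y z)) \<boxtimes> VComp (base A) w x y) \<cdot>
          Assoc W (MOb M (VHom A y z)) (MOb M (VHom A x y)) (MOb M (VHom A w x))"
    by (simp add: base_cat_def)
qed

lemma base_fun_simps [simp]: "FOb (base_fun M A F) = FOb F"
  "x \<in> VOb A \<Longrightarrow> y \<in> VOb A \<Longrightarrow> FHom (base_fun M A F) x y = MArr M (FHom F x y)"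
  by (simp_all add: base_fun_def)

lemma base_functor:
  assumes F: "is_vfunctor V A B F"
  shows "is_vfunctor W (base A) (base B) (base_fun M A F)"
  unfolding is_vfunctor_def
proof (intro conjI ballI, unfold base_simps)
  note A = V.vfun_vcat(1)[OF F] and B = V.vfun_vcat(2)[OF F]
  show "is_vcat W (base A)" "is_vcat W (base B)" by (fact base_vcat[OF A] base_vcat[OF B])+
  \<comment> \<open>\<open>base_fun\<close> leaves the object part untouched, so its extensionality
    has to be taken from that of \<open>F\<close>.\<close>
  have "FOb F = restrict (FOb F) (VOb A)"
    using V.vfun_eq[OF F] by (simp add: restrict_vfun_def) (metis vfun.select_convs(1))
  then show "base_fun M A F = restrict_vfun (base A) (FOb (base_fun M A F)) (FHom (base_fun M A F))"
    by (simp add: base_fun_def restrict_vfun_def restrict_def fun_eq_iff)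
  fix x y assume o: "x \<in> VOb A" "y \<in> VOb A"
  note h = V.vfun_hom[OF F] and fo = V.vfun_ob[OF F]
  show "FOb (base_fun M A F) x \<in> VOb B" using fo[OF o(1)] by simp
  show "FHom (base_fun M A F) x y \<in> Hom W (MOb M (VHom A x y))
      (MOb M (VHom B (FOb (base_fun M A F) x) (FOb (base_fun M A F) y)))"
    using M_in[OF h[OF o]] o by simp
  have "MArr M (FHom F x x) \<cdot> MArr M (VId A x) = MArr M (VId B (FOb F x))"
    using h[OF o(1,1)] V.vcat_id[OF A o(1,1)] V.vfun_id[OF F o(1)]
    by (simp add: Hom_iff flip: M_comp)
  then show "FHom (base_fun M A F) x x \<cdot> VId (base A) x = VId (base B) (FOb (base_fun M A F) x)"
    using h[OF o(1,1)] V.vcat_id[OF A o(1,1)] o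
    by (simp add: base_cat_def Hom_iff flip: W.comp_assoc)
  fix z assume z: "z \<in> VOb A"
  note [simp] = V.vcat_hom[OF A o] V.vcat_hom[OF A o(2) z]
  have law: "FHom F x z \<cdot>\<^bsub>V\<^esub> VComp A x y z =
        VComp B (FOb F x) (FOb F y) (FOb F z) \<cdot>\<^bsub>V\<^esub> (FHom F y z \<boxtimes>\<^bsub>V\<^esub> FHom F x y)"
    using F o z unfolding is_vfunctor_def by blast
  have "FHom (base_fun M A F) x z \<cdot> VComp (base A) x y z =
      MArr M (FHom F x z \<cdot>\<^bsub>V\<^esub> VComp A x y z) \<cdot> Mu M (VHom A y z) (VHom A x y)"
    using V.vcat_comp[OF A o z] h[OF o(1) z] o z
    by (simp add: base_cat_def Hom_iff W.comp_assoc M_comp)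
  also have "\<dots> = VComp (base B) (FOb (base_fun M A F) x) (FOb (base_fun M A F) y) (FOb (base_fun M A F) z) \<cdot>
      (FHom (base_fun M A F) y z \<boxtimes> FHom (base_fun M A F) x y)"
    unfolding law
    using M_comp_mu[OF V.vcat_comp[OF B fo[OF o(1)] fo[OF o(2)] fo[OF z]] h[OF o(2) z] h[OF o]] o z
    by (simp add: base_cat_def)
  finally show "FHom (base_fun M A F) x z \<cdot> VComp (base A) x y z = \<dots>" .
qed

section \<open>Evaluation of the base after base change\<close>

definition bev :: "'o \<Rightarrow> 'o \<Rightarrow> 'b" where
  "bev x y = MArr M (Eval V x y) \<cdot> Mu M (IHom V x y) x"

text \<open>
  Base change of the base: the invertibility of the comparison of internal homs makes the
  evaluation of \<open>V\<close>, carried to \<open>W\<close>, universal among all objects of \<open>W\<close>.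
\<close>
sublocale bs: concrete W "base (vself V)" "MOb M" bev
proof -
  interpret vs: concrete V "vself V" "\<lambda>x. x" "Eval V" by (rule V.vself_concrete)
  have S: "is_vcat W (base (vself V))" by (rule base_vcat[OF V.vself_vcat])
  have evin: "bev x y \<in> Hom W (MOb M (IHom V x y) \<otimes> MOb M x) (MOb M y)"
    if "x \<in> Obj V" "y \<in> Obj V" for x y
    using that by (simp add: bev_def Hom_iff)
  have univ: "\<exists>!g. g \<in> Hom W Z (MOb M (IHom V x y)) \<and> bev x y \<cdot> (g \<boxtimes> Idn W (MOb M x)) = f"
    if x [simp]: "x \<in> Obj V" and y [simp]: "y \<in> Obj V" and Z [simp]: "Z \<in> Obj W"
      and f: "f \<in> Hom W (Z \<otimes> MOb M x) (MOb M y)" for x y Z f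
  proof -
    \<comment> \<open>Evaluation through \<open>bev\<close> is the evaluation of \<open>W\<close>
      after composing with \<open>cmp\<close> (fact \<open>tg\<close>). As \<open>cmp\<close> is
      invertible, the universal property in \<open>W\<close> passes to \<open>bev\<close>.\<close>
    define cmp where "cmp = transpose_arr W (MOb M (IHom V x y)) (MOb M x) (MOb M y) (bev x y)"
    let ?E = "Eval W (MOb M x) (MOb M y)" and ?i = "Idn W (MOb M x)"
    have iso: "is_iso W cmp" using comparison_iso[OF x y] by (simp add: bev_def cmp_def)
    have t: "cmp \<in> Hom W (MOb M (IHom V x y)) (IHom W (MOb M x) (MOb M y))"
      "?E \<cdot> (cmp \<boxtimes> ?i) = bev x y"
      using W.transpose_arr[OF _ _ _ evin[OF x y]] by (simp_all add: cmp_def)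
    have tg: "bev x y \<cdot> (g \<boxtimes> ?i) = ?E \<cdot> ((cmp \<cdot> g) \<boxtimes> ?i)"
      if "g \<in> Hom W Z (MOb M (IHom V x y))" for g
      unfolding t(2)[symmetric] using t(1) that by (simp add: Hom_iff W.comp_assoc)
    note ex = W.eval_universal[OF M_ob[OF x] M_ob[OF y] Z f]
    obtain k where k: "k \<in> Hom W Z (IHom W (MOb M x) (MOb M y))" "?E \<cdot> (k \<boxtimes> ?i) = f"
      using ex by blast
    note ti = W.inverse_arrD[OF iso]
    let ?g = "inverse_arr W cmp \<cdot> k"
    have g: "?g \<in> Hom W Z (MOb M (IHom V x y))" "cmp \<cdot> ?g = k"
      using t(1) ti k(1) by (simp_all add: Hom_iff flip: W.comp_assoc)
    have "g' = ?g" if g': "g' \<in> Hom W Z (MOb M (IHom V x y))" "bev x y \<cdot> (g' \<boxtimes> ?i) = f" for g'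
    proof (rule W.iso_mono[OF iso])
      show "cmp \<cdot> g' = cmp \<cdot> ?g"
        using ex k g g' tg[OF g'(1)] W.comp_in[OF g'(1) t(1)] by metis
    qed (use t(1) g g' in \<open>auto simp: Hom_iff\<close>)
    then show ?thesis using g k tg[OF g(1)] by metis
  qed
  show "concrete W (base (vself V)) (MOb M) bev"
  proof (unfold_locales, unfold base_simps V.vself_simps)
    fix x y assume x: "x \<in> Obj V" and y: "y \<in> Obj V"
    note S' = W.vcatD[OF S]
    show "MOb M (IHom V x y) \<in> Obj W" "MOb M x \<in> Obj W" using x y by simp_all
    show "VId (base (vself V)) x \<in> Hom W (TUnit W) (MOb M (IHom V x x))"
      using S'(3)[of x] x by simp
    show "bev x y \<in> Hom W (MOb M (IHom V x y) \<otimes> MOb M x) (MOb M y)" by (rule evin[OF x y])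
    show "bev x x \<cdot> (VId (base (vself V)) x \<boxtimes> Idn W (MOb M x)) = LUnit W (MOb M x)"
      using M_unit_law[OF _ _ x vs.ev_id, of "IHom V x x"] vs.S_id[of x] x
      by (simp add: bev_def base_cat_def Hom_iff)
    fix z assume z: "z \<in> Obj V"
    show "VComp (base (vself V)) x y z \<in> Hom W (MOb M (IHom V y z) \<otimes> MOb M (IHom V x y)) (MOb M (IHom V x z))"
      using S'(2)[of x y z] x y z by simp
    show "bev x z \<cdot> (VComp (base (vself V)) x y z \<boxtimes> Idn W (MOb M x)) =
      bev y z \<cdot> (Idn W (MOb M (IHom V y z)) \<boxtimes> bev x y) \<cdot>
        Assoc W (MOb M (IHom V y z)) (MOb M (IHom V x y)) (MOb M x)"
      using M_assoc_law[OF vs.ev_in vs.S_comp vs.ev_in vs.ev_in x _ _ vs.ev_comp, of z y] x y z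
      by (simp add: bev_def base_cat_def)
  qed (use univ in auto)
qed

lemma base_rep:
  assumes A: "is_vcat V A" and L: "concrete.is_rep V (vself V) (\<lambda>x. x) (Eval V) A c h L"
  shows "bs.is_rep (base A) c h (\<lambda>x y. MArr M (L x y))"
proof -
  interpret vs: concrete V "vself V" "\<lambda>x. x" "Eval V" by (rule V.vself_concrete)
  have "MArr M (L x y) \<in> Hom W (MOb M (VHom A x y)) (MOb M (IHom V (h x) (h y))) \<and>
      bev (h x) (h y) \<cdot> (MArr M (L x y) \<boxtimes> Idn W (MOb M (VHom A c x))) = VComp (base A) c x y"
    if x: "x \<in> VOb A" and y: "y \<in> VOb A" for x y
  proof
    note r = vs.is_repD[OF L x] and hy = vs.is_repD(2)[OF L y]
    have L': "L x y \<in> Hom V (VHom A x y) (IHom V (h x) (h y))" using r(4)[OF y] by simp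
    show "MArr M (L x y) \<in> Hom W (MOb M (VHom A x y)) (MOb M (IHom V (h x) (h y)))"
      by (rule M_in[OF L'])
    have "Eval V (h x) (h y) \<in> Hom V (IHom V (h x) (h y) \<otimes>\<^bsub>V\<^esub> h x) (h y)"
      using vs.ev_in[OF r(2) hy] by simp
    from M_comp_mu[OF this L' V.idn_in[of "h x"]]
    show "bev (h x) (h y) \<cdot> (MArr M (L x y) \<boxtimes> Idn W (MOb M (VHom A c x))) = VComp (base A) c x y"
      using r(2,3,5) y V.vcat_hom[OF A r(1) x] by (simp add: bev_def base_cat_def)
  qed
  moreover have "c \<in> VOb A" using L unfolding vs.is_rep_def by blast
  moreover have "h x \<in> Obj V" "MOb M (h x) = MOb M (VHom A c x)" if "x \<in> VOb A" for x
    using vs.is_repD(2,3)[OF L that] by simp_all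
  ultimately show ?thesis
    unfolding bs.is_rep_def base_simps V.vself_simps by blast
qed

text \<open>Opposites and base change commute because \<open>M\<close> respects the
  symmetry.\<close>

lemma base_vop_comp:
  assumes A: "is_vcat V A" and x: "x \<in> VOb A" and y: "y \<in> VOb A" and z: "z \<in> VOb A"
  shows "VComp (base (vop V A)) x y z = VComp (vop W (base A)) x y z"
  using V.vcat_comp[OF A z y x] V.vcat_hom[OF A z y] V.vcat_hom[OF A y x]
  by (simp add: base_cat_def vop_def M_comp Hom_iff W.comp_assoc mu_symm)

lemma base_bimodule:
  assumes A: "is_vcat V A"
  shows "bimodule W (base (vself V)) (MOb M) bev (base A) (VHom A)
    (\<lambda>c x y. MArr M (FHom (hom_from V A c) x y)) (\<lambda>x c d. MArr M (FHom (hom_to V A x) c d))"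
proof unfold_locales
  interpret vs: concrete V "vself V" "\<lambda>x. x" "Eval V" by (rule V.vself_concrete)
  show "is_vcat W (base A)" by (rule base_vcat[OF A])
  fix c assume "c \<in> VOb (base A)"
  then have c: "c \<in> VOb A" by simp
  show "bs.is_rep (base A) c (VHom A c) (\<lambda>x y. MArr M (FHom (hom_from V A c) x y))"
    by (rule base_rep[OF A V.hom_from_rep[OF A c]])
  \<comment> \<open>The contravariant representable is covariant on the opposite; after base change
    \<open>base_vop_comp\<close> identifies the two opposites.\<close>
  have "bs.is_rep (base (vop V A)) c (VHom (vop V A) c) (\<lambda>x y. MArr M (FHom (hom_to V A c) x y))"
    unfolding V.hom_to_eq by (rule base_rep[OF V.vop_vcat[OF A] V.hom_from_rep[OF V.vop_vcat[OF A]]]) (simp add: c)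
  then show "bs.is_rep (vop W (base A)) c (\<lambda>x. VHom A x c) (\<lambda>x y. MArr M (FHom (hom_to V A c) x y))"
    unfolding bs.is_rep_def by (simp add: base_vop_comp[OF A])
qed

end

section \<open>Ends and functor categories\<close>

text \<open>\<open>has_limits\<close> speaks only of shapes whose objects and arrows have type
  \<open>'u\<close>. The given shape is copied along the two injections, and cones over the copy
  correspond to cones over the original.\<close>

lemma has_limits_small:
  fixes D :: "('i, 'j) category"
  assumes lim: "has_limits TYPE('u) K" and D: "is_category D"
    and so: "is_small TYPE('u) (Obj D)" and sa: "is_small TYPE('u) (Arr D)"
    and F: "is_functor D K Fo Fa"
  shows "\<exists>L p. is_limit D K Fo Fa L p"
proof -
  obtain f :: "'i \<Rightarrow> 'u" where f: "inj_on f (Obj D)" using so unfolding is_small_def by blast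
  obtain g :: "'j \<Rightarrow> 'u" where g: "inj_on g (Arr D)" using sa unfolding is_small_def by blast
  define f' where "f' = inv_into (Obj D) f"
  define g' where "g' = inv_into (Arr D) g"
  have f' [simp]: "f' (f d) = d" if "d \<in> Obj D" for d using f that by (simp add: f'_def)
  have g' [simp]: "g' (g u) = u" if "u \<in> Arr D" for u using g that by (simp add: g'_def)
  define D' :: "('u, 'u) category" where "D' = \<lparr>Obj = f ` Obj D, Arr = g ` Arr D,
    Dom = (\<lambda>u. f (Dom D (g' u))), Cod = (\<lambda>u. f (Cod D (g' u))), Idn = (\<lambda>d. g (Idn D (f' d))),
    Comp = (\<lambda>v u. g (g' v \<cdot>\<^bsub>D\<^esub> g' u))\<rparr>"
  have dc: "Dom D u \<in> Obj D" "Cod D u \<in> Obj D" if "u \<in> Arr D" for u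
    using D that unfolding is_category_def by blast+
  have idn: "Idn D d \<in> Arr D" "Dom D (Idn D d) = d" "Cod D (Idn D d) = d" if "d \<in> Obj D" for d
    using D that unfolding is_category_def Hom_iff by blast+
  have cmp: "v \<cdot>\<^bsub>D\<^esub> u \<in> Arr D" "Dom D (v \<cdot>\<^bsub>D\<^esub> u) = Dom D u" "Cod D (v \<cdot>\<^bsub>D\<^esub> u) = Cod D v"
    if "u \<in> Arr D" "v \<in> Arr D" "Cod D u = Dom D v" for u v
    using D that unfolding is_category_def Hom_iff by blast+
  have ff: "f d = f e \<longleftrightarrow> d = e" if "d \<in> Obj D" "e \<in> Obj D" for d e
    using f that by (auto dest: inj_onD)
  have unit: "u \<cdot>\<^bsub>D\<^esub> Idn D (Dom D u) = u" "Idn D (Cod D u) \<cdot>\<^bsub>D\<^esub> u = u" if "u \<in> Arr D" for u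
    using D that unfolding is_category_def by blast+
  have assoc: "(w \<cdot>\<^bsub>D\<^esub> v) \<cdot>\<^bsub>D\<^esub> u = w \<cdot>\<^bsub>D\<^esub> (v \<cdot>\<^bsub>D\<^esub> u)"
    if "u \<in> Arr D" "v \<in> Arr D" "w \<in> Arr D" "Cod D u = Dom D v" "Cod D v = Dom D w" for u v w
    using D that unfolding is_category_def by blast
  have F1: "Fo d \<in> Obj K" "Fa (Idn D d) = Idn K (Fo d)" if "d \<in> Obj D" for d
    using F that unfolding is_functor_def by blast+
  have F2: "Fa u \<in> Hom K (Fo (Dom D u)) (Fo (Cod D u))" if "u \<in> Arr D" for u
    using F that unfolding is_functor_def by blast
  have F3: "Fa (v \<cdot>\<^bsub>D\<^esub> u) = Fa v \<cdot>\<^bsub>K\<^esub> Fa u" if "u \<in> Arr D" "v \<in> Arr D" "Cod D u = Dom D v" for u v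
    using F that unfolding is_functor_def by blast
  have "is_category D'"
    unfolding is_category_def D'_def by (auto simp: Hom_iff dc idn cmp ff unit assoc)
  moreover have "is_functor D' K (Fo \<circ> f') (Fa \<circ> g')"
    unfolding is_functor_def D'_def by (auto simp: dc idn cmp ff F1 F2 F3)
  ultimately obtain L p where lp: "is_limit D' K (Fo \<circ> f') (Fa \<circ> g') L p"
    using lim unfolding has_limits_def by blast
  have cone: "is_cone D' K (Fo \<circ> f') (Fa \<circ> g') L' q \<longleftrightarrow> is_cone D K Fo Fa L' (q \<circ> f)" for L' q
    unfolding is_cone_def D'_def by (auto simp: dc)
  have "is_limit D K Fo Fa L (p \<circ> f)"
    unfolding is_limit_def
  proof (intro conjI allI impI)
    show "is_cone D K Fo Fa L (p \<circ> f)" using lp cone unfolding is_limit_def by blast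
    fix L' q assume q: "is_cone D K Fo Fa L' q"
    have "is_cone D K Fo Fa L' ((q \<circ> f') \<circ> f)"
      using q unfolding is_cone_def by (auto simp: dc)
    then have "\<exists>!h. h \<in> Hom K L' L \<and> (\<forall>d\<in>Obj D'. p d \<cdot>\<^bsub>K\<^esub> h = (q \<circ> f') d)"
      using lp cone unfolding is_limit_def by blast
    then show "\<exists>!h. h \<in> Hom K L' L \<and> (\<forall>d\<in>Obj D. (p \<circ> f) d \<cdot>\<^bsub>K\<^esub> h = q d)"
      by (simp add: D'_def)
  qed
  then show ?thesis by blast
qed

text \<open>An infinite type is in bijection with its square, so pairs can again be coded in
  \<open>'u\<close>.\<close>

lemma small_times:
  assumes inf: "infinite (UNIV :: 'u set)" and S: "is_small TYPE('u) S" and T: "is_small TYPE('u) T"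
  shows "is_small TYPE('u) (S \<times> T)"
proof -
  obtain f where f: "inj_on (f :: _ \<Rightarrow> 'u) S" using S unfolding is_small_def by blast
  obtain g where g: "inj_on (g :: _ \<Rightarrow> 'u) T" using T unfolding is_small_def by blast
  obtain h :: "'u \<times> 'u \<Rightarrow> 'u" where h: "bij_betw h (UNIV \<times> UNIV) UNIV"
    using iffD2[OF card_of_ordIso card_of_Times_same_infinite[OF inf]] by (elim exE)
  have "inj_on h (UNIV \<times> UNIV)" using h by (rule bij_betw_imp_inj_on)
  then have hh: "x = x' \<and> y = y'" if "h (x, y) = h (x', y')" for x y x' y'
    using inj_onD[of h "UNIV \<times> UNIV" "(x, y)" "(x', y')"] that by simp
  have "inj_on (\<lambda>z. h (f (fst z), g (snd z))) (S \<times> T)"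
  proof (rule inj_onI)
    fix z z' assume z: "z \<in> S \<times> T" "z' \<in> S \<times> T"
      and "h (f (fst z), g (snd z)) = h (f (fst z'), g (snd z'))"
    then have "f (fst z) = f (fst z') \<and> g (snd z) = g (snd z')" by (intro hh)
    then show "z = z'"
      using z inj_onD[OF f] inj_onD[OF g] by (simp add: mem_Times_iff prod_eq_iff)
  qed
  then show ?thesis unfolding is_small_def by blast
qed

lemma small_nat:
  assumes "infinite (UNIV :: 'u set)" shows "is_small TYPE('u) (N :: nat set)"
proof -
  obtain f :: "nat \<Rightarrow> 'u" where "inj f" using infinite_countable_subset[OF assms] by blast
  then have "inj_on f N" by (rule inj_on_subset) simp
  then show ?thesis unfolding is_small_def by blast
qed

lemma small_subset: "is_small U S \<Longrightarrow> T \<subseteq> S \<Longrightarrow> is_small U T"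
  unfolding is_small_def using inj_on_subset by blast

text \<open>
  The shape of the diagram whose limit is an end over \<open>S\<close>: objects \<open>(0,x,x)\<close> for the values at \<open>x\<close>
  and \<open>(1,x,y)\<close> for the naturality condition at \<open>x, y\<close>, which is the target of the arrows \<open>(2,x,y)\<close>
  from \<open>(0,x,x)\<close> and \<open>(3,x,y)\<close> from \<open>(0,y,y)\<close>; identities are numbered like their objects.
\<close>
definition end_shape :: "'c set \<Rightarrow> (nat \<times> 'c \<times> 'c, nat \<times> 'c \<times> 'c) category" where
  "end_shape S = \<lparr>Obj = (\<lambda>x. (0, x, x)) ` S \<union> {1} \<times> S \<times> S,
     Arr = (\<lambda>x. (0, x, x)) ` S \<union> {1, 2, 3} \<times> S \<times> S,
     Dom = (\<lambda>(i, x, y). if i = 2 then (0, x, x) else if i = 3 then (0, y, y) else (i, x, y)),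
     Cod = (\<lambda>(i, x, y). if i < 2 then (i, x, y) else (1, x, y)),
     Idn = (\<lambda>d. d),
     Comp = (\<lambda>v u. if fst v < 2 then u else v)\<rparr>"

text \<open>Arrows tagged 2 or 3 run from objects tagged 0 to objects tagged 1, so every composable
  pair contains an identity and the composite is the other member.\<close>

lemma end_shape_category: "is_category (end_shape S)"
  unfolding is_category_def end_shape_def Hom_iff by auto

text \<open>Objects and arrows are triples with tag at most 3, so a finite range of tags times two
  copies of \<open>S\<close> bounds both.\<close>

lemma end_shape_small:
  assumes "infinite (UNIV :: 'u set)" "is_small TYPE('u) S"
  shows "is_small TYPE('u) (Obj (end_shape S))" "is_small TYPE('u) (Arr (end_shape S))"
proof -
  have "is_small TYPE('u) ({..3::nat} \<times> S \<times> S)"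
    by (intro small_times small_nat assms)
  then show "is_small TYPE('u) (Obj (end_shape S))" "is_small TYPE('u) (Arr (end_shape S))"
    by (rule small_subset, auto simp: end_shape_def)+
qed

context smcc begin

section \<open>Ends as limits\<close>

lemma transpose_comp:
  assumes "x \<in> Obj V" "f \<in> Hom V (z \<otimes> x) y" "h \<in> Hom V w z"
  shows "Eval V x y \<cdot> ((transpose_arr V z x y f \<cdot> h) \<boxtimes> Idn V x) = f \<cdot> (h \<boxtimes> Idn V x)"
proof -
  note y = hom_obj(2)[OF assms(2)] and z = hom_obj(2)[OF assms(3)]
  note t = transpose_arr[OF assms(1) y z assms(2)]
  have "Eval V x y \<cdot> ((transpose_arr V z x y f \<cdot> h) \<boxtimes> Idn V x) =
      (Eval V x y \<cdot> (transpose_arr V z x y f \<boxtimes> Idn V x)) \<cdot> (h \<boxtimes> Idn V x)"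
    using t(1) assms y by (simp add: Hom_iff comp_assoc)
  then show ?thesis by (simp add: t(2))
qed

text \<open>Transposing the naturality square over \<open>A(x,y)\<close> turns it into an equation
  \<open>tr x y \<cdot> p x = tl x y \<cdot> p y\<close> between composites with fixed arrows. Cones
  over the corresponding diagram on \<open>end_shape\<close> are then natural families, and its
  limit is the end.\<close>

lemma nat_object_exists:
  assumes lim: "has_limits TYPE('u) V" and inf: "infinite (UNIV :: 'u set)"
    and small: "is_small TYPE('u) (VOb A)"
    and F: "is_vfunctor V A B F" and G: "is_vfunctor V A B G"
  shows "\<exists>W p. is_nat_object V A B F G W p"
proof -
  note A = vfun_vcat(1)[OF F] and B = vfun_vcat(2)[OF F]
  let ?h = "\<lambda>x y. VHom B (FOb F x) (FOb G y)"
  let ?D = "end_shape (VOb A)"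
  note hA = vcat_hom[OF A]
  have hB: "?h x y \<in> Obj V" if "x \<in> VOb A" "y \<in> VOb A" for x y
    using vcat_hom[OF B vfun_ob[OF F] vfun_ob[OF G]] that by blast
  \<comment> \<open>\<open>r\<close> and \<open>l\<close> are the two sides of the naturality square
    with the component replaced by the generic element of its hom-object; the facts
    \<open>rp\<close> and \<open>lp\<close> recover an arbitrary component \<open>k\<close>.\<close>
  define r where "r x y = gc B (FOb F x) (FOb G x) (FOb G y) (FHom G x y) (Idn V (?h x x)) \<cdot>
    Symm V (?h x x) (VHom A x y)" for x y
  define l where "l x y = gc B (FOb F x) (FOb F y) (FOb G y) (Idn V (?h y y)) (FHom F x y)" for x y
  have s: "Symm V x y \<in> Hom V (x \<otimes> y) (y \<otimes> x)" if "x \<in> Obj V" "y \<in> Obj V" for x y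
    using that by (simp add: Hom_iff)
  have g: "gc B (FOb F x) (FOb G x) (FOb G y) (FHom G x y) (Idn V (?h x x)) \<in> Hom V (VHom A x y \<otimes> ?h x x) (?h x y)"
    if "x \<in> VOb A" "y \<in> VOb A" for x y
    by (intro gc_in[OF B] vfun_ob[OF F] vfun_ob[OF G] vfun_hom[OF G] idn_in hB that)
  have r: "r x y \<in> Hom V (?h x x \<otimes> VHom A x y) (?h x y)" if "x \<in> VOb A" "y \<in> VOb A" for x y
    unfolding r_def by (rule comp_in[OF s[OF hB hA] g]) (use that in auto)
  have l: "l x y \<in> Hom V (?h y y \<otimes> VHom A x y) (?h x y)" if "x \<in> VOb A" "y \<in> VOb A" for x y
    unfolding l_def by (intro gc_in[OF B] vfun_ob[OF F] vfun_ob[OF G] vfun_hom[OF F] idn_in hB that)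
  define tr where "tr x y = transpose_arr V (?h x x) (VHom A x y) (?h x y) (r x y)" for x y
  define tl where "tl x y = transpose_arr V (?h y y) (VHom A x y) (?h x y) (l x y)" for x y
  have tr: "tr x y \<in> Hom V (?h x x) (IHom V (VHom A x y) (?h x y))"
    and tl: "tl x y \<in> Hom V (?h y y) (IHom V (VHom A x y) (?h x y))" if "x \<in> VOb A" "y \<in> VOb A" for x y
    unfolding tr_def tl_def using transpose_arr(1)[OF hA hB hB r] transpose_arr(1)[OF hA hB hB l] that
    by blast+
  have rp: "r x y \<cdot> (k \<boxtimes> Idn V (VHom A x y)) =
      gc B (FOb F x) (FOb G x) (FOb G y) (FHom G x y) k \<cdot> Symm V W (VHom A x y)"
    if x: "x \<in> VOb A" and y: "y \<in> VOb A" and p: "k \<in> Hom V W (?h x x)" for W k x y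
  proof -
    have "r x y \<cdot> (k \<boxtimes> Idn V (VHom A x y)) =
        (gc B (FOb F x) (FOb G x) (FOb G y) (FHom G x y) (Idn V (?h x x)) \<cdot> (Idn V (VHom A x y) \<boxtimes> k)) \<cdot> Symm V W (VHom A x y)"
      using g[OF x y] symm_nat[OF p idn_in[OF hA[OF x y]]] hA[OF x y] hB[OF x x] p hom_obj(1)[OF p]
      by (simp add: r_def Hom_iff comp_assoc)
    also have "gc B (FOb F x) (FOb G x) (FOb G y) (FHom G x y) (Idn V (?h x x)) \<cdot> (Idn V (VHom A x y) \<boxtimes> k) =
        gc B (FOb F x) (FOb G x) (FOb G y) (FHom G x y) k"
      using gc_comp_right[OF B vfun_ob[OF F x] vfun_ob[OF G x] vfun_ob[OF G y] vfun_hom[OF G x y] idn_in[OF hB[OF x x]] p]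
        p by (simp add: Hom_iff)
    finally show ?thesis .
  qed
  have lp: "l x y \<cdot> (k \<boxtimes> Idn V (VHom A x y)) =
      gc B (FOb F x) (FOb F y) (FOb G y) k (FHom F x y)"
    if x: "x \<in> VOb A" and y: "y \<in> VOb A" and p: "k \<in> Hom V W (?h y y)" for W k x y
    using gc_comp_left[OF B vfun_ob[OF F x] vfun_ob[OF F y] vfun_ob[OF G y] idn_in[OF hB[OF y y]] vfun_hom[OF F x y] p]
      p by (simp add: l_def Hom_iff)
  have fam: "nat_family V A B F G W p \<longleftrightarrow> W \<in> Obj V \<and> (\<forall>x\<in>VOb A. p x \<in> Hom V W (?h x x)) \<and>
      (\<forall>x\<in>VOb A. \<forall>y\<in>VOb A. tr x y \<cdot> p x = tl x y \<cdot> p y)" for W p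
  proof -
    have "tr x y \<cdot> p x = tl x y \<cdot> p y \<longleftrightarrow>
      gc B (FOb F x) (FOb F y) (FOb G y) (p y) (FHom F x y) =
      gc B (FOb F x) (FOb G x) (FOb G y) (FHom G x y) (p x) \<cdot> Symm V W (VHom A x y)"
      if W: "W \<in> Obj V" and p: "\<forall>x\<in>VOb A. p x \<in> Hom V W (?h x x)" and x: "x \<in> VOb A" and y: "y \<in> VOb A" for x y
    proof -
      note px = bspec[OF p x] and py = bspec[OF p y]
      note e = transpose_comp[OF hA[OF x y] r[OF x y] px, folded tr_def]
        transpose_comp[OF hA[OF x y] l[OF x y] py, folded tl_def]
      note e' = e[unfolded rp[OF x y px] lp[OF x y py]]
      have lt: "l x y \<cdot> (p y \<boxtimes> Idn V (VHom A x y)) \<in> Hom V (W \<otimes> VHom A x y) (?h x y)"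
        using l[OF x y] py hA[OF x y] by (simp add: Hom_iff)
      note u = eval_universal[OF hA[OF x y] hB[OF x y] W lt, unfolded lp[OF x y py]]
      show ?thesis
        using u e' comp_in[OF px tr[OF x y]] comp_in[OF py tl[OF x y]] by metis
    qed
    then show ?thesis unfolding nat_family_iff[OF F G] by blast
  qed
  define Fo where "Fo = (\<lambda>(i :: nat, x, y). if i = 0 then ?h x x else IHom V (VHom A x y) (?h x y))"
  define Fa where "Fa = (\<lambda>(i :: nat, x, y). if i = 2 then tr x y else if i = 3 then tl x y else Idn V (Fo (i, x, y)))"
  have Fo_obj: "Fo d \<in> Obj V" if "d \<in> Obj ?D" for d
    using that hA hB by (auto simp: Fo_def end_shape_def)
  have Fa_in: "Fa u \<in> Hom V (Fo (Dom ?D u)) (Fo (Cod ?D u))" if "u \<in> Arr ?D" for u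
    using that tr tl hA hB by (auto simp: Fa_def Fo_def end_shape_def intro!: idn_in)
  have Fa_idn: "Fa u = Idn V (Fo u)" "Cod ?D u = u" "Dom ?D u = u" if "u \<in> Arr ?D" "fst u < 2" for u
    using that by (auto simp: Fa_def end_shape_def)
  have two: "fst (Cod ?D u) < 2" if "u \<in> Arr ?D" for u
    using that by (auto simp: end_shape_def)
  have "is_functor ?D V Fo Fa"
    unfolding is_functor_def
  proof (intro conjI ballI impI)
    fix d assume "d \<in> Obj ?D"
    then show "Fo d \<in> Obj V" by (rule Fo_obj)
    show "Fa (Idn ?D d) = Idn V (Fo d)"
      using \<open>d \<in> Obj ?D\<close> by (auto simp: Fa_def end_shape_def)
  next
    fix u assume u: "u \<in> Arr ?D"
    then show "Fa u \<in> Hom V (Fo (Dom ?D u)) (Fo (Cod ?D u))" by (rule Fa_in)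
    fix v assume v: "v \<in> Arr ?D" and uv: "Cod ?D u = Dom ?D v"
    show "Fa (v \<cdot>\<^bsub>?D\<^esub> u) = Fa v \<cdot> Fa u"
    proof (cases "fst v < 2")
      case True
      then show ?thesis
        using Fa_idn[OF v True] Fa_in[OF u] uv by (simp add: end_shape_def Hom_iff)
    next
      case False
      then have "fst u < 2" "Cod ?D u = u"
        using u v uv by (auto simp: end_shape_def split: if_splits)
      then show ?thesis
        using False Fa_idn[OF u] Fa_in[OF v] uv by (simp add: end_shape_def Hom_iff)
    qed
  qed
  from has_limits_small[OF lim end_shape_category end_shape_small[OF inf small] this]
  obtain L p where L: "is_limit ?D V Fo Fa L p" by blast
  have cone: "nat_family V A B F G W (\<lambda>x. q (0, x, x))" if q: "is_cone ?D V Fo Fa W q" for W q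
    unfolding fam
  proof (intro conjI ballI)
    show "W \<in> Obj V" using q unfolding is_cone_def by blast
    fix x assume x: "x \<in> VOb A"
    have "q (0, x, x) \<in> Hom V W (Fo (0, x, x))"
      using q x unfolding is_cone_def by (auto simp: end_shape_def)
    then show "q (0, x, x) \<in> Hom V W (?h x x)" by (simp add: Fo_def)
    fix y assume y: "y \<in> VOb A"
    have legs: "Fa u \<cdot> q (Dom ?D u) = q (Cod ?D u)" if "u \<in> Arr ?D" for u
      using q that unfolding is_cone_def by blast
    show "tr x y \<cdot> q (0, x, x) = tl x y \<cdot> q (0, y, y)"
      using legs[of "(2, x, y)"] legs[of "(3, x, y)"] x y by (simp add: end_shape_def Fa_def)
  qed
  \<comment> \<open>The leg at \<open>(1,x,y)\<close> is forced by the arrow \<open>(2,x,y)\<close>;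
    compatibility with \<open>(3,x,y)\<close> is the naturality of \<open>q\<close>.\<close>
  define e where "e q = (\<lambda>(i :: nat, x, y). if i = 0 then q x else tr x y \<cdot> q x)" for q :: "_ \<Rightarrow> 'a"
  have conv: "is_cone ?D V Fo Fa W (e q)" if q: "nat_family V A B F G W q" for W q
  proof -
    have W: "W \<in> Obj V" and q1: "\<And>x. x \<in> VOb A \<Longrightarrow> q x \<in> Hom V W (?h x x)"
      and q2: "\<And>x y. x \<in> VOb A \<Longrightarrow> y \<in> VOb A \<Longrightarrow> tr x y \<cdot> q x = tl x y \<cdot> q y"
      using q unfolding fam by blast+
    have h: "e q d \<in> Hom V W (Fo d)" if "d \<in> Obj ?D" for d
      using that comp_in[OF q1 tr] q1 by (auto simp: e_def Fo_def end_shape_def)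
    have "Fa u \<cdot> e q (Dom ?D u) = e q (Cod ?D u)" if u: "u \<in> Arr ?D" for u
    proof (cases "fst u < 2")
      case True
      then have "u \<in> Obj ?D" using u by (auto simp: end_shape_def)
      then show ?thesis using Fa_idn[OF u True] h[of u] by (simp add: Hom_iff)
    next
      case False
      then show ?thesis using u q2 by (auto simp: end_shape_def Fa_def e_def)
    qed
    then show ?thesis unfolding is_cone_def using W h by blast
  qed
  have pL: "is_cone ?D V Fo Fa L p" using L unfolding is_limit_def by blast
  have "is_nat_object V A B F G L (\<lambda>x. p (0, x, x))"
    unfolding is_nat_object_def
  proof (intro conjI allI impI)
    show "nat_family V A B F G L (\<lambda>x. p (0, x, x))" by (rule cone[OF pL])
    fix W q assume q: "nat_family V A B F G W q"
    have "(\<forall>d\<in>Obj ?D. p d \<cdot> h = e q d) \<longleftrightarrow> (\<forall>x\<in>VOb A. p (0, x, x) \<cdot> h = q x)"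
      if h: "h \<in> Hom V W L" for h
    proof
      assume "\<forall>d\<in>Obj ?D. p d \<cdot> h = e q d"
      then show "\<forall>x\<in>VOb A. p (0, x, x) \<cdot> h = q x" by (simp add: end_shape_def e_def)
    next
      assume a: "\<forall>x\<in>VOb A. p (0, x, x) \<cdot> h = q x"
      have "p (1, x, y) \<cdot> h = tr x y \<cdot> q x" if x: "x \<in> VOb A" and y: "y \<in> VOb A" for x y
      proof -
        have px: "p (0, x, x) \<in> Hom V L (Fo (0, x, x))"
          using pL x unfolding is_cone_def by (auto simp: end_shape_def)
        have "(2, x, y) \<in> Arr ?D" using x y by (simp add: end_shape_def)
        then have "Fa (2, x, y) \<cdot> p (Dom ?D (2, x, y)) = p (Cod ?D (2, x, y))"
          using pL unfolding is_cone_def by blast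
        then have "p (1, x, y) \<cdot> h = (tr x y \<cdot> p (0, x, x)) \<cdot> h"
          by (simp add: end_shape_def Fa_def)
        also have "\<dots> = tr x y \<cdot> q x"
          using tr[OF x y] px h a x by (simp add: Fo_def Hom_iff comp_assoc)
        finally show ?thesis .
      qed
      then show "\<forall>d\<in>Obj ?D. p d \<cdot> h = e q d"
        using a by (auto simp: end_shape_def e_def)
    qed
    moreover have "\<exists>!h. h \<in> Hom V W L \<and> (\<forall>d\<in>Obj ?D. p d \<cdot> h = e q d)"
      using L conv[OF q] unfolding is_limit_def by blast
    ultimately show "\<exists>!h. h \<in> Hom V W L \<and> (\<forall>x\<in>VOb A. p (0, x, x) \<cdot> h = q x)"
      by (metis (no_types, lifting))
  qed
  then show ?thesis by blast
qed

lemma nat_object: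
  assumes "has_limits TYPE('u) V" "infinite (UNIV :: 'u set)" "is_small TYPE('u) (VOb A)"
    "is_vfunctor V A B F" "is_vfunctor V A B G"
  shows "is_nat_object V A B F G (fst (nat_object V A B F G)) (snd (nat_object V A B F G))"
proof -
  have "\<exists>z. (\<lambda>(W, p). is_nat_object V A B F G W p) z"
    using nat_object_exists[OF assms] by auto
  from someI_ex[OF this] show ?thesis
    unfolding nat_object_def case_prod_unfold .
qed

section \<open>Precomposition, composites and identities of natural families\<close>

lemma nat_precomp:
  assumes F: "is_vfunctor V A B F" and G: "is_vfunctor V A B G"
    and p: "nat_family V A B F G Z p" and u: "u \<in> Hom V Z' Z"
  shows "nat_family V A B F G Z' (\<lambda>x. p x \<cdot> u)"
proof (rule nat_familyI[OF F G hom_obj(1)[OF u] comp_in[OF u nat_in[OF p]]])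
  note B = vfun_vcat(2)[OF F] and fo = vfun_ob[OF F] and go = vfun_ob[OF G]
  fix x y P a assume x: "x \<in> VOb A" and y: "y \<in> VOb A" and a: "a \<in> Hom V P (VHom A x y)"
  note Fa = comp_in[OF a vfun_hom[OF F x y]] and Ga = comp_in[OF a vfun_hom[OF G x y]]
  note px = nat_in[OF p x] and py = nat_in[OF p y]
  note [simp] = hom_obj[OF u] hom_obj(1)[OF a]
  have "gc B (FOb F x) (FOb F y) (FOb G y) (p y \<cdot> u) (FHom F x y \<cdot> a) =
      (gc B (FOb F x) (FOb G x) (FOb G y) (FHom G x y \<cdot> a) (p x) \<cdot> Symm V Z P) \<cdot> (u \<boxtimes> Idn V P)"
    by (simp add: gc_comp_left[OF B fo[OF x] fo[OF y] go[OF y] py Fa u] nat_gc[OF F G p x y a])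
  also have "\<dots> = (gc B (FOb F x) (FOb G x) (FOb G y) (FHom G x y \<cdot> a) (p x) \<cdot> (Idn V P \<boxtimes> u)) \<cdot> Symm V Z' P"
    using symm_nat[OF u idn_in[of P]] gc_in[OF B fo[OF x] go[OF x] go[OF y] Ga px] u
    by (simp add: Hom_iff comp_assoc)
  finally show "gc B (FOb F x) (FOb F y) (FOb G y) (p y \<cdot> u) (FHom F x y \<cdot> a) =
      gc B (FOb F x) (FOb G x) (FOb G y) (FHom G x y \<cdot> a) (p x \<cdot> u) \<cdot> Symm V Z' P"
    by (simp add: gc_comp_right[OF B fo[OF x] go[OF x] go[OF y] Ga px u])
qed

text \<open>Two naturality squares are pasted. The element \<open>a\<close> passes \<open>p\<close>
  and then \<open>q\<close>, and \<open>hexagon2\<close> assembles the two symmetries into the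
  single one past \<open>Q \<otimes> P\<close>.\<close>

lemma nat_compose:
  assumes F: "is_vfunctor V A B F" and G: "is_vfunctor V A B G" and H: "is_vfunctor V A B H"
    and q: "nat_family V A B G H Q q" and p: "nat_family V A B F G P p"
  shows "nat_family V A B F H (Q \<otimes> P) (\<lambda>x. gc B (FOb F x) (FOb G x) (FOb H x) (q x) (p x))"
proof (rule nat_familyI[OF F H])
  note B = vfun_vcat(2)[OF F] and fo = vfun_ob[OF F] and go = vfun_ob[OF G] and ho = vfun_ob[OF H]
  note Q [simp] = nat_obj[OF q] and P [simp] = nat_obj[OF p]
  show "Q \<otimes> P \<in> Obj V" by simp
  fix x assume x: "x \<in> VOb A"
  note px = nat_in[OF p x] and qx = nat_in[OF q x]
  note qpx = gc_in[OF B fo[OF x] go[OF x] ho[OF x] qx px]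
  show "gc B (FOb F x) (FOb G x) (FOb H x) (q x) (p x) \<in> Hom V (Q \<otimes> P) (VHom B (FOb F x) (FOb H x))"
    by (rule qpx)
  fix y U a assume y: "y \<in> VOb A" and a: "a \<in> Hom V U (VHom A x y)"
  note U [simp] = hom_obj(1)[OF a]
  note py = nat_in[OF p y] and qy = nat_in[OF q y]
  note Fa = comp_in[OF a vfun_hom[OF F x y]] and Ga = comp_in[OF a vfun_hom[OF G x y]]
    and Ha = comp_in[OF a vfun_hom[OF H x y]]
  have s: "Symm V x y \<in> Hom V (x \<otimes> y) (y \<otimes> x)" if "x \<in> Obj V" "y \<in> Obj V" for x y
    using that by (simp add: Hom_iff)
  note Gp = gc_in[OF B fo[OF x] go[OF x] go[OF y] Ga px]
  note Hq = gc_in[OF B go[OF x] ho[OF x] ho[OF y] Ha qx]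
  note qG = gc_in[OF B go[OF x] go[OF y] ho[OF y] qy Ga]
  note qGp = gc_in[OF B fo[OF x] go[OF y] ho[OF y] qy Gp] gc_in[OF B fo[OF x] go[OF x] ho[OF y] qG px]
    gc_in[OF B fo[OF x] go[OF x] ho[OF y] Hq px] gc_in[OF B fo[OF x] ho[OF x] ho[OF y] Ha qpx]
  have ia: "is_iso V (Assoc V Q U P)" by simp
  note ai = inverse_arrD[OF ia]
  have "gc B (FOb F x) (FOb F y) (FOb H y) (gc B (FOb F y) (FOb G y) (FOb H y) (q y) (p y)) (FHom F x y \<cdot> a) =
      gc B (FOb F x) (FOb G y) (FOb H y) (q y) (gc B (FOb F x) (FOb G x) (FOb G y) (FHom G x y \<cdot> a) (p x) \<cdot> Symm V P U) \<cdot>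
      Assoc V Q P U"
    by (simp add: gc_assoc[OF B fo[OF x] fo[OF y] go[OF y] ho[OF y] qy py Fa] nat_gc[OF F G p x y a])
  also have "\<dots> = gc B (FOb F x) (FOb G y) (FOb H y) (q y) (gc B (FOb F x) (FOb G x) (FOb G y) (FHom G x y \<cdot> a) (p x)) \<cdot>
      (Idn V Q \<boxtimes> Symm V P U) \<cdot> Assoc V Q P U"
    unfolding gc_comp_right[OF B fo[OF x] go[OF y] ho[OF y] qy Gp s[OF P U]]
    using qGp by (simp add: Hom_iff comp_assoc)
  \<comment> \<open>Associativity is used backwards here; the inverse associator that it leaves is
    the one occurring in \<open>hexagon2\<close>.\<close>
  also have "gc B (FOb F x) (FOb G y) (FOb H y) (q y) (gc B (FOb F x) (FOb G x) (FOb G y) (FHom G x y \<cdot> a) (p x)) =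
      gc B (FOb F x) (FOb G x) (FOb H y) (gc B (FOb G x) (FOb G y) (FOb H y) (q y) (FHom G x y \<cdot> a)) (p x) \<cdot>
        inverse_arr V (Assoc V Q U P)"
    unfolding gc_assoc[OF B fo[OF x] go[OF x] go[OF y] ho[OF y] qy Ga px]
    using qGp ai by (simp add: Hom_iff comp_assoc)
  also have "gc B (FOb G x) (FOb G y) (FOb H y) (q y) (FHom G x y \<cdot> a) =
      gc B (FOb G x) (FOb H x) (FOb H y) (FHom H x y \<cdot> a) (q x) \<cdot> Symm V Q U"
    by (rule nat_gc[OF G H q x y a])
  also have "gc B (FOb F x) (FOb G x) (FOb H y) (gc B (FOb G x) (FOb H x) (FOb H y) (FHom H x y \<cdot> a) (q x) \<cdot> Symm V Q U) (p x) =
      gc B (FOb F x) (FOb H x) (FOb H y) (FHom H x y \<cdot> a) (gc B (FOb F x) (FOb G x) (FOb H x) (q x) (p x)) \<cdot>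
        Assoc V U Q P \<cdot> (Symm V Q U \<boxtimes> Idn V P)"
    unfolding gc_comp_left[OF B fo[OF x] go[OF x] ho[OF y] Hq px s[OF Q U]]
      gc_assoc[OF B fo[OF x] go[OF x] ho[OF x] ho[OF y] Ha qx px]
    using qGp by (simp add: Hom_iff comp_assoc)
  finally show "gc B (FOb F x) (FOb F y) (FOb H y) (gc B (FOb F y) (FOb G y) (FOb H y) (q y) (p y)) (FHom F x y \<cdot> a) =
      gc B (FOb F x) (FOb H x) (FOb H y) (FHom H x y \<cdot> a) (gc B (FOb F x) (FOb G x) (FOb H x) (q x) (p x)) \<cdot>
        Symm V (Q \<otimes> P) U"
    unfolding hexagon2[OF Q P U] using qGp ai by (simp add: Hom_iff comp_assoc)
qed

lemma nat_id:
  assumes F: "is_vfunctor V A B F"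
  shows "nat_family V A B F F (TUnit V) (\<lambda>x. VId B (FOb F x))"
proof (rule nat_familyI[OF F F tunit])
  note B = vfun_vcat(2)[OF F] and fo = vfun_ob[OF F]
  fix x assume x: "x \<in> VOb A"
  show "VId B (FOb F x) \<in> Hom V (TUnit V) (VHom B (FOb F x) (FOb F x))"
    by (rule vcat_id[OF B fo[OF x] fo[OF x]])
  fix y P a assume y: "y \<in> VOb A" and a: "a \<in> Hom V P (VHom A x y)"
  note Fa = comp_in[OF a vfun_hom[OF F x y]]
  show "gc B (FOb F x) (FOb F y) (FOb F y) (VId B (FOb F y)) (FHom F x y \<cdot> a) =
      gc B (FOb F x) (FOb F x) (FOb F y) (FHom F x y \<cdot> a) (VId B (FOb F x)) \<cdot> Symm V (TUnit V) P"
    unfolding gc_id_left[OF B fo[OF x] fo[OF y] Fa] gc_id_right[OF B fo[OF x] fo[OF y] Fa]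
    using Fa hom_obj(1)[OF a] by (simp add: Hom_iff comp_assoc runit_symm)
qed

lemma nat_objectD:
  assumes "is_nat_object V A B F G W p"
  shows nat_object_family: "nat_family V A B F G W p"
    and nat_object_universal: "nat_family V A B F G Z q \<Longrightarrow>
      \<exists>!h. h \<in> Hom V Z W \<and> (\<forall>x\<in>VOb A. p x \<cdot> h = q x)"
  using assms unfolding is_nat_object_def by blast+

lemma nat_object_ext:
  assumes F: "is_vfunctor V A B F" and G: "is_vfunctor V A B G" and W: "is_nat_object V A B F G W p"
    and h: "h \<in> Hom V Z W" and k: "k \<in> Hom V Z W" and eq: "\<And>x. x \<in> VOb A \<Longrightarrow> p x \<cdot> h = p x \<cdot> k"
  shows "h = k"
  using nat_object_universal[OF W nat_precomp[OF F G nat_object_family[OF W] k]] h k eq by blast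

end

section \<open>Full subcategories and reflection of functoriality along base change\<close>

lemma (in smcc) full_sub_vcat: "is_vcat V A \<Longrightarrow> S \<subseteq> VOb A \<Longrightarrow> is_vcat V (full_sub A S)"
  unfolding is_vcat_def full_sub_def by (simp add: subset_iff)

lemma full_sub_simps [simp]: "VOb (full_sub A S) = S" "VHom (full_sub A S) = VHom A"
    "VComp (full_sub A S) = VComp A" "VId (full_sub A S) = VId A"
  by (simp_all add: full_sub_def)

lemma (in smcc) gc_full_sub [simp]: "gc (full_sub A S) = gc A"
  by (simp add: gc_def fun_eq_iff)

text \<open>\<open>M\<close> is faithful and \<open>Eps\<close> and \<open>Mu\<close> are
  invertible, so the functor axioms over \<open>V\<close> may be verified after base change, where
  projections from ends are available.\<close>

lemma (in embedding) functor_reflect: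
  assumes A: "is_vcat V A" and B: "is_vcat V B" and eq: "F = restrict_vfun A (FOb F) (FHom F)"
    and o: "\<And>x. x \<in> VOb A \<Longrightarrow> FOb F x \<in> VOb B"
    and h: "\<And>x y. x \<in> VOb A \<Longrightarrow> y \<in> VOb A \<Longrightarrow>
      FHom F x y \<in> Hom V (VHom A x y) (VHom B (FOb F x) (FOb F y))"
    and i: "\<And>x. x \<in> VOb A \<Longrightarrow> MArr M (FHom F x x) \<cdot> VId (base A) x = VId (base B) (FOb F x)"
    and c: "\<And>x y z. \<lbrakk>x \<in> VOb A; y \<in> VOb A; z \<in> VOb A\<rbrakk> \<Longrightarrow>
      MArr M (FHom F x z) \<cdot> VComp (base A) x y z =
      W.gc (base B) (FOb F x) (FOb F y) (FOb F z) (MArr M (FHom F y z)) (MArr M (FHom F x y))"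
  shows "is_vfunctor V A B F"
  unfolding is_vfunctor_def
proof (intro conjI ballI A B eq o h)
  fix x assume x: "x \<in> VOb A"
  have l: "FHom F x x \<cdot>\<^bsub>V\<^esub> VId A x \<in> Hom V (TUnit V) (VHom B (FOb F x) (FOb F x))"
    by (rule V.comp_in[OF V.vcat_id[OF A x x] h[OF x x]])
  have r: "VId B (FOb F x) \<in> Hom V (TUnit V) (VHom B (FOb F x) (FOb F x))"
    by (rule V.vcat_id[OF B o[OF x] o[OF x]])
  show "FHom F x x \<cdot>\<^bsub>V\<^esub> VId A x = VId B (FOb F x)"
  proof (rule M_faithful[OF l r], rule W.iso_epi[of "Eps M"])
    show "MArr M (FHom F x x \<cdot>\<^bsub>V\<^esub> VId A x) \<cdot> Eps M = MArr M (VId B (FOb F x)) \<cdot> Eps M"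
      using i[OF x] h[OF x x] V.vcat_id[OF A x x]
      by (simp add: base_cat_def M_comp Hom_iff W.comp_assoc)
  qed (use l r in \<open>auto simp: Hom_iff\<close>)
next
  fix x y z assume x: "x \<in> VOb A" and y: "y \<in> VOb A" and z: "z \<in> VOb A"
  note [simp] = V.vcat_hom[OF A y z] V.vcat_hom[OF A x y]
  note cA = V.vcat_comp[OF A x y z] and cB = V.vcat_comp[OF B o[OF x] o[OF y] o[OF z]]
  have l: "FHom F x z \<cdot>\<^bsub>V\<^esub> VComp A x y z \<in> Hom V (VHom A y z \<otimes>\<^bsub>V\<^esub> VHom A x y) (VHom B (FOb F x) (FOb F z))"
    by (rule V.comp_in[OF cA h[OF x z]])
  have r: "VComp B (FOb F x) (FOb F y) (FOb F z) \<cdot>\<^bsub>V\<^esub> (FHom F y z \<boxtimes>\<^bsub>V\<^esub> FHom F x y) \<in>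
      Hom V (VHom A y z \<otimes>\<^bsub>V\<^esub> VHom A x y) (VHom B (FOb F x) (FOb F z))"
    by (rule V.comp_in[OF V.tens_in[OF h[OF y z] h[OF x y]] cB])
  show "FHom F x z \<cdot>\<^bsub>V\<^esub> VComp A x y z =
      VComp B (FOb F x) (FOb F y) (FOb F z) \<cdot>\<^bsub>V\<^esub> (FHom F y z \<boxtimes>\<^bsub>V\<^esub> FHom F x y)"
  proof (rule M_faithful[OF l r], rule W.iso_epi[of "Mu M (VHom A y z) (VHom A x y)"])
    show "MArr M (FHom F x z \<cdot>\<^bsub>V\<^esub> VComp A x y z) \<cdot> Mu M (VHom A y z) (VHom A x y) =
      MArr M (VComp B (FOb F x) (FOb F y) (FOb F z) \<cdot>\<^bsub>V\<^esub> (FHom F y z \<boxtimes>\<^bsub>V\<^esub> FHom F x y)) \<cdot>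
        Mu M (VHom A y z) (VHom A x y)"
      using c[OF x y z] base_gc[OF B o[OF x] o[OF y] o[OF z] h[OF y z] h[OF x y]] cA h[OF x z]
      by (simp add: base_cat_def M_comp Hom_iff W.comp_assoc V.gc_def)
  qed (use l r in \<open>auto simp: Hom_iff\<close>)
qed

text \<open>The hom-objects are chosen by \<open>SOME\<close>, so nothing can be said about them
  before an end is known to exist; \<open>ends_exist\<close> records that the choice
  succeeds.\<close>

locale functor_category = embedding V W M
  for V :: "('o, 'a) smcc" and W :: "('p, 'b) smcc" (structure) and M +
  fixes A :: "('o, 'a, 'c) vcat" and B :: "('o, 'a, 'd) vcat"
  assumes ends_exist: "\<lbrakk>is_vfunctor V A B F; is_vfunctor V A B G\<rbrakk> \<Longrightarrow>
    is_nat_object W (base_cat W M A) (base_cat W M B) (base_fun M A F) (base_fun M A G)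
      (fun_hom W M A B F G) (fun_proj W M A B F G)"
begin

abbreviation K where "K \<equiv> fun_cat V W M A B"
abbreviation hom where "hom \<equiv> fun_hom W M A B"
abbreviation \<pi> where "\<pi> \<equiv> fun_proj W M A B"

lemma fun_cat_simps [simp]: "VOb K = {F. is_vfunctor V A B F}" "VHom K = hom"
  by (simp_all add: fun_cat_def)

lemma proj_family:
  assumes "is_vfunctor V A B F" "is_vfunctor V A B G"
  shows "nat_family W (base A) (base B) (base_fun M A F) (base_fun M A G) (hom F G) (\<pi> F G)"
  by (rule W.nat_object_family[OF ends_exist[OF assms]])

lemma hom_obj: "is_vfunctor V A B F \<Longrightarrow> is_vfunctor V A B G \<Longrightarrow> hom F G \<in> Obj W"
  by (rule W.nat_obj[OF proj_family])

lemma proj_in: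
  assumes "is_vfunctor V A B F" "is_vfunctor V A B G" "x \<in> VOb A"
  shows "\<pi> F G x \<in> Hom W (hom F G) (MOb M (VHom B (FOb F x) (FOb G x)))"
  using W.nat_in[OF proj_family[OF assms(1,2)], of x] assms(3) by simp

lemma proj_ext:
  assumes "is_vfunctor V A B F" "is_vfunctor V A B G" "h \<in> Hom W Z (hom F G)" "k \<in> Hom W Z (hom F G)"
    "\<And>x. x \<in> VOb A \<Longrightarrow> \<pi> F G x \<cdot> h = \<pi> F G x \<cdot> k"
  shows "h = k"
  by (rule W.nat_object_ext[OF base_functor[OF assms(1)] base_functor[OF assms(2)]
    ends_exist[OF assms(1,2)] assms(3,4)]) (simp add: assms(5))

lemma proj_lift:
  assumes "is_vfunctor V A B F" "is_vfunctor V A B G"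
    "nat_family W (base A) (base B) (base_fun M A F) (base_fun M A G) Z q"
  shows "\<exists>!h. h \<in> Hom W Z (hom F G) \<and> (\<forall>x\<in>VOb A. \<pi> F G x \<cdot> h = q x)"
  using W.nat_object_universal[OF ends_exist[OF assms(1,2)] assms(3)] by simp

text \<open>Composites of natural families are natural, so the universal property of the end makes
  the definite description of composition denote.\<close>

lemma fun_comp:
  assumes F: "is_vfunctor V A B F" and G: "is_vfunctor V A B G" and H: "is_vfunctor V A B H"
  shows "VComp K F G H \<in> Hom W (hom G H \<otimes> hom F G) (hom F H)"
    "x \<in> VOb A \<Longrightarrow> \<pi> F H x \<cdot> VComp K F G H =
      W.gc (base B) (FOb F x) (FOb G x) (FOb H x) (\<pi> G H x) (\<pi> F G x)"
proof -
  have "nat_family W (base A) (base B) (base_fun M A F) (base_fun M A H) (hom G H \<otimes> hom F G)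
      (\<lambda>x. W.gc (base B) (FOb F x) (FOb G x) (FOb H x) (\<pi> G H x) (\<pi> F G x))"
    using W.nat_compose[OF base_functor[OF F] base_functor[OF G] base_functor[OF H]
      proj_family[OF G H] proj_family[OF F G]] by simp
  from theI'[OF proj_lift[OF F H this]]
  show "VComp K F G H \<in> Hom W (hom G H \<otimes> hom F G) (hom F H)"
    "x \<in> VOb A \<Longrightarrow> \<pi> F H x \<cdot> VComp K F G H =
      W.gc (base B) (FOb F x) (FOb G x) (FOb H x) (\<pi> G H x) (\<pi> F G x)"
    by (simp_all add: fun_cat_def W.gc_def)
qed

lemma fun_id:
  assumes F: "is_vfunctor V A B F"
  shows "VId K F \<in> Hom W (TUnit W) (hom F F)"
    "x \<in> VOb A \<Longrightarrow> \<pi> F F x \<cdot> VId K F = VId (base B) (FOb F x)"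
  using theI'[OF proj_lift[OF F F W.nat_id[OF base_functor[OF F]]]] by (simp_all add: fun_cat_def)

lemma gc_fun_in:
  assumes F: "is_vfunctor V A B F" and G: "is_vfunctor V A B G" and H: "is_vfunctor V A B H"
    and b: "b \<in> Hom W Q (hom G H)" and a: "a \<in> Hom W P (hom F G)"
  shows "W.gc K F G H b a \<in> Hom W (Q \<otimes> P) (hom F H)"
  unfolding W.gc_def by (rule W.comp_in[OF W.tens_in[OF b a] fun_comp(1)[OF F G H]])

lemma proj_gc:
  assumes F: "is_vfunctor V A B F" and G: "is_vfunctor V A B G" and H: "is_vfunctor V A B H"
    and b: "b \<in> Hom W Q (hom G H)" and a: "a \<in> Hom W P (hom F G)" and x: "x \<in> VOb A"
  shows "\<pi> F H x \<cdot> W.gc K F G H b a =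
    W.gc (base B) (FOb F x) (FOb G x) (FOb H x) (\<pi> G H x \<cdot> b) (\<pi> F G x \<cdot> a)"
proof -
  note B = base_vcat[OF V.vfun_vcat(2)[OF F]]
  have o: "FOb F x \<in> VOb (base B)" "FOb G x \<in> VOb (base B)" "FOb H x \<in> VOb (base B)"
    using V.vfun_ob[OF F x] V.vfun_ob[OF G x] V.vfun_ob[OF H x] by simp_all
  have p: "\<pi> G H x \<in> Hom W (hom G H) (VHom (base B) (FOb G x) (FOb H x))"
    "\<pi> F G x \<in> Hom W (hom F G) (VHom (base B) (FOb F x) (FOb G x))"
    using proj_in[OF G H x] proj_in[OF F G x] by simp_all
  have "\<pi> F H x \<cdot> W.gc K F G H b a = (\<pi> F H x \<cdot> VComp K F G H) \<cdot> (b \<boxtimes> a)"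
    using fun_comp(1)[OF F G H] proj_in[OF F H x] a b by (simp add: W.gc_def Hom_iff W.comp_assoc)
  then show ?thesis
    unfolding fun_comp(2)[OF F G H x] by (simp add: W.gc_comp[OF B o p b a])
qed

text \<open>The projections are jointly monic (\<open>proj_ext\<close>) and carry composition to
  composition in \<open>base B\<close>, so every law is inherited componentwise.\<close>

lemma fun_cat_vcat: "is_vcat W K"
proof (rule W.is_vcatI, unfold fun_cat_simps mem_Collect_eq)
  fix E F G H P Q R a b c
  assume E: "is_vfunctor V A B E" and F: "is_vfunctor V A B F" and G: "is_vfunctor V A B G"
    and H: "is_vfunctor V A B H"
    and a: "a \<in> Hom W P (hom G H)" and b: "b \<in> Hom W Q (hom F G)" and c: "c \<in> Hom W R (hom E F)"
  note B = base_vcat[OF V.vfun_vcat(2)[OF E]]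
  note [simp] = W.hom_obj(1)[OF a] W.hom_obj(1)[OF b] W.hom_obj(1)[OF c]
  note bc = gc_fun_in[OF E F G b c] and ab = gc_fun_in[OF F G H a b]
  note abc = gc_fun_in[OF E G H a bc]
  have as: "Assoc W P Q R \<in> Hom W ((P \<otimes> Q) \<otimes> R) (P \<otimes> (Q \<otimes> R))"
    by (simp add: Hom_iff)
  show "W.gc K E F H (W.gc K F G H a b) c = W.gc K E G H a (W.gc K E F G b c) \<cdot> Assoc W P Q R"
  proof (rule proj_ext[OF E H gc_fun_in[OF E F H ab c] W.comp_in[OF as abc]])
    fix x assume x: "x \<in> VOb A"
    have o: "FOb E x \<in> VOb (base B)" "FOb F x \<in> VOb (base B)" "FOb G x \<in> VOb (base B)" "FOb H x \<in> VOb (base B)"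
      using V.vfun_ob[OF E x] V.vfun_ob[OF F x] V.vfun_ob[OF G x] V.vfun_ob[OF H x] by simp_all
    have p: "\<pi> G H x \<cdot> a \<in> Hom W P (VHom (base B) (FOb G x) (FOb H x))"
      "\<pi> F G x \<cdot> b \<in> Hom W Q (VHom (base B) (FOb F x) (FOb G x))"
      "\<pi> E F x \<cdot> c \<in> Hom W R (VHom (base B) (FOb E x) (FOb F x))"
      using W.comp_in[OF a proj_in[OF G H x]] W.comp_in[OF b proj_in[OF F G x]]
        W.comp_in[OF c proj_in[OF E F x]] by simp_all
    have "\<pi> E H x \<cdot> W.gc K E G H a (W.gc K E F G b c) \<cdot> Assoc W P Q R =
        (\<pi> E H x \<cdot> W.gc K E G H a (W.gc K E F G b c)) \<cdot> Assoc W P Q R"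
      using abc proj_in[OF E H x] by (simp add: Hom_iff W.comp_assoc)
    then show "\<pi> E H x \<cdot> W.gc K E F H (W.gc K F G H a b) c =
        \<pi> E H x \<cdot> W.gc K E G H a (W.gc K E F G b c) \<cdot> Assoc W P Q R"
      by (simp add: proj_gc[OF E F H ab c x] proj_gc[OF F G H a b x] proj_gc[OF E G H a bc x]
        proj_gc[OF E F G b c x] W.gc_assoc[OF B o p])
  qed
next
  fix F G P f assume F: "is_vfunctor V A B F" and G: "is_vfunctor V A B G" and f: "f \<in> Hom W P (hom F G)"
  note B = base_vcat[OF V.vfun_vcat(2)[OF F]]
  have lr: "LUnit W P \<in> Hom W (TUnit W \<otimes> P) P" "RUnit W P \<in> Hom W (P \<otimes> TUnit W) P"
    using W.hom_obj(1)[OF f] by (simp_all add: Hom_iff)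
  have o: "FOb F x \<in> VOb (base B)" "FOb G x \<in> VOb (base B)"
    and p: "\<pi> F G x \<cdot> f \<in> Hom W P (VHom (base B) (FOb F x) (FOb G x))" if x: "x \<in> VOb A" for x
    using V.vfun_ob[OF F x] V.vfun_ob[OF G x] W.comp_in[OF f proj_in[OF F G x]] by simp_all
  show "W.gc K F G G (VId K G) f = f \<cdot> LUnit W P"
  proof (rule proj_ext[OF F G gc_fun_in[OF F G G fun_id(1)[OF G] f] W.comp_in[OF lr(1) f]])
    fix x assume x: "x \<in> VOb A"
    show "\<pi> F G x \<cdot> W.gc K F G G (VId K G) f = \<pi> F G x \<cdot> f \<cdot> LUnit W P"
      using proj_gc[OF F G G fun_id(1)[OF G] f x] W.gc_id_left[OF B o[OF x] p[OF x]]
        fun_id(2)[OF G x] f lr proj_in[OF F G x] by (simp add: Hom_iff W.comp_assoc)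
  qed
  show "W.gc K F F G f (VId K F) = f \<cdot> RUnit W P"
  proof (rule proj_ext[OF F G gc_fun_in[OF F F G f fun_id(1)[OF F]] W.comp_in[OF lr(2) f]])
    fix x assume x: "x \<in> VOb A"
    show "\<pi> F G x \<cdot> W.gc K F F G f (VId K F) = \<pi> F G x \<cdot> f \<cdot> RUnit W P"
      using proj_gc[OF F F G f fun_id(1)[OF F] x] W.gc_id_right[OF B o[OF x] p[OF x]]
        fun_id(2)[OF F x] f lr proj_in[OF F G x] by (simp add: Hom_iff W.comp_assoc)
  qed
qed (use hom_obj fun_comp(1) fun_id(1) in auto)

end

lemma (in embedding) functor_categoryI:
  assumes "has_limits TYPE('u) W" "infinite (UNIV :: 'u set)" "is_small TYPE('u) (VOb A)"
  shows "functor_category V W M A B"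
proof unfold_locales
  fix F G assume F: "is_vfunctor V A B F" and G: "is_vfunctor V A B G"
  show "is_nat_object W (base A) (base B) (base_fun M A F) (base_fun M A G)
      (fun_hom W M A B F G) (fun_proj W M A B F G)"
    unfolding fun_hom_def fun_proj_def
    by (rule W.nat_object[OF assms(1,2) _ base_functor[OF F] base_functor[OF G]]) (simp add: assms(3))
qed

section \<open>Algebras\<close>

text \<open>Three functor categories meet: \<open>TC\<close> contains the algebras in
  \<open>C\<close>, \<open>TV\<close> contains the algebras that \<open>TA\<close> presents through
  \<open>\<phi>\<close>, and \<open>CT\<close> is the target of the Yoneda functor.\<close>

locale algebra_yoneda = embedding V W M +
  TC: functor_category V W M T C + TV: functor_category V W M T "vself V" +
  CT: functor_category V W M "vop V C" TA
  for V :: "('o, 'a) smcc" and W :: "('p, 'b) smcc" (structure) and M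
    and T :: "('o, 'a, 'o) vcat" and C :: "('o, 'a, 'c) vcat"
    and TA :: "('o, 'a, ('a, 'o, 'o) vfun) vcat" +
  fixes J :: "'o set" and \<phi> :: "('b, ('a, 'o, 'o) vfun, ('a, 'o, 'o) vfun) vfun"
  assumes J: "J \<subseteq> Obj V" and C: "is_vcat V C"
    and TA: "alg_exists_as V W M J T TA \<phi>"
begin

abbreviation S where "S \<equiv> base (vself V)"
abbreviation L where "L c x y \<equiv> MArr M (FHom (hom_from V C c) x y)"
abbreviation R where "R x c d \<equiv> MArr M (FHom (hom_to V C x) c d)"
abbreviation br where "br c E \<equiv> bracket_ob V T C c E"
abbreviation pr where "pr \<equiv> alg_proj V W M T \<phi>"
abbreviation bl where "bl \<equiv> bracket_left V W M T C TA \<phi>"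
abbreviation algs where "algs \<equiv> algebras V J T C"

sublocale bm: bimodule W S "MOb M" bev "base C" "VHom C" L R
  by (rule base_bimodule[OF C])

section \<open>Hom-objects of \<open>TA\<close> through evaluation at the objects of
  \<open>T\<close>\<close>

lemma TA_vcat: "is_vcat V TA" and TA_ob: "VOb TA = algebras V J T (vself V)"
  and phi: "is_vfunctor W (base TA) (Alg V W M J T (vself V)) \<phi>"
  and phi_ob: "E \<in> VOb TA \<Longrightarrow> FOb \<phi> E = E"
  and phi_iso: "\<lbrakk>E \<in> VOb TA; F \<in> VOb TA\<rbrakk> \<Longrightarrow> is_iso W (FHom \<phi> E F)"
  using TA unfolding alg_exists_as_def vfully_faithful_def by auto

lemma Alg_simps [simp]: "VOb (Alg V W M J T D) = algebras V J T D"
    "VHom (Alg V W M J T D) = fun_hom W M T D" "VId (Alg V W M J T D) = VId (fun_cat V W M T D)"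
    "W.gc (Alg V W M J T D) = W.gc (fun_cat V W M T D)"
  by (simp_all add: Alg_def fun_cat_def)

lemma TA_functor: "E \<in> VOb TA \<Longrightarrow> is_vfunctor V T (vself V) E"
  by (simp add: TA_ob algebras_def)

lemma phi_in: "\<lbrakk>E \<in> VOb TA; F \<in> VOb TA\<rbrakk> \<Longrightarrow> FHom \<phi> E F \<in> Hom W (MOb M (VHom TA E F)) (TV.hom E F)"
  using W.vfun_hom[OF phi, of E F] by (simp add: phi_ob)

lemma pr_in:
  assumes "E \<in> VOb TA" "F \<in> VOb TA" "t \<in> VOb T"
  shows "pr E F t \<in> Hom W (MOb M (VHom TA E F)) (MOb M (IHom V (FOb E t) (FOb F t)))"
  using W.comp_in[OF phi_in[OF assms(1,2)] TV.proj_in[OF TA_functor TA_functor, OF assms]]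
  by (simp add: alg_proj_def)

lemma pr_comp:
  assumes "E \<in> VOb TA" "F \<in> VOb TA" "t \<in> VOb T" "h \<in> Hom W Z (MOb M (VHom TA E F))"
  shows "pr E F t \<cdot> h = TV.\<pi> E F t \<cdot> FHom \<phi> E F \<cdot> h"
  using phi_in[OF assms(1,2)] TV.proj_in[OF TA_functor TA_functor, OF assms(1-3)] assms(4)
  by (simp add: alg_proj_def Hom_iff W.comp_assoc)

text \<open>\<open>\<phi>\<close> is invertible on hom-objects, so those of \<open>TA\<close>
  inherit the universal property of the ends in \<open>TV\<close>, with projections
  \<open>pr\<close>. This is the uniqueness half, \<open>pr_lift\<close> the existence half.\<close>

lemma pr_ext:
  assumes E: "E \<in> VOb TA" and F: "F \<in> VOb TA"
    and h: "h \<in> Hom W Z (MOb M (VHom TA E F))" and k: "k \<in> Hom W Z (MOb M (VHom TA E F))"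
    and eq: "\<And>t. t \<in> VOb T \<Longrightarrow> pr E F t \<cdot> h = pr E F t \<cdot> k"
  shows "h = k"
proof (rule W.iso_mono[OF phi_iso[OF E F]])
  show "FHom \<phi> E F \<cdot> h = FHom \<phi> E F \<cdot> k"
    by (rule TV.proj_ext[OF TA_functor[OF E] TA_functor[OF F] W.comp_in[OF h phi_in[OF E F]]
      W.comp_in[OF k phi_in[OF E F]]]) (simp add: eq flip: pr_comp[OF E F _ h] pr_comp[OF E F _ k])
qed (use h k phi_in[OF E F] in \<open>auto simp: Hom_iff\<close>)

lemma pr_lift:
  assumes E: "E \<in> VOb TA" and F: "F \<in> VOb TA"
    and q: "nat_family W (base T) S (base_fun M T E) (base_fun M T F) Z q"
  shows "\<exists>h. h \<in> Hom W Z (MOb M (VHom TA E F)) \<and> (\<forall>t\<in>VOb T. pr E F t \<cdot> h = q t)"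
proof -
  obtain k where k: "k \<in> Hom W Z (TV.hom E F)" and kq: "\<And>t. t \<in> VOb T \<Longrightarrow> TV.\<pi> E F t \<cdot> k = q t"
    using TV.proj_lift[OF TA_functor[OF E] TA_functor[OF F] q] by blast
  note i = W.inverse_arrD[OF phi_iso[OF E F]] and f = phi_in[OF E F]
  let ?h = "inverse_arr W (FHom \<phi> E F) \<cdot> k"
  have h: "?h \<in> Hom W Z (MOb M (VHom TA E F))" and "FHom \<phi> E F \<cdot> ?h = k"
    using i f k by (simp_all add: Hom_iff flip: W.comp_assoc)
  then have "\<forall>t\<in>VOb T. pr E F t \<cdot> ?h = q t" using kq pr_comp[OF E F _ h] by simp
  with h show ?thesis by blast
qed

lemma pr_family:
  assumes E: "E \<in> VOb TA" and F: "F \<in> VOb TA" and h: "h \<in> Hom W Z (MOb M (VHom TA E F))"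
  shows "nat_family W (base T) S (base_fun M T E) (base_fun M T F) Z (\<lambda>t. pr E F t \<cdot> h)"
proof -
  note E' = TA_functor[OF E] and F' = TA_functor[OF F]
  have "nat_family W (base T) S (base_fun M T E) (base_fun M T F) Z
      (\<lambda>t. TV.\<pi> E F t \<cdot> (FHom \<phi> E F \<cdot> h))"
    by (rule W.nat_precomp[OF base_functor[OF E'] base_functor[OF F'] TV.proj_family[OF E' F']
      W.comp_in[OF h phi_in[OF E F]]])
  then show ?thesis unfolding nat_family_def by (simp add: pr_comp[OF E F _ h])
qed

lemma TA_base: "is_vcat W (base TA)"
  by (rule base_vcat[OF TA_vcat])

text \<open>Evaluation at \<open>t\<close> respects composition because both \<open>\<phi>\<close>
  and the projections of \<open>TV\<close> do.\<close>

lemma pr_gc: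
  assumes E: "E \<in> VOb TA" and F: "F \<in> VOb TA" and G: "G \<in> VOb TA" and t: "t \<in> VOb T"
    and b: "b \<in> Hom W Q (MOb M (VHom TA F G))" and a: "a \<in> Hom W P (MOb M (VHom TA E F))"
  shows "pr E G t \<cdot> W.gc (base TA) E F G b a =
    W.gc S (FOb E t) (FOb F t) (FOb G t) (pr F G t \<cdot> b) (pr E F t \<cdot> a)"
proof -
  have o: "E \<in> VOb (base TA)" "F \<in> VOb (base TA)" "G \<in> VOb (base TA)" using E F G by simp_all
  have b': "b \<in> Hom W Q (VHom (base TA) F G)" and a': "a \<in> Hom W P (VHom (base TA) E F)"
    using a b by simp_all
  have ba: "W.gc (base TA) E F G b a \<in> Hom W (Q \<otimes> P) (MOb M (VHom TA E G))"
    using W.gc_in[OF TA_base o b' a'] by simp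
  have "FHom \<phi> E G \<cdot> W.gc (base TA) E F G b a = W.gc TV.K E F G (FHom \<phi> F G \<cdot> b) (FHom \<phi> E F \<cdot> a)"
    using W.vfun_gc[OF phi o b' a'] E F G by (simp add: phi_ob)
  then show ?thesis
    using pr_comp[OF E G t ba] pr_comp[OF F G t b] pr_comp[OF E F t a]
      TV.proj_gc[OF TA_functor[OF E] TA_functor[OF F] TA_functor[OF G]
        W.comp_in[OF b phi_in[OF F G]] W.comp_in[OF a phi_in[OF E F]] t] by simp
qed

lemma pr_id:
  assumes E: "E \<in> VOb TA" and t: "t \<in> VOb T"
  shows "pr E E t \<cdot> VId (base TA) E = VId S (FOb E t)"
proof -
  have i: "VId (base TA) E \<in> Hom W (TUnit W) (MOb M (VHom TA E E))"
    using W.vcat_id[OF TA_base, of E E] E by simp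
  have "FHom \<phi> E E \<cdot> VId (base TA) E = VId TV.K E"
    using W.vfun_id[OF phi, of E] E by (simp add: phi_ob)
  then show ?thesis
    using pr_comp[OF E E t i] TV.fun_id(2)[OF TA_functor[OF E] t] by simp
qed

section \<open>The algebras \<open>C(c, E -)\<close> and their dependence on
  \<open>c\<close>\<close>

lemma alg_functor: "E \<in> algs \<Longrightarrow> is_vfunctor V T C E"
  by (simp add: algebras_def)

lemma br_TA: "E \<in> algs \<Longrightarrow> c \<in> VOb C \<Longrightarrow> br c E \<in> VOb TA"
  unfolding TA_ob by (rule V.bracket_ob_algebra[OF C _ J])

lemma br_ob [simp]: "E \<in> algs \<Longrightarrow> t \<in> VOb T \<Longrightarrow> FOb (br c E) t = VHom C c (FOb E t)"
  using V.vfun_ob[OF alg_functor] by (simp add: bracket_ob_def)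

lemma br_hom:
  assumes E: "E \<in> algs" and c: "c \<in> VOb C" and t: "t \<in> VOb T" and s: "s \<in> VOb T"
    and a: "a \<in> Hom W P (MOb M (VHom T t s))"
  shows "FHom (base_fun M T (br c E)) t s \<cdot> a =
    L c (FOb E t) (FOb E s) \<cdot> (MArr M (FHom E t s) \<cdot> a)"
proof -
  note o = V.vfun_ob[OF alg_functor[OF E]] and h = V.vfun_hom[OF alg_functor[OF E] t s]
  show ?thesis
    using V.vfun_hom[OF V.hom_from_functor[OF C c] o[OF t] o[OF s]] h a t s
    by (simp add: bracket_ob_def Hom_iff M_comp W.comp_assoc)
qed

lemma E_arr:
  assumes "E \<in> algs" "t \<in> VOb T" "s \<in> VOb T" "a \<in> Hom W P (MOb M (VHom T t s))"
  shows "MArr M (FHom E t s) \<cdot> a \<in> Hom W P (VHom (base C) (FOb E t) (FOb E s))"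
  using W.comp_in[OF assms(4) M_in[OF V.vfun_hom[OF alg_functor[OF assms(1)] assms(2,3)]]] by simp

lemma E_ob: "E \<in> algs \<Longrightarrow> t \<in> VOb T \<Longrightarrow> FOb E t \<in> VOb (base C)"
  using V.vfun_ob[OF alg_functor] by simp

text \<open>Naturality in \<open>t\<close> says that pre-composition in \<open>C\<close> commutes
  with post-composition by the action of \<open>E\<close>, which is
  \<open>R_L_commute\<close>.\<close>

lemma R_family:
  assumes E: "E \<in> algs" and c: "c \<in> VOb C" and d: "d \<in> VOb C"
  shows "nat_family W (base T) S (base_fun M T (br c E)) (base_fun M T (br d E))
    (MOb M (VHom C d c)) (\<lambda>t. R (FOb E t) c d)"
proof (rule W.nat_familyI[OF base_functor base_functor])
  have cd: "c \<in> VOb (base C)" "d \<in> VOb (base C)" using c d by simp_all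
  note u = W.vcat_hom[OF bm.A cd(2,1)]
  show "is_vfunctor V T (vself V) (br c E)" "is_vfunctor V T (vself V) (br d E)"
    using TA_functor br_TA[OF E] c d by blast+
  show "MOb M (VHom C d c) \<in> Obj W" using u by simp
  fix t assume "t \<in> VOb (base T)"
  then have t: "t \<in> VOb T" by simp
  note Ri = bm.R_in[OF E_ob[OF E t] cd]
  show "R (FOb E t) c d \<in> Hom W (MOb M (VHom C d c))
      (VHom S (FOb (base_fun M T (br c E)) t) (FOb (base_fun M T (br d E)) t))"
    using Ri E t by simp
  fix s P a assume "s \<in> VOb (base T)" and a: "a \<in> Hom W P (VHom (base T) t s)"
  then have s: "s \<in> VOb T" and a': "a \<in> Hom W P (MOb M (VHom T t s))" by simp_all
  note Ri' = bm.R_in[OF E_ob[OF E s] cd]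
  show "W.gc S (FOb (base_fun M T (br c E)) t) (FOb (base_fun M T (br c E)) s) (FOb (base_fun M T (br d E)) s)
      (R (FOb E s) c d) (FHom (base_fun M T (br c E)) t s \<cdot> a) =
    W.gc S (FOb (base_fun M T (br c E)) t) (FOb (base_fun M T (br d E)) t) (FOb (base_fun M T (br d E)) s)
      (FHom (base_fun M T (br d E)) t s \<cdot> a) (R (FOb E t) c d) \<cdot> Symm W (MOb M (VHom C d c)) P"
    using bm.R_L_commute[OF cd E_ob[OF E t] E_ob[OF E s] W.idn_in[OF u] E_arr[OF E t s a']]
      br_hom[OF E c t s a'] br_hom[OF E d t s a'] Ri Ri' E t s by (simp add: Hom_iff)
qed

lemma bl_simps [simp]: "c \<in> VOb C \<Longrightarrow> FOb (bl E) c = br c E"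
  by (simp add: bracket_left_def)

text \<open>\<open>pr_lift\<close> gives an arrow of \<open>W\<close> between objects in the image
  of \<open>M\<close>, and fullness brings it down to \<open>V\<close>. With uniqueness from
  \<open>pr_ext\<close> and faithfulness, the description in \<open>bracket_left\<close>
  denotes.\<close>

lemma bl_hom:
  assumes E: "E \<in> algs" and c: "c \<in> VOb C" and d: "d \<in> VOb C"
  shows bl_in: "FHom (bl E) c d \<in> Hom V (VHom C d c) (VHom TA (br c E) (br d E))"
    and bl_pr: "t \<in> VOb T \<Longrightarrow> pr (br c E) (br d E) t \<cdot> MArr M (FHom (bl E) c d) = R (FOb E t) c d"
proof -
  note bc = br_TA[OF E c] and bd = br_TA[OF E d]
  note dc = V.vcat_hom[OF C d c] and tt = V.vcat_hom[OF TA_vcat bc bd]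
  let ?P = "\<lambda>u. u \<in> Hom V (VHom C d c) (VHom TA (br c E) (br d E)) \<and>
    (\<forall>t\<in>VOb T. pr (br c E) (br d E) t \<cdot> MArr M u = R (FOb E t) c d)"
  obtain h where h: "h \<in> Hom W (MOb M (VHom C d c)) (MOb M (VHom TA (br c E) (br d E)))"
    and hR: "\<And>t. t \<in> VOb T \<Longrightarrow> pr (br c E) (br d E) t \<cdot> h = R (FOb E t) c d"
    using pr_lift[OF bc bd R_family[OF E c d]] by blast
  obtain u where "u \<in> Hom V (VHom C d c) (VHom TA (br c E) (br d E))" "MArr M u = h"
    using M_full[OF dc tt h] by blast
  then have u: "?P u" using hR by simp
  have "v = u" if v: "?P v" for v
  proof (rule M_faithful)
    show "v \<in> Hom V (VHom C d c) (VHom TA (br c E) (br d E))"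
      "u \<in> Hom V (VHom C d c) (VHom TA (br c E) (br d E))" using u v by blast+
    then show "MArr M v = MArr M u"
      using u v by (intro pr_ext[OF bc bd M_in M_in]) auto
  qed
  with u have "?P (THE u. ?P u)" by (rule theI[of ?P])
  then have "?P (FHom (bl E) c d)" using c d by (simp add: bracket_left_def)
  then show "FHom (bl E) c d \<in> Hom V (VHom C d c) (VHom TA (br c E) (br d E))"
    "t \<in> VOb T \<Longrightarrow> pr (br c E) (br d E) t \<cdot> MArr M (FHom (bl E) c d) = R (FOb E t) c d"
    by blast+
qed

text \<open>\<open>functor_reflect\<close> moves the axioms to \<open>W\<close> and
  \<open>pr_ext\<close> tests them at each \<open>t\<close>, where they express functoriality of
  \<open>C(-, E t)\<close>.\<close>

lemma bl_functor:
  assumes E: "E \<in> algs"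
  shows "is_vfunctor V (vop V C) TA (bl E)"
proof (rule functor_reflect[OF V.vop_vcat[OF C] TA_vcat])
  show "bl E = restrict_vfun (vop V C) (FOb (bl E)) (FHom (bl E))"
    unfolding bracket_left_def by (rule V.restrict_vfun_idem)
next
  fix c assume "c \<in> VOb (vop V C)"
  then have c: "c \<in> VOb C" and cB: "c \<in> VOb (base C)" by simp_all
  note bc = br_TA[OF E c]
  show "FOb (bl E) c \<in> VOb TA" using bc c by simp
  note u = M_in[OF bl_in[OF E c c]]
  have i: "VId (base C) c \<in> Hom W (TUnit W) (MOb M (VHom C c c))"
    using W.vcat_id[OF bm.A cB cB] by simp
  have i': "VId (base TA) (br c E) \<in> Hom W (TUnit W) (MOb M (VHom TA (br c E) (br c E)))"
    using W.vcat_id[OF TA_base, of "br c E" "br c E"] bc by simp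
  have e: "VId (base (vop V C)) c = VId (base C) c" by (simp add: base_cat_def)
  have "MArr M (FHom (bl E) c c) \<cdot> VId (base C) c = VId (base TA) (br c E)"
  proof (rule pr_ext[OF bc bc W.comp_in[OF i u] i'])
    fix t assume t: "t \<in> VOb T"
    have "pr (br c E) (br c E) t \<cdot> MArr M (FHom (bl E) c c) \<cdot> VId (base C) c =
        (pr (br c E) (br c E) t \<cdot> MArr M (FHom (bl E) c c)) \<cdot> VId (base C) c"
      using pr_in[OF bc bc t] u i by (simp add: Hom_iff W.comp_assoc)
    then show "pr (br c E) (br c E) t \<cdot> MArr M (FHom (bl E) c c) \<cdot> VId (base C) c =
        pr (br c E) (br c E) t \<cdot> VId (base TA) (br c E)"
      using bl_pr[OF E c c t] bs.rep_id[OF bm.R[OF E_ob[OF E t]] W.vop_vcat[OF bm.A], of c] pr_id[OF bc t]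
        E t c by simp
  qed
  then show "MArr M (FHom (bl E) c c) \<cdot> VId (base (vop V C)) c = VId (base TA) (FOb (bl E) c)"
    using c e by simp
next
  fix c d assume "c \<in> VOb (vop V C)" "d \<in> VOb (vop V C)"
  then show "FHom (bl E) c d \<in> Hom V (VHom (vop V C) c d) (VHom TA (FOb (bl E) c) (FOb (bl E) d))"
    using bl_in[OF E, of c d] by simp
next
  fix c d e assume "c \<in> VOb (vop V C)" "d \<in> VOb (vop V C)" "e \<in> VOb (vop V C)"
  then have c: "c \<in> VOb C" and d: "d \<in> VOb C" and e: "e \<in> VOb C" by simp_all
  let ?B = "vop W (base C)"
  note B = W.vop_vcat[OF bm.A]
  have o: "c \<in> VOb ?B" "d \<in> VOb ?B" "e \<in> VOb ?B" using c d e by simp_all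
  note bc = br_TA[OF E c] and bd = br_TA[OF E d] and be = br_TA[OF E e]
  note u = M_in[OF bl_in[OF E d e]] M_in[OF bl_in[OF E c d]] M_in[OF bl_in[OF E c e]]
  have hd: "VHom ?B d e \<in> Obj W" "VHom ?B c d \<in> Obj W"
    using W.vcat_hom[OF B o(2,3)] W.vcat_hom[OF B o(1,2)] by blast+
  note cB = W.vcat_comp[OF B o]
  have cB': "VComp ?B c d e \<in> Hom W (MOb M (VHom C e d) \<otimes> MOb M (VHom C d c)) (MOb M (VHom C e c))"
    using cB by simp
  have eq: "VComp (base (vop V C)) c d e = VComp ?B c d e"
    by (rule base_vop_comp[OF C c d e])
  have o': "br c E \<in> VOb (base TA)" "br d E \<in> VOb (base TA)" "br e E \<in> VOb (base TA)"
    using bc bd be by simp_all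
  have g: "W.gc (base TA) (br c E) (br d E) (br e E) (MArr M (FHom (bl E) d e)) (MArr M (FHom (bl E) c d)) \<in>
      Hom W (MOb M (VHom C e d) \<otimes> MOb M (VHom C d c)) (MOb M (VHom TA (br c E) (br e E)))"
    using W.gc_in[OF TA_base o'] u by simp
  have "MArr M (FHom (bl E) c e) \<cdot> VComp ?B c d e =
    W.gc (base TA) (br c E) (br d E) (br e E) (MArr M (FHom (bl E) d e)) (MArr M (FHom (bl E) c d))"
  proof (rule pr_ext[OF bc be W.comp_in[OF cB' u(3)] g])
    fix t assume t: "t \<in> VOb T"
    note rep = bm.R[OF E_ob[OF E t]]
    have "pr (br c E) (br e E) t \<cdot> MArr M (FHom (bl E) c e) \<cdot> VComp ?B c d e =
        R (FOb E t) c e \<cdot> VComp ?B c d e"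
      unfolding bl_pr[OF E c e t, symmetric]
      using pr_in[OF bc be t] u cB' by (simp add: Hom_iff W.comp_assoc)
    also have "\<dots> = W.gc S (VHom C c (FOb E t)) (VHom C d (FOb E t)) (VHom C e (FOb E t))
        (R (FOb E t) d e) (R (FOb E t) c d)"
      using bs.rep_gc[OF rep B o W.idn_in[OF hd(1)] W.idn_in[OF hd(2)]] W.gc_Idn[OF B o]
        bs.is_repD(4)[OF rep o(2,3)] bs.is_repD(4)[OF rep o(1,2)] by (simp add: Hom_iff)
    also have "\<dots> = pr (br c E) (br e E) t \<cdot>
        W.gc (base TA) (br c E) (br d E) (br e E) (MArr M (FHom (bl E) d e)) (MArr M (FHom (bl E) c d))"
      using pr_gc[OF bc bd be t u(1,2)] bl_pr[OF E d e t] bl_pr[OF E c d t] E t by simp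
    finally show "pr (br c E) (br e E) t \<cdot> MArr M (FHom (bl E) c e) \<cdot> VComp ?B c d e = \<dots>" .
  qed
  then show "MArr M (FHom (bl E) c e) \<cdot> VComp (base (vop V C)) c d e =
      W.gc (base TA) (FOb (bl E) c) (FOb (bl E) d) (FOb (bl E) e)
        (MArr M (FHom (bl E) d e)) (MArr M (FHom (bl E) c d))"
    using c d e eq by simp
qed

text \<open>The component of \<open>Y\<close> at \<open>c\<close>.\<close>
abbreviation right where "right c E F \<equiv> FHom (bracket_right V W M J T C TA \<phi> c) E F"

text \<open>The projections of \<open>TC\<close> are natural in \<open>t\<close>, and functoriality
  of \<open>C(c,-)\<close> transports this naturality.\<close>

lemma L_family:
  assumes E: "E \<in> algs" and F: "F \<in> algs" and c: "c \<in> VOb C"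
  shows "nat_family W (base T) S (base_fun M T (br c E)) (base_fun M T (br c F))
    (TC.hom E F) (\<lambda>t. L c (FOb E t) (FOb F t) \<cdot> TC.\<pi> E F t)"
proof (rule W.nat_familyI[OF base_functor base_functor])
  have cB: "c \<in> VOb (base C)" using c by simp
  note E' = alg_functor[OF E] and F' = alg_functor[OF F]
  note rep = bm.L[OF cB]
  show "is_vfunctor V T (vself V) (br c E)" "is_vfunctor V T (vself V) (br c F)"
    using TA_functor br_TA[OF E c] br_TA[OF F c] by blast+
  show "TC.hom E F \<in> Obj W" by (rule TC.hom_obj[OF E' F'])
  have p: "TC.\<pi> E F t \<in> Hom W (TC.hom E F) (VHom (base C) (FOb E t) (FOb F t))" if "t \<in> VOb T" for t
    using TC.proj_in[OF E' F' that] by simp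
  fix t assume "t \<in> VOb (base T)"
  then have t: "t \<in> VOb T" by simp
  show "L c (FOb E t) (FOb F t) \<cdot> TC.\<pi> E F t \<in> Hom W (TC.hom E F)
      (VHom S (FOb (base_fun M T (br c E)) t) (FOb (base_fun M T (br c F)) t))"
    using W.comp_in[OF p[OF t] bm.L_in[OF cB E_ob[OF E t] E_ob[OF F t]]] E F t by simp
  fix s P a assume "s \<in> VOb (base T)" and a: "a \<in> Hom W P (VHom (base T) t s)"
  then have s: "s \<in> VOb T" and a': "a \<in> Hom W P (MOb M (VHom T t s))" by simp_all
  note oE = E_ob[OF E t] E_ob[OF E s] and oF = E_ob[OF F t] E_ob[OF F s]
  note Ea = E_arr[OF E t s a'] and Fa = E_arr[OF F t s a']
  have nat: "W.gc (base C) (FOb E t) (FOb E s) (FOb F s) (TC.\<pi> E F s) (MArr M (FHom E t s) \<cdot> a) =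
      W.gc (base C) (FOb E t) (FOb F t) (FOb F s) (MArr M (FHom F t s) \<cdot> a) (TC.\<pi> E F t) \<cdot>
        Symm W (TC.hom E F) P"
    using W.nat_gc[OF base_functor[OF E'] base_functor[OF F'] TC.proj_family[OF E' F'], of t s a P] t s a' by simp
  have "W.gc S (VHom C c (FOb E t)) (VHom C c (FOb E s)) (VHom C c (FOb F s))
      (L c (FOb E s) (FOb F s) \<cdot> TC.\<pi> E F s) (L c (FOb E t) (FOb E s) \<cdot> (MArr M (FHom E t s) \<cdot> a)) =
    L c (FOb E t) (FOb F s) \<cdot> (W.gc (base C) (FOb E t) (FOb F t) (FOb F s)
      (MArr M (FHom F t s) \<cdot> a) (TC.\<pi> E F t) \<cdot> Symm W (TC.hom E F) P)"
    using bs.rep_gc[OF rep bm.A oE oF(2) p[OF s] Ea] nat by simp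
  also have "\<dots> = W.gc S (VHom C c (FOb E t)) (VHom C c (FOb F t)) (VHom C c (FOb F s))
      (L c (FOb F t) (FOb F s) \<cdot> (MArr M (FHom F t s) \<cdot> a)) (L c (FOb E t) (FOb F t) \<cdot> TC.\<pi> E F t) \<cdot>
      Symm W (TC.hom E F) P"
    unfolding bs.rep_gc[OF rep bm.A oE(1) oF Fa p[OF t], symmetric]
    using W.gc_in[OF bm.A oE(1) oF Fa p[OF t]] bm.L_in[OF cB oE(1) oF(2)] TC.hom_obj[OF E' F'] W.hom_obj(1)[OF a]
    by (simp add: Hom_iff W.comp_assoc)
  finally show "W.gc S (FOb (base_fun M T (br c E)) t) (FOb (base_fun M T (br c E)) s) (FOb (base_fun M T (br c F)) s)
      (L c (FOb E s) (FOb F s) \<cdot> TC.\<pi> E F s) (FHom (base_fun M T (br c E)) t s \<cdot> a) =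
    W.gc S (FOb (base_fun M T (br c E)) t) (FOb (base_fun M T (br c F)) t) (FOb (base_fun M T (br c F)) s)
      (FHom (base_fun M T (br c F)) t s \<cdot> a) (L c (FOb E t) (FOb F t) \<cdot> TC.\<pi> E F t) \<cdot>
      Symm W (TC.hom E F) P"
    unfolding br_hom[OF E c t s a'] br_hom[OF F c t s a'] using E F t s by simp
qed

lemma right_hom:
  assumes E: "E \<in> algs" and F: "F \<in> algs" and c: "c \<in> VOb C"
  shows right_in: "right c E F \<in> Hom W (TC.hom E F) (MOb M (VHom TA (br c E) (br c F)))"
    and right_pr: "t \<in> VOb T \<Longrightarrow> pr (br c E) (br c F) t \<cdot> right c E F = L c (FOb E t) (FOb F t) \<cdot> TC.\<pi> E F t"
proof -
  note bE = br_TA[OF E c] and bF = br_TA[OF F c]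
  let ?P = "\<lambda>u. u \<in> Hom W (TC.hom E F) (MOb M (VHom TA (br c E) (br c F))) \<and>
    (\<forall>t\<in>VOb T. pr (br c E) (br c F) t \<cdot> u = L c (FOb E t) (FOb F t) \<cdot> TC.\<pi> E F t)"
  obtain u where u: "?P u"
    using pr_lift[OF bE bF L_family[OF E F c]] by (elim exE)
  have "w = u" if w: "?P w" for w
  proof (rule pr_ext[OF bE bF conjunct1[OF w] conjunct1[OF u]])
    fix t assume "t \<in> VOb T"
    then show "pr (br c E) (br c F) t \<cdot> w = pr (br c E) (br c F) t \<cdot> u"
      using conjunct2[OF u] conjunct2[OF w] by metis
  qed
  with u have "?P (THE u. ?P u)" by (rule theI[of ?P])
  then have "?P (right c E F)" using E F by (simp add: bracket_right_def)
  then show "right c E F \<in> Hom W (TC.hom E F) (MOb M (VHom TA (br c E) (br c F)))"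
    "t \<in> VOb T \<Longrightarrow> pr (br c E) (br c F) t \<cdot> right c E F = L c (FOb E t) (FOb F t) \<cdot> TC.\<pi> E F t"
    by blast+
qed

text \<open>Tested at \<open>t\<close>, naturality in \<open>c\<close> says that post-composition
  with an element of \<open>C(E t, F t)\<close> commutes with pre-composition, which is
  \<open>L_R_commute\<close>.\<close>

lemma right_family:
  assumes E: "E \<in> algs" and F: "F \<in> algs"
  shows "nat_family W (base (vop V C)) (base TA) (base_fun M (vop V C) (bl E)) (base_fun M (vop V C) (bl F))
    (TC.hom E F) (\<lambda>c. right c E F)"
proof (rule W.nat_familyI'[OF base_functor[OF bl_functor[OF E]] base_functor[OF bl_functor[OF F]]])
  note E' = alg_functor[OF E] and F' = alg_functor[OF F]
  note X = TC.hom_obj[OF E' F']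
  show "TC.hom E F \<in> Obj W" by (rule X)
  fix c assume "c \<in> VOb (base (vop V C))"
  then have c: "c \<in> VOb C" and cB: "c \<in> VOb (base C)" by simp_all
  show "right c E F \<in> Hom W (TC.hom E F) (VHom (base TA) (FOb (base_fun M (vop V C) (bl E)) c)
      (FOb (base_fun M (vop V C) (bl F)) c))"
    using right_in[OF E F c] c by simp
  fix d assume "d \<in> VOb (base (vop V C))"
  then have d: "d \<in> VOb C" and dB: "d \<in> VOb (base C)" by simp_all
  note bcE = br_TA[OF E c] and bcF = br_TA[OF F c] and bdE = br_TA[OF E d] and bdF = br_TA[OF F d]
  have o: "br c E \<in> VOb (base TA)" "br c F \<in> VOb (base TA)" "br d E \<in> VOb (base TA)" "br d F \<in> VOb (base TA)"
    using bcE bcF bdE bdF by simp_all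
  note uE = M_in[OF bl_in[OF E c d]] and uF = M_in[OF bl_in[OF F c d]]
  note vc = right_in[OF E F c] and vd = right_in[OF E F d]
  have U: "MOb M (VHom C d c) \<in> Obj W" using V.vcat_hom[OF C d c] by simp
  have s: "Symm W (TC.hom E F) (MOb M (VHom C d c)) \<in>
      Hom W (TC.hom E F \<otimes> MOb M (VHom C d c)) (MOb M (VHom C d c) \<otimes> TC.hom E F)"
    using X U by (simp add: Hom_iff)
  have l: "W.gc (base TA) (br c E) (br d E) (br d F) (right d E F) (MArr M (FHom (bl E) c d)) \<in>
      Hom W (TC.hom E F \<otimes> MOb M (VHom C d c)) (MOb M (VHom TA (br c E) (br d F)))"
    using W.gc_in[OF TA_base o(1,3,4)] vd uE by simp
  have r: "W.gc (base TA) (br c E) (br c F) (br d F) (MArr M (FHom (bl F) c d)) (right c E F) \<in>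
      Hom W (MOb M (VHom C d c) \<otimes> TC.hom E F) (MOb M (VHom TA (br c E) (br d F)))"
    using W.gc_in[OF TA_base o(1,2,4)] vc uF by simp
  have "W.gc (base TA) (br c E) (br d E) (br d F) (right d E F) (MArr M (FHom (bl E) c d)) =
      W.gc (base TA) (br c E) (br c F) (br d F) (MArr M (FHom (bl F) c d)) (right c E F) \<cdot>
        Symm W (TC.hom E F) (MOb M (VHom C d c))"
  proof (rule pr_ext[OF bcE bdF l W.comp_in[OF s r]])
    fix t assume t: "t \<in> VOb T"
    have p: "TC.\<pi> E F t \<in> Hom W (TC.hom E F) (VHom (base C) (FOb E t) (FOb F t))"
      using TC.proj_in[OF E' F' t] by simp
    have i: "Idn W (MOb M (VHom C d c)) \<in> Hom W (MOb M (VHom C d c)) (VHom (base C) d c)"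
      using W.idn_in[OF U] by simp
    note eo = E_ob[OF E t] and fo = E_ob[OF F t]
    have "pr (br c E) (br d F) t \<cdot> W.gc (base TA) (br c E) (br d E) (br d F) (right d E F) (MArr M (FHom (bl E) c d)) =
        W.gc S (VHom C c (FOb E t)) (VHom C d (FOb E t)) (VHom C d (FOb F t))
          (L d (FOb E t) (FOb F t) \<cdot> TC.\<pi> E F t) (R (FOb E t) c d)"
      using pr_gc[OF bcE bdE bdF t vd uE] right_pr[OF E F d t] bl_pr[OF E c d t] E F t by simp
    also have "\<dots> = W.gc S (VHom C c (FOb E t)) (VHom C c (FOb F t)) (VHom C d (FOb F t))
          (R (FOb F t) c d) (L c (FOb E t) (FOb F t) \<cdot> TC.\<pi> E F t) \<cdot> Symm W (TC.hom E F) (MOb M (VHom C d c))"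
      using bm.L_R_commute[OF cB dB eo fo i p] bm.R_in[OF eo cB dB] bm.R_in[OF fo cB dB]
      by (simp add: Hom_iff)
    also have "\<dots> = (pr (br c E) (br d F) t \<cdot>
        W.gc (base TA) (br c E) (br c F) (br d F) (MArr M (FHom (bl F) c d)) (right c E F)) \<cdot>
        Symm W (TC.hom E F) (MOb M (VHom C d c))"
      using pr_gc[OF bcE bcF bdF t uF vc] right_pr[OF E F c t] bl_pr[OF F c d t] E F t by simp
    also have "\<dots> = pr (br c E) (br d F) t \<cdot>
        W.gc (base TA) (br c E) (br c F) (br d F) (MArr M (FHom (bl F) c d)) (right c E F) \<cdot>
        Symm W (TC.hom E F) (MOb M (VHom C d c))"
      using pr_in[OF bcE bdF t] r s by (simp add: Hom_iff W.comp_assoc)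
    finally show "pr (br c E) (br d F) t \<cdot>
        W.gc (base TA) (br c E) (br d E) (br d F) (right d E F) (MArr M (FHom (bl E) c d)) = \<dots>" .
  qed
  then show "W.gc (base TA) (FOb (base_fun M (vop V C) (bl E)) c) (FOb (base_fun M (vop V C) (bl E)) d)
      (FOb (base_fun M (vop V C) (bl F)) d) (right d E F) (FHom (base_fun M (vop V C) (bl E)) c d) =
    W.gc (base TA) (FOb (base_fun M (vop V C) (bl E)) c) (FOb (base_fun M (vop V C) (bl F)) c)
      (FOb (base_fun M (vop V C) (bl F)) d) (FHom (base_fun M (vop V C) (bl F)) c d) (right c E F) \<cdot>
      Symm W (TC.hom E F) (VHom (base (vop V C)) c d)"
    using c d by simp
qed

text \<open>The action on hom-objects is prescribed through its projections, so that its component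
  at \<open>c\<close> is \<open>bracket_right\<close> by construction; \<open>right_family\<close>
  is what makes the description denote.\<close>

definition Y :: "('b, ('a, 'o, 'c) vfun, ('a, 'c, ('a, 'o, 'o) vfun) vfun) vfun" where
  "Y = restrict_vfun (Alg V W M J T C) bl (\<lambda>E F. THE h. h \<in> Hom W (TC.hom E F) (CT.hom (bl E) (bl F)) \<and>
    (\<forall>c\<in>VOb (vop V C). CT.\<pi> (bl E) (bl F) c \<cdot> h = right c E F))"

lemma Y_ob [simp]: "E \<in> algs \<Longrightarrow> FOb Y E = bl E"
  by (simp add: Y_def)

lemma Y_hom:
  assumes E: "E \<in> algs" and F: "F \<in> algs"
  shows Y_in: "FHom Y E F \<in> Hom W (TC.hom E F) (CT.hom (bl E) (bl F))"
    and Y_proj: "c \<in> VOb C \<Longrightarrow> CT.\<pi> (bl E) (bl F) c \<cdot> FHom Y E F = right c E F"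
  using theI'[OF CT.proj_lift[OF bl_functor[OF E] bl_functor[OF F] right_family[OF E F]]] E F
  by (simp_all add: Y_def)

lemma CT_proj_in:
  assumes E: "E \<in> algs" and F: "F \<in> algs" and c: "c \<in> VOb C"
  shows "CT.\<pi> (bl E) (bl F) c \<in> Hom W (CT.hom (bl E) (bl F)) (MOb M (VHom TA (br c E) (br c F)))"
  using CT.proj_in[OF bl_functor[OF E] bl_functor[OF F], of c] c by simp

text \<open>Projecting first at \<open>c\<close> and then at \<open>t\<close> is jointly monic,
  since each of the two stages is.\<close>

lemma Y_ext:
  assumes E: "E \<in> algs" and F: "F \<in> algs"
    and h: "h \<in> Hom W Z (CT.hom (bl E) (bl F))" and k: "k \<in> Hom W Z (CT.hom (bl E) (bl F))"
    and eq: "\<And>c t. c \<in> VOb C \<Longrightarrow> t \<in> VOb T \<Longrightarrow>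
      pr (br c E) (br c F) t \<cdot> CT.\<pi> (bl E) (bl F) c \<cdot> h =
      pr (br c E) (br c F) t \<cdot> CT.\<pi> (bl E) (bl F) c \<cdot> k"
  shows "h = k"
proof (rule CT.proj_ext[OF bl_functor[OF E] bl_functor[OF F] h k])
  fix c assume "c \<in> VOb (vop V C)"
  then have c: "c \<in> VOb C" by simp
  note p = CT_proj_in[OF E F c]
  show "CT.\<pi> (bl E) (bl F) c \<cdot> h = CT.\<pi> (bl E) (bl F) c \<cdot> k"
    by (rule pr_ext[OF br_TA[OF E c] br_TA[OF F c] W.comp_in[OF h p] W.comp_in[OF k p] eq[OF c]])
qed

text \<open>Seen through both projections, \<open>Y\<close> is post-composition in \<open>C\<close>.
  This formula reduces functoriality and full faithfulness of \<open>Y\<close> to facts about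
  \<open>L\<close>.\<close>

lemma Y_pr:
  assumes E: "E \<in> algs" and F: "F \<in> algs" and c: "c \<in> VOb C" and t: "t \<in> VOb T"
    and h: "h \<in> Hom W Z (TC.hom E F)"
  shows "pr (br c E) (br c F) t \<cdot> CT.\<pi> (bl E) (bl F) c \<cdot> FHom Y E F \<cdot> h =
    L c (FOb E t) (FOb F t) \<cdot> TC.\<pi> E F t \<cdot> h"
proof -
  note p = pr_in[OF br_TA[OF E c] br_TA[OF F c] t]
  have cB: "c \<in> VOb (base C)" using c by simp
  note l = bm.L_in[OF cB E_ob[OF E t] E_ob[OF F t]]
  have "pr (br c E) (br c F) t \<cdot> CT.\<pi> (bl E) (bl F) c \<cdot> FHom Y E F \<cdot> h =
      pr (br c E) (br c F) t \<cdot> (CT.\<pi> (bl E) (bl F) c \<cdot> FHom Y E F) \<cdot> h"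
    using CT_proj_in[OF E F c] Y_in[OF E F] h by (simp add: Hom_iff W.comp_assoc)
  also have "\<dots> = (pr (br c E) (br c F) t \<cdot> right c E F) \<cdot> h"
    unfolding Y_proj[OF E F c] using p right_in[OF E F c] h by (simp add: Hom_iff W.comp_assoc)
  also have "\<dots> = L c (FOb E t) (FOb F t) \<cdot> TC.\<pi> E F t \<cdot> h"
    unfolding right_pr[OF E F c t]
    using l TC.proj_in[OF alg_functor[OF E] alg_functor[OF F] t] h by (simp add: Hom_iff W.comp_assoc)
  finally show ?thesis .
qed

lemma Alg_vcat: "is_vcat W (Alg V W M J T C)"
  unfolding Alg_def by (rule W.full_sub_vcat[OF TC.fun_cat_vcat]) (auto simp: algebras_def)

text \<open>By \<open>Y_ext\<close> and \<open>Y_pr\<close> the axioms become those of the functors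
  \<open>C(c,-)\<close> at each pair \<open>c\<close>, \<open>t\<close>.\<close>

lemma Y_functor: "is_vfunctor W (Alg V W M J T C) CT.K Y"
proof (rule W.vfunctorI[OF Alg_vcat CT.fun_cat_vcat])
  show "Y = restrict_vfun (Alg V W M J T C) (FOb Y) (FHom Y)"
    unfolding Y_def by (rule V.restrict_vfun_idem)
next
  fix E assume "E \<in> VOb (Alg V W M J T C)"
  then have E: "E \<in> algs" by simp
  note E' = alg_functor[OF E] and bE = bl_functor[OF E]
  show "FOb Y E \<in> VOb CT.K" using E bE by simp
  note i = TC.fun_id(1)[OF E'] and i' = CT.fun_id(1)[OF bE]
  have "FHom Y E E \<cdot> VId TC.K E = VId CT.K (bl E)"
  proof (rule Y_ext[OF E E W.comp_in[OF i Y_in[OF E E]] i'])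
    fix c t assume c: "c \<in> VOb C" and t: "t \<in> VOb T"
    have cB: "c \<in> VOb (base C)" using c by simp
    have "CT.\<pi> (bl E) (bl E) c \<cdot> VId CT.K (bl E) = VId (base TA) (br c E)"
      using CT.fun_id(2)[OF bE, of c] c by simp
    then show "pr (br c E) (br c E) t \<cdot> CT.\<pi> (bl E) (bl E) c \<cdot> FHom Y E E \<cdot> VId TC.K E =
        pr (br c E) (br c E) t \<cdot> CT.\<pi> (bl E) (bl E) c \<cdot> VId CT.K (bl E)"
      using Y_pr[OF E E c t i] TC.fun_id(2)[OF E' t] bs.rep_id[OF bm.L[OF cB] bm.A E_ob[OF E t]]
        pr_id[OF br_TA[OF E c] t] E t by simp
  qed
  then show "FHom Y E E \<cdot> VId (Alg V W M J T C) E = VId CT.K (FOb Y E)"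
    using E by simp
next
  fix E F assume "E \<in> VOb (Alg V W M J T C)" "F \<in> VOb (Alg V W M J T C)"
  then show "FHom Y E F \<in> Hom W (VHom (Alg V W M J T C) E F) (VHom CT.K (FOb Y E) (FOb Y F))"
    using Y_in by simp
next
  fix E F G P Q g f
  assume "E \<in> VOb (Alg V W M J T C)" "F \<in> VOb (Alg V W M J T C)" "G \<in> VOb (Alg V W M J T C)"
    and "g \<in> Hom W Q (VHom (Alg V W M J T C) F G)" and "f \<in> Hom W P (VHom (Alg V W M J T C) E F)"
  then have E: "E \<in> algs" and F: "F \<in> algs" and G: "G \<in> algs"
    and g: "g \<in> Hom W Q (TC.hom F G)" and f: "f \<in> Hom W P (TC.hom E F)" by simp_all
  note E' = alg_functor[OF E] and F' = alg_functor[OF F] and G' = alg_functor[OF G]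
  note bE = bl_functor[OF E] and bF = bl_functor[OF F] and bG = bl_functor[OF G]
  note Yg = W.comp_in[OF g Y_in[OF F G]] and Yf = W.comp_in[OF f Y_in[OF E F]]
  note gf = TC.gc_fun_in[OF E' F' G' g f]
  have "FHom Y E G \<cdot> W.gc TC.K E F G g f =
      W.gc CT.K (bl E) (bl F) (bl G) (FHom Y F G \<cdot> g) (FHom Y E F \<cdot> f)"
  proof (rule Y_ext[OF E G W.comp_in[OF gf Y_in[OF E G]] CT.gc_fun_in[OF bE bF bG Yg Yf]])
    fix c t assume c: "c \<in> VOb C" and t: "t \<in> VOb T"
    have cB: "c \<in> VOb (base C)" and co: "c \<in> VOb (vop V C)" using c by simp_all
    have pg: "TC.\<pi> F G t \<cdot> g \<in> Hom W Q (VHom (base C) (FOb F t) (FOb G t))"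
      and pf: "TC.\<pi> E F t \<cdot> f \<in> Hom W P (VHom (base C) (FOb E t) (FOb F t))"
      using W.comp_in[OF g TC.proj_in[OF F' G' t]] W.comp_in[OF f TC.proj_in[OF E' F' t]] by simp_all
    note cYg = W.comp_in[OF Yg CT_proj_in[OF F G c]] and cYf = W.comp_in[OF Yf CT_proj_in[OF E F c]]
    have "pr (br c E) (br c G) t \<cdot> CT.\<pi> (bl E) (bl G) c \<cdot> FHom Y E G \<cdot> W.gc TC.K E F G g f =
        L c (FOb E t) (FOb G t) \<cdot> W.gc (base C) (FOb E t) (FOb F t) (FOb G t)
          (TC.\<pi> F G t \<cdot> g) (TC.\<pi> E F t \<cdot> f)"
      by (simp add: Y_pr[OF E G c t gf] TC.proj_gc[OF E' F' G' g f t])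
    also have "\<dots> = W.gc S (VHom C c (FOb E t)) (VHom C c (FOb F t)) (VHom C c (FOb G t))
        (L c (FOb F t) (FOb G t) \<cdot> TC.\<pi> F G t \<cdot> g) (L c (FOb E t) (FOb F t) \<cdot> TC.\<pi> E F t \<cdot> f)"
      by (rule bs.rep_gc[OF bm.L[OF cB] bm.A E_ob[OF E t] E_ob[OF F t] E_ob[OF G t] pg pf])
    also have "\<dots> = pr (br c E) (br c G) t \<cdot> W.gc (base TA) (br c E) (br c F) (br c G)
        (CT.\<pi> (bl F) (bl G) c \<cdot> FHom Y F G \<cdot> g) (CT.\<pi> (bl E) (bl F) c \<cdot> FHom Y E F \<cdot> f)"
      using pr_gc[OF br_TA[OF E c] br_TA[OF F c] br_TA[OF G c] t cYg cYf]
        Y_pr[OF F G c t g] Y_pr[OF E F c t f] E F G t by simp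
    also have "\<dots> = pr (br c E) (br c G) t \<cdot> CT.\<pi> (bl E) (bl G) c \<cdot>
        W.gc CT.K (bl E) (bl F) (bl G) (FHom Y F G \<cdot> g) (FHom Y E F \<cdot> f)"
      using CT.proj_gc[OF bE bF bG Yg Yf co] c by simp
    finally show "pr (br c E) (br c G) t \<cdot> CT.\<pi> (bl E) (bl G) c \<cdot> FHom Y E G \<cdot> W.gc TC.K E F G g f = \<dots>" .
  qed
  then show "FHom Y E G \<cdot> W.gc (Alg V W M J T C) E F G g f =
      W.gc CT.K (FOb Y E) (FOb Y F) (FOb Y G) (FHom Y F G \<cdot> g) (FHom Y E F \<cdot> f)"
    using E F G by simp
qed

lemma Y_iso:
  assumes E: "E \<in> algs" and F: "F \<in> algs"
  shows "is_iso W (FHom Y E F)"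
proof (rule W.iso_if_universal[OF Y_in[OF E F]])
  note E' = alg_functor[OF E] and F' = alg_functor[OF F]
  fix Z g assume g: "g \<in> Hom W Z (CT.hom (bl E) (bl F))"
  note Z = W.hom_obj(1)[OF g]
  define q where "q c t = pr (br c E) (br c F) t \<cdot> CT.\<pi> (bl E) (bl F) c \<cdot> g" for c t
  note g_in = W.comp_in[OF g CT_proj_in[OF E F]]
  have q_in: "q c t \<in> Hom W Z (VHom S (VHom C c (FOb E t)) (VHom C c (FOb F t)))"
    if c: "c \<in> VOb C" and t: "t \<in> VOb T" for c t
    using W.comp_in[OF g_in[OF c] pr_in[OF br_TA[OF E c] br_TA[OF F c] t]] E F t by (simp add: q_def)
  \<comment> \<open>The family that \<open>g\<close> induces is natural over \<open>vop V C\<close>;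
    applying \<open>pr\<close> at \<open>t\<close> turns this into the hypothesis of
    \<open>bm.yoneda\<close>.\<close>
  have q_nat: "W.gc S (VHom C c (FOb E t)) (VHom C d (FOb E t)) (VHom C d (FOb F t)) (q d t) (R (FOb E t) c d \<cdot> u) =
      W.gc S (VHom C c (FOb E t)) (VHom C c (FOb F t)) (VHom C d (FOb F t)) (R (FOb F t) c d \<cdot> u) (q c t) \<cdot> Symm W Z U"
    if t: "t \<in> VOb T" and c: "c \<in> VOb C" and d: "d \<in> VOb C" and u: "u \<in> Hom W U (MOb M (VHom C d c))" for t c d U u
  proof -
    note bcE = br_TA[OF E c] and bcF = br_TA[OF F c] and bdE = br_TA[OF E d] and bdF = br_TA[OF F d]
    have o: "br c E \<in> VOb (base TA)" "br c F \<in> VOb (base TA)" "br d F \<in> VOb (base TA)"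
      using bcE bcF bdF by simp_all
    note uE = W.comp_in[OF u M_in[OF bl_in[OF E c d]]] and uF = W.comp_in[OF u M_in[OF bl_in[OF F c d]]]
    have fam: "nat_family W (base (vop V C)) (base TA) (base_fun M (vop V C) (bl E)) (base_fun M (vop V C) (bl F))
        Z (\<lambda>c. CT.\<pi> (bl E) (bl F) c \<cdot> g)"
      by (rule W.nat_precomp[OF base_functor[OF bl_functor[OF E]] base_functor[OF bl_functor[OF F]]
        CT.proj_family[OF bl_functor[OF E] bl_functor[OF F]] g])
    have nat: "W.gc (base TA) (br c E) (br d E) (br d F) (CT.\<pi> (bl E) (bl F) d \<cdot> g) (MArr M (FHom (bl E) c d) \<cdot> u) =
        W.gc (base TA) (br c E) (br c F) (br d F) (MArr M (FHom (bl F) c d) \<cdot> u) (CT.\<pi> (bl E) (bl F) c \<cdot> g) \<cdot> Symm W Z U"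
      using W.nat_gc[OF base_functor[OF bl_functor[OF E]] base_functor[OF bl_functor[OF F]] fam, of c d u U] c d u by simp
    have Ru: "pr (br c G) (br d G) t \<cdot> MArr M (FHom (bl G) c d) \<cdot> u = R (FOb G t) c d \<cdot> u"
      if G: "G \<in> algs" for G
      unfolding bl_pr[OF G c d t, symmetric]
      using pr_in[OF br_TA[OF G c] br_TA[OF G d] t] M_in[OF bl_in[OF G c d]] u by (simp add: Hom_iff W.comp_assoc)
    have r: "W.gc (base TA) (br c E) (br c F) (br d F) (MArr M (FHom (bl F) c d) \<cdot> u) (CT.\<pi> (bl E) (bl F) c \<cdot> g) \<in>
        Hom W (U \<otimes> Z) (MOb M (VHom TA (br c E) (br d F)))"
      using W.gc_in[OF TA_base o] uF g_in[OF c] by simp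
    have "W.gc S (VHom C c (FOb E t)) (VHom C d (FOb E t)) (VHom C d (FOb F t)) (q d t) (R (FOb E t) c d \<cdot> u) =
        pr (br c E) (br d F) t \<cdot>
          W.gc (base TA) (br c E) (br d E) (br d F) (CT.\<pi> (bl E) (bl F) d \<cdot> g) (MArr M (FHom (bl E) c d) \<cdot> u)"
      using pr_gc[OF bcE bdE bdF t g_in[OF d] uE] Ru[OF E] E F t by (simp add: q_def)
    also have "\<dots> = (pr (br c E) (br d F) t \<cdot> W.gc (base TA) (br c E) (br c F) (br d F)
        (MArr M (FHom (bl F) c d) \<cdot> u) (CT.\<pi> (bl E) (bl F) c \<cdot> g)) \<cdot> Symm W Z U"
      unfolding nat using r pr_in[OF bcE bdF t] Z W.hom_obj(1)[OF u] by (simp add: Hom_iff W.comp_assoc)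
    also have "\<dots> = W.gc S (VHom C c (FOb E t)) (VHom C c (FOb F t)) (VHom C d (FOb F t))
        (R (FOb F t) c d \<cdot> u) (q c t) \<cdot> Symm W Z U"
      using pr_gc[OF bcE bcF bdF t uF g_in[OF c]] Ru[OF F] E F t by (simp add: q_def)
    finally show ?thesis .
  qed
  \<comment> \<open>Yoneda is applied at each \<open>t\<close> separately, so the resulting family
    carries no naturality in \<open>t\<close> yet.\<close>
  have "\<exists>a. a \<in> Hom W Z (VHom (base C) (FOb E t) (FOb F t)) \<and>
      (\<forall>c\<in>VOb C. L c (FOb E t) (FOb F t) \<cdot> a = q c t)" if t: "t \<in> VOb T" for t
  proof -
    obtain a where "a \<in> Hom W Z (VHom (base C) (FOb E t) (FOb F t))"
      "\<And>c. c \<in> VOb (base C) \<Longrightarrow> L c (FOb E t) (FOb F t) \<cdot> a = q c t"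
      by (rule bm.yoneda[OF E_ob[OF E t] E_ob[OF F t] Z, of "\<lambda>c. q c t"])
        (use q_in[OF _ t] q_nat[OF t] in auto)
    then show ?thesis by auto
  qed
  then obtain a where a: "\<And>t. t \<in> VOb T \<Longrightarrow> a t \<in> Hom W Z (VHom (base C) (FOb E t) (FOb F t))"
    and La: "\<And>c t. c \<in> VOb C \<Longrightarrow> t \<in> VOb T \<Longrightarrow> L c (FOb E t) (FOb F t) \<cdot> a t = q c t"
    by metis
  have "nat_family W (base T) (base C) (base_fun M T E) (base_fun M T F) Z a"
  proof (rule W.nat_familyI[OF base_functor[OF E'] base_functor[OF F'] Z])
    fix t assume "t \<in> VOb (base T)"
    then have t: "t \<in> VOb T" by simp
    show "a t \<in> Hom W Z (VHom (base C) (FOb (base_fun M T E) t) (FOb (base_fun M T F) t))"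
      using a[OF t] by simp
    fix s P x assume "s \<in> VOb (base T)" and x': "x \<in> Hom W P (VHom (base T) t s)"
    then have s: "s \<in> VOb T" and x: "x \<in> Hom W P (MOb M (VHom T t s))" by simp_all
    note oE = E_ob[OF E t] E_ob[OF E s] and oF = E_ob[OF F t] E_ob[OF F s]
    note Ex = E_arr[OF E t s x] and Fx = E_arr[OF F t s x]
    \<comment> \<open>One test object suffices: at \<open>c = E t\<close> the action
      \<open>L\<close> is injective by \<open>L_inject\<close>, and there naturality of
      \<open>q\<close> in \<open>t\<close> decides the equation.\<close>
    let ?c = "FOb E t"
    have c: "?c \<in> VOb C" using oE by simp
    note bE = br_TA[OF E c] and bF = br_TA[OF F c]
    note l = W.gc_in[OF bm.A oE oF(2) a[OF s] Ex] and r = W.gc_in[OF bm.A oE(1) oF Fx a[OF t]]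
    have sy: "Symm W Z P \<in> Hom W (Z \<otimes> P) (P \<otimes> Z)"
      using Z W.hom_obj(1)[OF x] by (simp add: Hom_iff)
    have "W.gc (base C) (FOb E t) (FOb E s) (FOb F s) (a s) (MArr M (FHom E t s) \<cdot> x) =
      W.gc (base C) (FOb E t) (FOb F t) (FOb F s) (MArr M (FHom F t s) \<cdot> x) (a t) \<cdot> Symm W Z P"
    proof (rule bm.L_inject[OF oE(1) oF(2) l W.comp_in[OF sy r]])
      have nat: "W.gc S (VHom C ?c (FOb E t)) (VHom C ?c (FOb E s)) (VHom C ?c (FOb F s)) (q ?c s)
          (FHom (base_fun M T (br ?c E)) t s \<cdot> x) =
        W.gc S (VHom C ?c (FOb E t)) (VHom C ?c (FOb F t)) (VHom C ?c (FOb F s))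
          (FHom (base_fun M T (br ?c F)) t s \<cdot> x) (q ?c t) \<cdot> Symm W Z P"
        using W.nat_gc[OF base_functor[OF TA_functor[OF bE]] base_functor[OF TA_functor[OF bF]]
          pr_family[OF bE bF g_in[OF c]], of t s x P] t s x' E F by (simp add: q_def)
      have "L ?c (FOb E t) (FOb F s) \<cdot>
          W.gc (base C) (FOb E t) (FOb E s) (FOb F s) (a s) (MArr M (FHom E t s) \<cdot> x) =
        W.gc S (VHom C ?c (FOb E t)) (VHom C ?c (FOb F t)) (VHom C ?c (FOb F s))
          (L ?c (FOb F t) (FOb F s) \<cdot> (MArr M (FHom F t s) \<cdot> x)) (L ?c (FOb E t) (FOb F t) \<cdot> a t) \<cdot> Symm W Z P"
        using bs.rep_gc[OF bm.L[OF oE(1)] bm.A oE oF(2) a[OF s] Ex] nat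
        by (simp add: br_hom[OF E c t s x] br_hom[OF F c t s x] La[OF c s] La[OF c t])
      also have "\<dots> = L ?c (FOb E t) (FOb F s) \<cdot>
        (W.gc (base C) (FOb E t) (FOb F t) (FOb F s) (MArr M (FHom F t s) \<cdot> x) (a t) \<cdot> Symm W Z P)"
        unfolding bs.rep_gc[OF bm.L[OF oE(1)] bm.A oE(1) oF Fx a[OF t], symmetric]
        using r sy bm.L_in[OF oE(1) oE(1) oF(2)] by (simp add: Hom_iff W.comp_assoc)
      finally show "L ?c (FOb E t) (FOb F s) \<cdot>
          W.gc (base C) (FOb E t) (FOb E s) (FOb F s) (a s) (MArr M (FHom E t s) \<cdot> x) = \<dots>" .
    qed
    then show "W.gc (base C) (FOb (base_fun M T E) t) (FOb (base_fun M T E) s) (FOb (base_fun M T F) s)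
        (a s) (FHom (base_fun M T E) t s \<cdot> x) =
      W.gc (base C) (FOb (base_fun M T E) t) (FOb (base_fun M T F) t) (FOb (base_fun M T F) s)
        (FHom (base_fun M T F) t s \<cdot> x) (a t) \<cdot> Symm W Z P"
      using t s by simp
  qed
  then obtain h where h: "h \<in> Hom W Z (TC.hom E F)" and ha: "\<And>t. t \<in> VOb T \<Longrightarrow> TC.\<pi> E F t \<cdot> h = a t"
    using TC.proj_lift[OF E' F'] by blast
  have "FHom Y E F \<cdot> h = g"
    by (rule Y_ext[OF E F W.comp_in[OF h Y_in[OF E F]] g])
      (simp add: Y_pr[OF E F _ _ h] ha La q_def)
  moreover have "k = h" if k: "k \<in> Hom W Z (TC.hom E F)" and "FHom Y E F \<cdot> k = g" for k
  proof (rule TC.proj_ext[OF E' F' k h])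
    fix t assume t: "t \<in> VOb T"
    \<comment> \<open>Again \<open>c = E t\<close> suffices by \<open>L_inject\<close>: the two
      projections have the same image because \<open>k\<close> and \<open>h\<close> are both sent to
      \<open>g\<close>.\<close>
    have c: "FOb E t \<in> VOb C" using E_ob[OF E t] by simp
    have pk: "TC.\<pi> E F t \<cdot> k \<in> Hom W Z (VHom (base C) (FOb E t) (FOb F t))"
      "TC.\<pi> E F t \<cdot> h \<in> Hom W Z (VHom (base C) (FOb E t) (FOb F t))"
      using W.comp_in[OF k TC.proj_in[OF E' F' t]] W.comp_in[OF h TC.proj_in[OF E' F' t]] by simp_all
    show "TC.\<pi> E F t \<cdot> k = TC.\<pi> E F t \<cdot> h"
      by (rule bm.L_inject[OF E_ob[OF E t] E_ob[OF F t] pk])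
        (simp add: that \<open>FHom Y E F \<cdot> h = g\<close> flip: Y_pr[OF E F c t k] Y_pr[OF E F c t h])
  qed
  ultimately show "\<exists>!h. h \<in> Hom W Z (TC.hom E F) \<and> FHom Y E F \<cdot> h = g"
    using h by blast
qed

end

theorem proposition3p9:
  fixes V :: "('o, 'a) smcc"
    and V' :: "('p, 'b) smcc"
    and \<iota> :: "('o, 'a, 'p, 'b) mon_functor"
    and J :: "'o set"
    and T :: "('o, 'a, 'o) vcat" and \<tau> :: "('a, 'o, 'o) vfun"
    and C :: "('o, 'a, 'c) vcat" and pw :: "'o \<Rightarrow> 'c \<Rightarrow> 'c" and \<kappa> :: "'o \<Rightarrow> 'c \<Rightarrow> 'a"
    and TAlg :: "('o, 'a, ('a, 'o, 'o) vfun) vcat"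
    and \<phi> :: "('b, ('a, 'o, 'o) vfun, ('a, 'o, 'o) vfun) vfun"
  assumes "is_smcc V" and "has_finite_limits V"
    and "is_smcc V'" and "infinite (UNIV :: 'u set)"
    and "has_limits TYPE('u) V'" and "has_colimits TYPE('u) V'"
    and "is_symmetric_strong_monoidal V V' \<iota>"
    and "is_fully_faithful V V' (MOb \<iota>) (MArr \<iota>)"
    and "preserves_limits TYPE('i) V V' \<iota>"
    and "is_system_of_arities V J" and "is_amenable V V' \<iota> J"
    and "is_theory V J T \<tau>"
    and "is_vcat V C" and "has_designated_powers V J C pw \<kappa>"
    and "alg_exists_as V V' \<iota> J T TAlg \<phi>"
    and "is_small TYPE('u) (VOb (vself V))" and "is_small TYPE('u) (VOb C)"
    and "is_small TYPE('u) (VOb TAlg)"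
  shows "\<exists>Y. is_vfunctor V' (Alg V V' \<iota> J T C) (fun_cat V V' \<iota> (vop V C) TAlg) Y \<and>
             vfully_faithful V' (Alg V V' \<iota> J T C) Y \<and>
             (\<forall>E\<in>algebras V J T C. FOb Y E = bracket_left V V' \<iota> T C TAlg \<phi> E) \<and>
             (\<forall>E\<in>algebras V J T C. \<forall>F\<in>algebras V J T C. \<forall>c\<in>VOb C.
                fun_proj V' \<iota> (vop V C) TAlg (FOb Y E) (FOb Y F) c \<cdot>\<^bsub>V'\<^esub> FHom Y E F =
                FHom (bracket_right V V' \<iota> J T C TAlg \<phi> c) E F)"
proof -
  interpret V: smcc V by unfold_locales fact
  interpret embedding V V' \<iota>
    using assms(3,7-9) by unfold_locales (auto simp: preserves_limits_def)
  have J: "J \<subseteq> Obj V" using assms(10) by (simp add: is_system_of_arities_def)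
  \<comment> \<open>The objects of \<open>T\<close> are those of \<open>J\<close>, hence objects of
    \<open>V\<close>, so smallness of the latter yields the ends over \<open>T\<close>.\<close>
  have T: "is_small TYPE('u) (VOb T)"
    using small_subset[OF assms(16)] assms(12) J by (simp add: is_theory_def)
  have vC: "is_small TYPE('u) (VOb (vop V C))" using assms(17) by simp
  interpret TC: functor_category V V' \<iota> T C by (rule functor_categoryI[OF assms(5,4) T])
  interpret TV: functor_category V V' \<iota> T "vself V" by (rule functor_categoryI[OF assms(5,4) T])
  interpret CT: functor_category V V' \<iota> "vop V C" TAlg by (rule functor_categoryI[OF assms(5,4) vC])
  interpret algebra_yoneda V V' \<iota> T C TAlg J \<phi>
    by unfold_locales (fact J assms(13,15))+
  show ?thesis
    using Y_functor Y_iso Y_proj by (intro exI[of _ Y]) (auto simp: vfully_faithful_def)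
qed

end
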